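(* Let $d\ge 2$, let $K\subset\mathrm{SL}(d,\mathbb R)$ be compact, and let $\mu$ be a Borel probability measure on $\mathrm{SL}(d,\mathbb R)$ with $\mathrm{supp}(\mu)\subset K$. Assume that $\mu$ is quasi-irreducible and $L_1(\mu)>L_2(\mu)$. Then the first Lyapunov exponent of random matrix products is Hölder continuous with respect to the measure in the Wasserstein distance near $\mu$: there are $\delta>0$, $C<\infty$ and $\theta>0$ such that for all Borel probability measures $\nu_1,\nu_2$ supported in $K$ with $W_1(\nu_i,\mu)<\delta$ ($i=1,2$), $$|L_1(\nu_1)-L_1(\nu_2)|\le C\,W_1(\nu_1,\nu_2)^{\theta}.$$
   Context: For a compactly supported Borel probability measure $\nu$ on $\mathrm{SL}(d,\mathbb R)$, let $X=\mathrm{SL}(d,\mathbb R)^{\mathbb Z}$ with the product measure $\nu^{\mathbb Z}$ and the two-sided shift $\sigma((x_n)_n)=(x_{n+1})_n$, and consider the cocycle with $A(x)=x_0$, so that $A^{(n)}(x)=A(\sigma^{n-1}x)\cdots A(\sigma x)A(x)=x_{n-1}\cdots x_1x_0$ is a product of i.i.d. random matrices with law $\nu$. The Lyapunov exponents $L_1(\nu)\ge L_2(\nu)\ge\dots\ge L_d(\nu)$ are the $\nu^{\mathbb Z}$-a.e. limits $L_k(\nu)=\lim_n\frac1n\log s_k(A^{(n)}(x))$, with $s_1\ge\dots\ge s_d$ the singular values. Quasi-irreducible: either there is no proper (nonzero) subspace $V\subset\mathbb R^d$ invariant under all matrices in $\mathrm{supp}(\mu)$, or the only invariant proper subspace realizes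 the first Lyapunov exponent, i.e. the first Lyapunov exponent of the cocycle restricted to that subspace equals $L_1(\mu)$. $W_1(\mu,\nu)=\inf_\pi\int \|g-h\|\,d\pi(g,h)$ over all couplings $\pi$ of $\mu$ and $\nu$. *)

theory Defs
  imports "HOL-Probability.Probability"
begin

section \<open>Borel probability measures on the special linear group\<close>

definition SL :: "(real^'n::finite^'n) set"
  where "SL = {g. det g = 1}"

definition prob_measure_SL :: "(real^'n::finite^'n) measure \<Rightarrow> bool"
  where "prob_measure_SL \<nu> \<longleftrightarrow> prob_space \<nu> \<and> sets \<nu> = sets (restrict_space borel SL)"

definition supp :: "(real^'n::finite^'n) measure \<Rightarrow> (real^'n^'n) set"
  where "supp \<nu> = {g \<in> SL. \<forall>U. open U \<and> g \<in> U \<longrightarrow> emeasure \<nu> (U \<inter> SL) > 0}"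

section \<open>Singular values\<close>

text \<open>
  Let \<open>B\<close> be the restriction of \<open>g\<close> to the subspace \<open>V\<close>. Since
  \<open>B\<^sup>*B\<close> is determined by \<open>\<langle>B\<^sup>*B v, w\<rangle> = \<langle>g v, g w\<rangle>\<close> for \<open>v, w\<close> in \<open>V\<close>, the
  following set is the eigenspace of \<open>B\<^sup>*B\<close> for the eigenvalue \<open>s\<^sup>2\<close>. Taking
  \<open>V = UNIV\<close> gives the eigenspaces of \<open>g\<^sup>T g\<close>, see the lemma below.
\<close>

definition sv_eigenspace :: "(real^'n::finite) set \<Rightarrow> real^'n^'n \<Rightarrow> real \<Rightarrow> (real^'n) set"
  where "sv_eigenspace V g s = {v \<in> V. \<forall>w\<in>V. (g *v v) \<bullet> (g *v w) = s\<^sup>2 * (v \<bullet> w)}"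

lemma sv_eigenspace_UNIV:
  "sv_eigenspace UNIV g s = {v. (transpose g ** g) *v v = s\<^sup>2 *\<^sub>R v}"
proof -
  have "(g *v v) \<bullet> (g *v w) = ((transpose g ** g) *v v) \<bullet> w" for v w :: "real^'a"
    by (metis dot_lmul_matrix inner_commute matrix_vector_mul_assoc transpose_matrix_vector)
  then show ?thesis
    unfolding sv_eigenspace_def
    by (auto simp: vector_eq_rdot simp flip: inner_scaleR_left)
qed

text \<open>
  The singular values of the restriction of \<open>g\<close> to \<open>V\<close>, repeated according to
  multiplicity, in decreasing order.
\<close>

definition singular_values :: "(real^'n::finite) set \<Rightarrow> real^'n^'n \<Rightarrow> real list"
  where "singular_values V g =
    (THE ss. length ss = dim V \<and> sorted_wrt (\<ge>) ss \<and> (\<forall>s\<in>set ss. 0 \<le> s) \<and>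
             (\<forall>s\<ge>0. count_list ss s = dim (sv_eigenspace V g s)))"

text \<open>Indexed from \<open>1\<close>, so that \<open>k = 1\<close> gives the largest one.\<close>

definition singular_value :: "(real^'n::finite) set \<Rightarrow> nat \<Rightarrow> real^'n^'n \<Rightarrow> real"
  where "singular_value V k g = singular_values V g ! (k - 1)"

section \<open>Lyapunov exponents of random matrix products\<close>

definition shift :: "(int \<Rightarrow> 'a) \<Rightarrow> int \<Rightarrow> 'a"
  where "shift x = (\<lambda>n. x (n + 1))"

definition generator :: "(int \<Rightarrow> real^'n::finite^'n) \<Rightarrow> real^'n^'n"
  where "generator x = x 0"

primrec cocycle :: "nat \<Rightarrow> (int \<Rightarrow> real^'n::finite^'n) \<Rightarrow> real^'n^'n" where
  "cocycle 0 x = mat 1"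
| "cocycle (Suc n) x = generator ((shift ^^ n) x) ** cocycle n x"

text \<open>The Lyapunov exponents of the cocycle restricted to a subspace \<open>V\<close>.\<close>

definition lyapunov_exponent_on ::
    "(real^'n::finite) set \<Rightarrow> nat \<Rightarrow> (real^'n^'n) measure \<Rightarrow> real"
  where "lyapunov_exponent_on V k \<nu> =
    (THE L. AE x in Pi\<^sub>M (UNIV :: int set) (\<lambda>_. \<nu>).
       (\<lambda>n. ln (singular_value V k (cocycle n x)) / real n) \<longlonglongrightarrow> L)"

abbreviation lyapunov_exponent :: "nat \<Rightarrow> (real^'n::finite^'n) measure \<Rightarrow> real"
  where "lyapunov_exponent \<equiv> lyapunov_exponent_on UNIV"

section \<open>Quasi-irreducibility\<close>

definition proper_invariant_subspace ::
    "(real^'n::finite^'n) measure \<Rightarrow> (real^'n) set \<Rightarrow> bool"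
  where "proper_invariant_subspace \<mu> V \<longleftrightarrow>
    subspace V \<and> V \<noteq> {0} \<and> V \<noteq> UNIV \<and> (\<forall>g\<in>supp \<mu>. (\<lambda>v. g *v v) ` V \<subseteq> V)"

definition quasi_irreducible :: "(real^'n::finite^'n) measure \<Rightarrow> bool"
  where "quasi_irreducible \<mu> \<longleftrightarrow>
    (\<nexists>V. proper_invariant_subspace \<mu> V) \<or>
    (\<exists>V. proper_invariant_subspace \<mu> V \<and>
         (\<forall>W. proper_invariant_subspace \<mu> W \<longrightarrow> W = V) \<and>
         lyapunov_exponent_on V 1 \<mu> = lyapunov_exponent 1 \<mu>)"

section \<open>Wasserstein distance\<close>

definition couplings ::
    "(real^'n::finite^'n) measure \<Rightarrow> (real^'n^'n) measure \<Rightarrow>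
     ((real^'n^'n) \<times> (real^'n^'n)) measure set"
  where "couplings \<mu> \<nu> =
    {\<pi>. prob_space \<pi> \<and> sets \<pi> = sets (\<mu> \<Otimes>\<^sub>M \<nu>) \<and>
         distr \<pi> \<mu> fst = \<mu> \<and> distr \<pi> \<nu> snd = \<nu>}"

text \<open>
  The norm of a matrix is the Euclidean operator norm. The infimum is finite for
  compactly supported \<open>\<mu>\<close> and \<open>\<nu>\<close>, so that \<open>enn2real\<close> loses nothing there.
\<close>

definition wasserstein ::
    "(real^'n::finite^'n) measure \<Rightarrow> (real^'n^'n) measure \<Rightarrow> real"
  where "wasserstein \<mu> \<nu> =
    enn2real (INF \<pi> \<in> couplings \<mu> \<nu>.
      \<integral>\<^sup>+ p. ennreal (onorm (\<lambda>v. (fst p - snd p) *v v)) \<partial>\<pi>)"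

end

theory Submission
  imports Defs
begin

text \<open>
  Let \<open>A\<^sup>n\<close> be the random product and \<open>d\<close> the sine distance of directions. Kingman's theorem gives
  the exponents as limits of means of \<open>ln (s\<^sub>1 (A\<^sup>n)) / n\<close> and \<open>ln (s\<^sub>1 (A\<^sup>n) * s\<^sub>2 (A\<^sup>n)) / n\<close>. The
  vectors that grow almost surely at a rate below \<open>L\<^sub>1\<close> form an invariant subspace, which is trivial by
  quasi-irreducibility; with a zero-one law and compactness this yields that the mean of
  \<open>ln (norm (A\<^sup>n v) / norm v)\<close> is at least \<open>n (L\<^sub>1 - \<epsilon>) - C\<close>, uniformly in \<open>v\<close>. Together with
  \<open>L\<^sub>1 > L\<^sub>2\<close> it follows that, for small \<open>\<alpha>\<close> and large \<open>m\<close>, \<open>A\<^sup>m\<close> contracts \<open>d\<^sup>\<alpha>\<close> in mean. This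
  contraction persists for laws that are close in the Wasserstein distance. Contraction bounds the
  difference of \<open>ln (norm (A\<^sup>n v) / norm v)\<close> for two vectors in mean, uniformly in \<open>n\<close>; hence the
  exponent is the growth rate of the mean from any starting vector, and replacing one law by the other
  along a coupling of cost \<open>w\<close> costs \<open>O (w\<^sup>\<alpha>)\<close> in each step.
\<close>

section \<open>The sequence space of an i.i.d. process\<close>

text \<open>Neither stationary measures nor an ergodic theorem occur: conditioning on the first
  factors is Fubini on the sequence space, the zero-one law plays the part of ergodicity, and the
  exponent is approached through expected logarithms from a fixed vector. Quasi-irreducibility is
  used for \<open>\<mu>\<close> alone; what nearby laws inherit is the contraction. For this the
  perturbation error must carry the distance of the two directions as a factor, since an additive
  error would dominate for close directions. A power \<open>d^\<alpha>\<close> contracts only after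
  \<open>m\<close> steps, so a gauge comparable with it is built that contracts in one step, and
  then a coupling of single factors suffices. The Hoelder exponent is the \<open>\<alpha>\<close> of
  the contraction. The power of the displacement is majorised by an affine function, so that only
  the mean cost of a coupling enters. Laws are restricted to their supports: then every sequence,
  not just almost every one, has factors in \<open>K\<close>, which supplies one bilipschitz
  constant for all laws. Matrices carry the Frobenius norm inside the proof and the operator norm in
  the Wasserstein distance; the change costs a factor of the dimension.\<close>

lemma (in prob_space) integrable_bounded:
  fixes f :: "'a \<Rightarrow> real"
  assumes "f \<in> borel_measurable M" "\<And>x. x \<in> space M \<Longrightarrow> \<bar>f x\<bar> \<le> B"
  shows "integrable M f"
  using assms by (intro integrable_const_bound[where B = B]) (auto intro: AE_I2)

lemma (in prob_space) integral_le_bound: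
  fixes f :: "'a \<Rightarrow> real"
  assumes "integrable M f" "\<And>x. x \<in> space M \<Longrightarrow> f x \<le> B"
  shows "expectation f \<le> B"
  using integral_mono[of M f "\<lambda>_. B"] assms by (simp add: prob_space)

lemma (in prob_space) integral_ge_bound:
  fixes f :: "'a \<Rightarrow> real"
  assumes "integrable M f" "\<And>x. x \<in> space M \<Longrightarrow> B \<le> f x"
  shows "B \<le> expectation f"
  using integral_mono[of M "\<lambda>_. B" f] assms by (simp add: prob_space)

text \<open>The tail unions decrease to the limit superior and each contains some
  \<open>A i\<close>. Later this carries a lower bound for probabilities from a convergent sequence
  of directions to the limit direction.\<close>

lemma (in prob_space) limsup_events:
  assumes A: "\<And>i::nat. A i \<in> events" and ge: "\<And>i. c \<le> prob (A i)"
  shows "c \<le> prob {x \<in> space M. \<forall>k. \<exists>i\<ge>k. x \<in> A i}"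
proof -
  define U where "U k = (\<Union>i\<in>{k..}. A i)" for k
  have U: "U k \<in> events" for k
    unfolding U_def using A by auto
  have "(\<lambda>k. prob (U k)) \<longlonglongrightarrow> prob (\<Inter>k. U k)"
    by (rule finite_Lim_measure_decseq) (use U in \<open>auto simp: decseq_def U_def\<close>, meson atLeast_iff order_trans)
  moreover have "c \<le> prob (U k)" for k
    using ge[of k] by (rule order_trans) (intro finite_measure_mono U, auto simp: U_def)
  ultimately have "c \<le> prob (\<Inter>k. U k)"
    by (intro LIMSEQ_le_const) auto
  also have "(\<Inter>k. U k) = {x \<in> space M. \<forall>k. \<exists>i\<ge>k. x \<in> A i}"
    using A[THEN sets.sets_into_space] by (fastforce simp: U_def)
  finally show ?thesis .
qed

definition sshift :: "nat \<Rightarrow> (nat \<Rightarrow> 'a) \<Rightarrow> nat \<Rightarrow> 'a"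
  where "sshift n x = (\<lambda>k. x (k + n))"

lemma comb_seq_sshift: "comb_seq n x (sshift n x) = x"
  by (auto simp: comb_seq_def sshift_def)

lemma sshift_sshift: "sshift m (sshift n x) = sshift (m + n) x"
  by (simp add: sshift_def ac_simps)

lemma sshift_comb_seq: "sshift n (comb_seq n x y) = y"
  by (auto simp: comb_seq_def sshift_def)

lemma sshift_0 [simp]: "sshift 0 x = x"
  by (simp add: sshift_def)

text \<open>
  Steele's covering argument: from a point that is not bad one jumps to the first time at which
  \<open>Y\<close> is nonpositive, from a bad point one moves a single step at the price \<open>c\<close>.
\<close>

lemma covering_bound:
  fixes Y :: "nat \<Rightarrow> 'a \<Rightarrow> real" and \<tau> :: "nat \<Rightarrow> 'a \<Rightarrow> 'a"
  assumes \<tau>0: "\<And>x. x \<in> X \<Longrightarrow> \<tau> 0 x = x"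
    and \<tau>add: "\<And>m n x. x \<in> X \<Longrightarrow> \<tau> m (\<tau> n x) = \<tau> (m + n) x"
    and \<tau>X: "\<And>n x. x \<in> X \<Longrightarrow> \<tau> n x \<in> X"
    and sub: "\<And>m n x. x \<in> X \<Longrightarrow> Y (n + m) x \<le> Y n x + Y m (\<tau> n x)"
    and bound: "\<And>n x. x \<in> X \<Longrightarrow> Y n x \<le> c * real n + c"
    and c: "c \<ge> 0"
    and "x \<in> X"
  shows "Y n x \<le> 2 * c * (\<Sum>k<n. indicator {x. \<forall>j\<in>{1..N}. Y j x > 0} (\<tau> k x)) + c * real N + c"
  using \<open>x \<in> X\<close>
proof (induction n arbitrary: x rule: less_induct)
  case (less n)
  let ?b = "\<lambda>x. indicator {x. \<forall>j\<in>{1..N}. Y j x > 0} x :: real"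
  show ?case
  \<comment> \<open>A last stretch of at most \<open>N\<close> steps is paid for by the a priori
    bound; this is the source of \<open>c * real N + c\<close>.\<close>
  proof (cases "n \<le> N")
    case True
    have "Y n x \<le> c * real n + c" using bound less.prems by auto
    also have "\<dots> \<le> c * real N + c" using True c by (simp add: mult_left_mono)
    also have "\<dots> \<le> 2 * c * (\<Sum>k<n. ?b (\<tau> k x)) + c * real N + c"
      using c by (simp add: sum_nonneg)
    finally show ?thesis .
  next
    case False
    have jump: "Y n x \<le> Y j x + 2 * c * (\<Sum>k\<in>{j..<n}. ?b (\<tau> k x)) + c * real N + c"
      if j: "1 \<le> j" "j \<le> n" for j
    proof -
      have "Y n x = Y (j + (n - j)) x" using j by simp
      also have "\<dots> \<le> Y j x + Y (n - j) (\<tau> j x)"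
        using sub less.prems by blast
      also have "Y (n - j) (\<tau> j x) \<le> 2 * c * (\<Sum>k<n - j. ?b (\<tau> k (\<tau> j x))) + c * real N + c"
        using j less.prems \<tau>X by (intro less.IH) auto
      also have "(\<Sum>k<n - j. ?b (\<tau> k (\<tau> j x))) = (\<Sum>k<n - j. ?b (\<tau> (k + j) x))"
        using \<tau>add less.prems by simp
      also have "\<dots> = (\<Sum>k\<in>{j..<n}. ?b (\<tau> k x))"
        using j by (intro sum.reindex_bij_witness[of _ "\<lambda>k. k - j" "\<lambda>k. k + j"]) auto
      finally show ?thesis by simp
    qed
    show ?thesis
    proof (cases "\<forall>j\<in>{1..N}. Y j x > 0")
      case True
      have "n > 0" using False by auto
      have "Y n x \<le> Y 1 x + 2 * c * (\<Sum>k\<in>{1..<n}. ?b (\<tau> k x)) + c * real N + c"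
        using \<open>n > 0\<close> by (intro jump) auto
      \<comment> \<open>The a priori bound for one step is \<open>c * 1 + c\<close>. At a bad point
        the indicator at time \<open>0\<close> equals \<open>1\<close> and absorbs it.\<close>
      also have "Y 1 x \<le> 2 * c * ?b (\<tau> 0 x)"
        using bound[OF less.prems, of 1] True \<tau>0[OF less.prems] by simp
      also have "2 * c * ?b (\<tau> 0 x) + 2 * c * (\<Sum>k\<in>{1..<n}. ?b (\<tau> k x)) =
          2 * c * (\<Sum>k<n. ?b (\<tau> k x))"
        using \<open>n > 0\<close>
        by (simp add: lessThan_atLeast0 sum.atLeast_Suc_lessThan[of 0 n] distrib_left)
      finally show ?thesis by simp
    next
      case bad: False
      then obtain j where j: "1 \<le> j" "j \<le> N" "Y j x \<le> 0" by (auto simp: not_less)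
      have "Y n x \<le> Y j x + 2 * c * (\<Sum>k\<in>{j..<n}. ?b (\<tau> k x)) + c * real N + c"
        using j False by (intro jump) auto
      also have "\<dots> \<le> 2 * c * (\<Sum>k\<in>{j..<n}. ?b (\<tau> k x)) + c * real N + c"
        using j by simp
      also have "(\<Sum>k\<in>{j..<n}. ?b (\<tau> k x)) \<le> (\<Sum>k<n. ?b (\<tau> k x))"
        by (intro sum_mono2) auto
      finally show ?thesis using c by (simp add: mult_left_mono)
    qed
  qed
qed

text \<open>Division with remainder by \<open>m\<close>: the term at \<open>k * m + j\<close> is at
  most \<open>u m ^ k * u j\<close>, so the sums over blocks of length \<open>m\<close> are
  dominated by a geometric series.\<close>

lemma submultiplicative_summable:
  fixes u :: "nat \<Rightarrow> real"
  assumes nonneg: "\<And>n. 0 \<le> u n" and sub: "\<And>m n. u (m + n) \<le> u m * u n"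
    and m: "m \<ge> 1" "u m < 1"
  shows "summable u"
proof -
  have pow: "u (k * m + j) \<le> u m ^ k * u j" for k j
  proof (induction k)
    case (Suc k)
    have "u (Suc k * m + j) \<le> u m * u (k * m + j)"
      using sub[of m "k * m + j"] by (simp add: ac_simps)
    also have "\<dots> \<le> u m * (u m ^ k * u j)"
      using Suc nonneg by (intro mult_left_mono) auto
    finally show ?case by simp
  qed simp
  define B where "B = (\<Sum>j<m. u j)"
  have B: "u j \<le> B" if "j < m" for j
    unfolding B_def using that nonneg by (intro member_le_sum) auto
  have B0: "0 \<le> B" unfolding B_def using nonneg by (simp add: sum_nonneg)
  define r where "r = u m"
  have r: "0 \<le> r" "r < 1" using nonneg m by (auto simp: r_def)
    have part: "(\<Sum>i<k * m. u i) \<le> B / (1 - r) * real m" for k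
    proof -
      have "(\<Sum>i<k * m. u i) \<le> (\<Sum>i<k. r ^ i) * (B * real m)"
      proof (induction k)
        case (Suc k)
        have "(\<Sum>i<Suc k * m. u i) = (\<Sum>i<k * m. u i) + (\<Sum>j<m. u (k * m + j))"
          using sum.nat_group[of u m k] sum.nat_group[of u m "Suc k"]
          by (simp add: lessThan_atLeast0 sum.shift_bounds_nat_ivl[of u 0 "k*m" m, simplified] ac_simps)
        also have "(\<Sum>j<m. u (k * m + j)) \<le> (\<Sum>j<m. r ^ k * B)"
          by (intro sum_mono order_trans[OF pow] mult_mono) (use B r in \<open>auto simp: r_def nonneg\<close>)
        finally show ?case using Suc by (simp add: algebra_simps)
      qed simp
      also have "\<dots> \<le> (1 / (1 - r)) * (B * real m)"
      proof (intro mult_right_mono)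
        show "(\<Sum>i<k. r ^ i) \<le> 1 / (1 - r)"
          using r sum_gp_strict[of r k] by (simp add: divide_right_mono)
      qed (use B0 in auto)
      finally show ?thesis by simp
    qed
    have "(\<Sum>i<n. u i) \<le> B / (1 - r) * real m" for n
    proof -
      have "(\<Sum>i<n. u i) \<le> (\<Sum>i<n * m. u i)"
        using nonneg m by (intro sum_mono2) auto
      then show ?thesis using part[of n] by simp
    qed
  then show ?thesis
    by (rule summableI_nonneg_bounded[OF nonneg])
qed

lemma exp_le_quadratic: "exp (y::real) \<le> 1 + y + y\<^sup>2 * exp \<bar>y\<bar>"
proof -
  obtain t where t: "\<bar>t\<bar> \<le> \<bar>y\<bar>" "exp y = (\<Sum>m<2. y ^ m / fact m) + exp t / fact 2 * y ^ 2"
    using Maclaurin_exp_le[of y 2] by blast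
  have "exp t / 2 * y\<^sup>2 \<le> exp \<bar>y\<bar> * y\<^sup>2"
  proof (intro mult_right_mono)
    have "exp t \<le> exp \<bar>y\<bar>" using t by simp
    then show "exp t / 2 \<le> exp \<bar>y\<bar>" by (smt (verit) exp_gt_zero field_sum_of_halves)
  qed simp
  then show ?thesis using t by (simp add: numeral_2_eq_2 ac_simps)
qed

text \<open>Second order expansion of the exponential at a random variable with negative mean. The
  point is that \<open>\<theta>\<close> depends on \<open>\<epsilon>\<close> and \<open>B\<close>
  only: later one exponent serves all pairs of directions at once.\<close>

lemma exp_moment_small:
  fixes \<epsilon> B :: real
  assumes "\<epsilon> > 0" "B \<ge> 0"
  obtains \<theta> where "0 < \<theta>" "\<theta> \<le> 1"
    "\<And>(M :: 'a measure) Y. prob_space M \<Longrightarrow> Y \<in> borel_measurable M \<Longrightarrow> (\<And>x. x \<in> space M \<Longrightarrow> \<bar>Y x\<bar> \<le> B) \<Longrightarrow>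
      (\<integral>x. Y x \<partial>M) \<le> - \<epsilon> \<Longrightarrow> (\<integral>x. exp (\<theta> * Y x) \<partial>M) \<le> 1 - \<theta> * \<epsilon> / 2"
proof -
  \<comment> \<open>The summand \<open>1\<close> keeps \<open>Q\<close> positive. The choice of
    \<open>\<theta>\<close> below lets the quadratic term use up at most half of the linear gain
    \<open>\<theta> * \<epsilon>\<close>.\<close>
  define Q where "Q = B\<^sup>2 * exp B + 1"
  have Q: "Q > 0" unfolding Q_def by (simp add: add_nonneg_pos)
  define \<theta> where "\<theta> = min 1 (\<epsilon> / (2 * Q))"
  have \<theta>: "0 < \<theta>" "\<theta> \<le> 1" "\<theta> * Q \<le> \<epsilon> / 2"
    using assms Q by (auto simp: \<theta>_def min_def field_simps)
  show ?thesis
  proof (rule that[OF \<theta>(1,2)])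
    fix M :: "'a measure" and Y
    assume M: "prob_space M" and [measurable]: "Y \<in> borel_measurable M"
      and B: "\<And>x. x \<in> space M \<Longrightarrow> \<bar>Y x\<bar> \<le> B" and neg: "(\<integral>x. Y x \<partial>M) \<le> - \<epsilon>"
    interpret prob_space M by fact
    have Yi: "integrable M Y" using B by (intro integrable_bounded) auto
    have le: "exp (\<theta> * Y x) \<le> 1 + \<theta> * Y x + \<theta>\<^sup>2 * Q" if "x \<in> space M" for x
    proof -
      have ab: "\<bar>\<theta> * Y x\<bar> \<le> B"
        using B[OF that] \<theta> by (simp add: abs_mult) (smt (verit) mult_left_le_one_le)
      have "(Y x)\<^sup>2 \<le> B\<^sup>2" using B[OF that] by (simp add: abs_le_square_iff[symmetric])
      have "exp (\<theta> * Y x) \<le> 1 + \<theta> * Y x + (\<theta> * Y x)\<^sup>2 * exp \<bar>\<theta> * Y x\<bar>"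
        by (rule exp_le_quadratic)
      also have "(\<theta> * Y x)\<^sup>2 * exp \<bar>\<theta> * Y x\<bar> \<le> (\<theta>\<^sup>2 * B\<^sup>2) * exp B"
        using ab \<open>(Y x)\<^sup>2 \<le> B\<^sup>2\<close> by (intro mult_mono) (auto simp: power_mult_distrib intro: mult_left_mono)
      also have "(\<theta>\<^sup>2 * B\<^sup>2) * exp B \<le> \<theta>\<^sup>2 * Q" by (simp add: Q_def algebra_simps)
      finally show ?thesis by simp
    qed
    have ei: "integrable M (\<lambda>x. exp (\<theta> * Y x))"
    proof (rule integrable_bounded[where B = "1 + B + Q"])
      fix x assume x: "x \<in> space M"
      have "\<theta> * Y x \<le> B"
        using B[OF x] \<theta> by (smt (verit) mult_left_le_one_le mult_left_mono)
      moreover have "\<theta>\<^sup>2 * Q \<le> Q" using \<theta> Q by (simp add: power_le_one)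
      ultimately show "\<bar>exp (\<theta> * Y x)\<bar> \<le> 1 + B + Q" using le[OF x] by simp
    qed measurable
    have "(\<integral>x. exp (\<theta> * Y x) \<partial>M) \<le> (\<integral>x. 1 + \<theta> * Y x + \<theta>\<^sup>2 * Q \<partial>M)"
      using le ei Yi by (intro integral_mono) auto
    also have "\<dots> = 1 + \<theta> * (\<integral>x. Y x \<partial>M) + \<theta> * (\<theta> * Q)"
      using Yi by (simp add: prob_space power2_eq_square)
    also have "\<dots> \<le> 1 + \<theta> * (-\<epsilon>) + \<theta> * (\<epsilon> / 2)"
      using neg \<theta> by (intro add_mono mult_left_mono) auto
    finally show "(\<integral>x. exp (\<theta> * Y x) \<partial>M) \<le> 1 - \<theta> * \<epsilon> / 2" by (simp add: field_simps)
  qed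
qed

section \<open>Fubini and the zero-one law on the sequence space\<close>

context sequence_space
begin

lemma measurable_sshift [measurable]: "sshift n \<in> measurable S S"
  unfolding sshift_def by (rule measurable_PiM_single') (auto simp: space_PiM)

lemma space_sshift: "x \<in> space S \<Longrightarrow> sshift n x \<in> space S"
  by (auto simp: space_PiM sshift_def)

lemma space_comb_seq: "x \<in> space S \<Longrightarrow> y \<in> space S \<Longrightarrow> comb_seq n x y \<in> space S"
  by (auto simp: space_PiM comb_seq_def PiE_iff)

text \<open>Markov property at time \<open>n\<close>: given the past \<open>x\<close>, the future
  \<open>y\<close> is an independent copy of the whole sequence.\<close>

lemma integral_comb_seq:
  fixes f :: "(nat \<Rightarrow> 'a) \<Rightarrow> real"
  assumes f: "integrable S f"
  shows "(\<integral>x. f x \<partial>S) = (\<integral>x. (\<integral>y. f (comb_seq n x y) \<partial>S) \<partial>S)"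
proof -
  interpret SS: pair_sigma_finite S S ..
  have [measurable]: "f \<in> borel_measurable S" using f by auto
  have i: "integrable (S \<Otimes>\<^sub>M S) (\<lambda>p. f (case_prod (comb_seq n) p))"
    using f by (intro integrable_distr[OF measurable_comb_seq]) (simp add: PiM_comb_seq)
  have "(\<integral>x. f x \<partial>S) = (\<integral>p. f (case_prod (comb_seq n) p) \<partial>(S \<Otimes>\<^sub>M S))"
    by (subst PiM_comb_seq[symmetric, of n], subst integral_distr[OF measurable_comb_seq]) auto
  also have "\<dots> = (\<integral>x. (\<integral>y. f (comb_seq n x y) \<partial>S) \<partial>S)"
    using SS.integral_fst'[OF i] by simp
  finally show ?thesis .
qed

text \<open>The case of a single past factor, integrated over \<open>M\<close>. For matrix products
  it isolates the factor that is applied first and turns means into recursions over the starting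
  vector.\<close>

lemma integral_case_nat:
  fixes f :: "(nat \<Rightarrow> 'a) \<Rightarrow> real"
  assumes f: "integrable S f"
  shows "(\<integral>x. f x \<partial>S) = (\<integral>g. (\<integral>y. f (case_nat g y) \<partial>S) \<partial>M)"
proof -
  interpret MS: pair_sigma_finite M S ..
  have [measurable]: "f \<in> borel_measurable S" using f by auto
  have m: "(\<lambda>(s, \<omega>). case_nat s \<omega>) \<in> measurable (M \<Otimes>\<^sub>M S) S" by measurable
  have i: "integrable (M \<Otimes>\<^sub>M S) (\<lambda>p. f (case_prod case_nat p))"
    using f by (intro integrable_distr[OF m]) (simp add: PiM_iter)
  have "(\<integral>x. f x \<partial>S) = (\<integral>p. f (case_prod case_nat p) \<partial>(M \<Otimes>\<^sub>M S))"
    by (subst PiM_iter[symmetric], subst integral_distr[OF m]) auto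
  also have "\<dots> = (\<integral>x. (\<integral>y. f (case_nat x y) \<partial>S) \<partial>M)"
    using MS.integral_fst'[OF i] by simp
  finally show ?thesis .
qed

lemma integral_sshift:
  fixes f :: "(nat \<Rightarrow> 'a) \<Rightarrow> real"
  assumes f: "f \<in> borel_measurable S" "\<And>x. x \<in> space S \<Longrightarrow> \<bar>f x\<bar> \<le> B"
  shows "(\<integral>x. f (sshift n x) \<partial>S) = (\<integral>x. f x \<partial>S)"
proof -
  note [measurable] = f(1)
  have "integrable S (\<lambda>x. f (sshift n x))"
    using f(2) space_sshift by (intro P.integrable_bounded[where B = B]) auto
  then have "(\<integral>x. f (sshift n x) \<partial>S) = (\<integral>x. (\<integral>y. f (sshift n (comb_seq n x y)) \<partial>S) \<partial>S)"
    by (rule integral_comb_seq)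
  then show ?thesis by (simp add: sshift_comb_seq P.prob_space)
qed

text \<open>The hypothesis makes the conditional probability of \<open>B\<close> given finitely many coordinates at
  most, hence equal to, its probability, so that \<open>B\<close> is independent of itself.\<close>

lemma zero_one:
  assumes B: "B \<in> sets S"
    and le: "\<And>n x. x \<in> space S \<Longrightarrow> measure S {y \<in> space S. comb_seq n x y \<in> B} \<le> measure S B"
  shows "measure S B = 0 \<or> measure S B = 1"
proof -
  note [measurable] = B
  \<comment> \<open>\<open>C\<close> depends on the first \<open>n\<close> coordinates only, so it
    leaves the inner integral, where the hypothesis applies.\<close>
  have half: "measure S (B \<inter> C) \<le> measure S B * measure S C"
    if C[measurable]: "C \<in> sets S"
      and dep: "\<And>x y. x \<in> space S \<Longrightarrow> y \<in> space S \<Longrightarrow> comb_seq n x y \<in> C \<longleftrightarrow> x \<in> C" for n C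
  proof -
    have "measure S (B \<inter> C) = (\<integral>x. indicat_real (B \<inter> C) x \<partial>S)" by simp
    also have "\<dots> = (\<integral>x. (\<integral>y. indicat_real (B \<inter> C) (comb_seq n x y) \<partial>S) \<partial>S)"
      by (intro integral_comb_seq P.integrable_bounded[where B = 1]) (auto simp: indicator_def)
    also have "\<dots> = (\<integral>x. indicat_real C x * measure S {y \<in> space S. comb_seq n x y \<in> B} \<partial>S)"
    proof (rule Bochner_Integration.integral_cong[OF refl])
      fix x assume x: "x \<in> space S"
      have "(\<integral>y. indicat_real (B \<inter> C) (comb_seq n x y) \<partial>S) =
          (\<integral>y. indicat_real C x * indicat_real {y \<in> space S. comb_seq n x y \<in> B} y \<partial>S)"
        using dep x by (intro Bochner_Integration.integral_cong) (auto simp: indicator_def)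
      then show "(\<integral>y. indicat_real (B \<inter> C) (comb_seq n x y) \<partial>S) =
          indicat_real C x * measure S {y \<in> space S. comb_seq n x y \<in> B}"
        by (simp add: Int_absorb2[of "{y \<in> space S. comb_seq n x y \<in> B}" "space S"])
    qed
    also have "\<dots> \<le> (\<integral>x. indicat_real C x * measure S B \<partial>S)"
    proof (rule integral_mono)
      show "integrable S (\<lambda>x. indicat_real C x * measure S {y \<in> space S. comb_seq n x y \<in> B})"
        by (rule P.integrable_bounded[where B = 1]) (auto simp: indicator_def)
      show "integrable S (\<lambda>x. indicat_real C x * measure S B)"
        by (rule P.integrable_bounded[where B = 1]) (auto simp: indicator_def)
    qed (use le in \<open>auto simp: indicator_def\<close>)
    also have "\<dots> = measure S B * measure S C" by simp
    finally show ?thesis .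
  qed
  \<comment> \<open>The inequality for \<open>C\<close> and the one for its complement add up to an
    equality, so neither can be strict.\<close>
  have indep: "measure S (B \<inter> C) = measure S B * measure S C"
    if C: "C \<in> sets S"
      and dep: "\<And>x y. x \<in> space S \<Longrightarrow> y \<in> space S \<Longrightarrow> comb_seq n x y \<in> C \<longleftrightarrow> x \<in> C" for n C
  proof -
    have "measure S (B \<inter> (space S - C)) \<le> measure S B * measure S (space S - C)"
      using C by (intro half[of _ n]) (auto simp: dep space_comb_seq)
    moreover have "measure S (space S - C) = 1 - measure S C"
      using C by (rule P.prob_compl)
    moreover have "measure S B = measure S (B \<inter> C) + measure S (B \<inter> (space S - C))"
    proof -
      have "B = (B \<inter> C) \<union> (B \<inter> (space S - C))"
        using sets.sets_into_space[OF B] by blast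
      moreover have "measure S ((B \<inter> C) \<union> (B \<inter> (space S - C))) =
          measure S (B \<inter> C) + measure S (B \<inter> (space S - C))"
        using C by (intro P.finite_measure_Union) auto
      ultimately show ?thesis by simp
    qed
    moreover note half[OF C dep]
    ultimately show ?thesis by (simp add: algebra_simps)
  qed
  \<comment> \<open>\<open>C \<mapsto> P(B \<inter> C)\<close> and
    \<open>C \<mapsto> P(B) P(C)\<close> agree on cylinders, hence on all measurable sets; at
    \<open>C = B\<close> this reads \<open>P(B) = P(B)^2\<close>.\<close>
  define N1 where "N1 = density S (indicator B)"
  define N2 where "N2 = scale_measure (ennreal (measure S B)) S"
  have e1: "emeasure N1 C = ennreal (measure S (B \<inter> C))" if "C \<in> sets S" for C
    using that B by (simp add: N1_def emeasure_restricted P.emeasure_eq_measure)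
  have e2: "emeasure N2 C = ennreal (measure S B * measure S C)" if "C \<in> sets S" for C
    using that by (simp add: N2_def P.emeasure_eq_measure ennreal_mult)
  have "N1 = N2"
  proof (rule measure_eqI_PiM_infinite[where I = UNIV and M = "\<lambda>_. M"])
    show "sets N1 = sets (Pi\<^sub>M UNIV (\<lambda>_. M))" "sets N2 = sets (Pi\<^sub>M UNIV (\<lambda>_. M))"
      by (simp_all add: N1_def N2_def)
    show "finite_measure N1"
      by (rule finite_measureI) (use e1[of "space S"] in \<open>simp add: N1_def\<close>)
    fix A :: "nat \<Rightarrow> 'a set" and J assume J: "finite J" "\<And>i. i \<in> J \<Longrightarrow> A i \<in> sets M"
    define C where "C = prod_emb UNIV (\<lambda>_. M) J (Pi\<^sub>E J A)"
    have C: "C \<in> sets S" unfolding C_def using J by (intro sets_PiM_I) auto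
    obtain n where n: "\<And>j. j \<in> J \<Longrightarrow> j < n"
      using J(1) unfolding finite_nat_set_iff_bounded by auto
    have dep: "comb_seq n x y \<in> C \<longleftrightarrow> x \<in> C" if "x \<in> space S" "y \<in> space S" for x y
      using that space_comb_seq[OF that, of n] n
      by (auto simp: C_def prod_emb_def space_PiM PiE_iff comb_seq_less)
    show "emeasure N1 (prod_emb UNIV (\<lambda>_. M) J (Pi\<^sub>E J A)) =
        emeasure N2 (prod_emb UNIV (\<lambda>_. M) J (Pi\<^sub>E J A))"
      using e1[OF C] e2[OF C] indep[OF C dep] unfolding C_def by simp
  qed
  then have "measure S B = measure S B * measure S B"
    using e1[OF B] e2[OF B] by simp
  then show ?thesis by simp
qed

end

section \<open>Kingman's theorem over a Bernoulli shift\<close>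

lemma tendsto_divide_const_add:
  fixes a :: "nat \<Rightarrow> real"
  assumes "(\<lambda>n. a n / real n) \<longlonglongrightarrow> L" and "\<And>n. \<bar>b n - a n\<bar> \<le> C"
  shows "(\<lambda>n. b n / real n) \<longlonglongrightarrow> L"
proof -
  have "(\<lambda>n. C / real n) \<longlonglongrightarrow> 0"
    by (rule lim_const_over_n)
  moreover have "norm (b n / real n - a n / real n) \<le> C / real n" for n
    using assms(2)[of n] by (simp flip: diff_divide_distrib add: divide_right_mono)
  ultimately have "(\<lambda>n. b n / real n - a n / real n) \<longlonglongrightarrow> 0"
    by (rule Lim_null_comparison[OF always_eventually[rule_format], rotated])
  from tendsto_add[OF this assms(1)] show ?thesis by simp
qed

text \<open>Subadditivity is stated for glued sequences, which fits Fubini better than shifts.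
  \<open>X_tail\<close> controls the loss when the first \<open>n\<close> coordinates are deleted;
  with \<open>X_sub\<close> it makes the exceptional set of the lower bound insensitive to finitely
  many coordinates, so that the zero-one law can replace ergodicity.\<close>

locale subadditive_process = sequence_space +
  fixes X :: "nat \<Rightarrow> (nat \<Rightarrow> 'a) \<Rightarrow> real" and c :: real
  assumes measurable_X [measurable]: "\<And>n. X n \<in> borel_measurable S"
    and X_bound: "\<And>n x. x \<in> space S \<Longrightarrow> \<bar>X n x\<bar> \<le> c * real n + c"
    and X_sub: "\<And>m n x y. x \<in> space S \<Longrightarrow> y \<in> space S \<Longrightarrow>
      X (m + n) (comb_seq n x y) \<le> X n x + X m y"
    and X_tail: "\<And>m n x y. x \<in> space S \<Longrightarrow> y \<in> space S \<Longrightarrow>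
      X m y \<le> X (m + n) (comb_seq n x y) + c * real n"
begin

lemma X_integrable: "integrable S (X n)"
  using X_bound by (intro P.integrable_bounded) auto

lemma c_nonneg: "0 \<le> c"
proof -
  obtain x where "x \<in> space S" using P.not_empty by blast
  from X_bound[OF this, of 0] show ?thesis by simp
qed

definition \<gamma> :: real
  where "\<gamma> = (INF n\<in>{1..}. (\<integral>x. X n x \<partial>S) / real n)"

lemma mean_bdd_below: "bdd_below ((\<lambda>n. (\<integral>x. X n x \<partial>S) / real n) ` {1..})"
proof (rule bdd_belowI2)
  fix n :: nat assume n: "n \<in> {1..}"
  have "- (c * real n + c) \<le> (\<integral>x. X n x \<partial>S)"
    by (intro P.integral_ge_bound X_integrable) (use X_bound in \<open>auto simp: abs_le_iff\<close>, smt (verit))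
  moreover have "c \<le> c * real n" using n c_nonneg by (simp add: mult_le_cancel_left1)
  ultimately have "- (2 * c) * real n \<le> (\<integral>x. X n x \<partial>S)" by simp
  then show "- (2 * c) \<le> (\<integral>x. X n x \<partial>S) / real n"
    using n by (simp add: pos_le_divide_eq)
qed

lemma \<gamma>_le: "real n * \<gamma> \<le> (\<integral>x. X n x \<partial>S)"
proof (cases "n = 0")
  case True
  have "(\<integral>x. X 0 x \<partial>S) \<ge> 0"
  proof (rule P.integral_ge_bound[OF X_integrable])
    fix x assume x: "x \<in> space S"
    have "X (0 + 0) (comb_seq 0 x x) \<le> X 0 x + X 0 x" by (rule X_sub[OF x x])
    then show "0 \<le> X 0 x" by (simp add: comb_seq_0)
  qed
  with True show ?thesis by simp
next
  case False
  then have "\<gamma> \<le> (\<integral>x. X n x \<partial>S) / real n"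
    unfolding \<gamma>_def by (intro cINF_lower mean_bdd_below) auto
  with False show ?thesis by (simp add: field_simps)
qed

text \<open>The exponential moments of \<open>X n - s n\<close> are submultiplicative in \<open>n\<close> and one of them is below \<open>1\<close>,
  so they are summable.\<close>

lemma AE_upper:
  assumes "s > \<gamma>"
  shows "AE x in S. eventually (\<lambda>n. X n x \<le> s * real n) sequentially"
proof -
  obtain m where m: "m \<ge> 1" "(\<integral>x. X m x \<partial>S) / real m < s"
    using assms unfolding \<gamma>_def
    by (subst (asm) cINF_less_iff[OF _ mean_bdd_below]) auto
  define \<epsilon> where "\<epsilon> = s * real m - (\<integral>x. X m x \<partial>S)"
  have \<epsilon>: "\<epsilon> > 0" using m by (simp add: \<epsilon>_def field_simps)
  define B where "B = (c * real m + c) + \<bar>s\<bar> * real m"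
  have "B \<ge> 0" using c_nonneg by (simp add: B_def)
  obtain \<theta> where \<theta>: "0 < \<theta>" "\<theta> \<le> 1"
    and small: "\<And>(M :: (nat \<Rightarrow> 'a) measure) Y. prob_space M \<Longrightarrow> Y \<in> borel_measurable M \<Longrightarrow>
      (\<And>x. x \<in> space M \<Longrightarrow> \<bar>Y x\<bar> \<le> B) \<Longrightarrow> (\<integral>x. Y x \<partial>M) \<le> - \<epsilon> \<Longrightarrow>
      (\<integral>x. exp (\<theta> * Y x) \<partial>M) \<le> 1 - \<theta> * \<epsilon> / 2"
    using exp_moment_small[OF \<epsilon> \<open>B \<ge> 0\<close>] by metis
  define E where "E n x = exp (\<theta> * (X n x - s * real n))" for n x
  have [measurable]: "E n \<in> borel_measurable S" for n unfolding E_def by measurable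
  have E0: "0 \<le> E n x" for n x by (simp add: E_def)
  define u where "u n = (\<integral>x. E n x \<partial>S)" for n
  have ei: "integrable S (E n)" for n
  proof (rule P.integrable_bounded[where B = "exp (\<theta> * (c * real n + c + \<bar>s * real n\<bar>))"])
    fix x assume "x \<in> space S"
    from X_bound[OF this, of n] have "X n x - s * real n \<le> c * real n + c + \<bar>s * real n\<bar>" by linarith
    then show "\<bar>E n x\<bar> \<le> exp (\<theta> * (c * real n + c + \<bar>s * real n\<bar>))"
      using \<theta> by (simp add: E_def)
  qed measurable
  have "u m \<le> 1 - \<theta> * \<epsilon> / 2"
    unfolding u_def E_def
  proof (rule small)
    fix x assume "x \<in> space S"
    from X_bound[OF this, of m] show "\<bar>X m x - s * real m\<bar> \<le> B"
      using abs_triangle_ineq4[of "X m x" "s * real m"] unfolding B_def by (simp add: abs_mult)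
  next
    show "(\<integral>x. X m x - s * real m \<partial>S) \<le> - \<epsilon>"
      using X_integrable[of m] by (simp add: \<epsilon>_def P.prob_space)
  qed (auto intro: P.prob_space_axioms)
  moreover have "0 < \<theta> * \<epsilon>" using \<theta> \<epsilon> by simp
  ultimately have "u m < 1" by linarith
  have E_sub: "E (k + n) (comb_seq n x y) \<le> E n x * E k y" if "x \<in> space S" "y \<in> space S" for k n x y
  proof -
    have "\<theta> * (X (k + n) (comb_seq n x y) - s * real (k + n)) \<le>
        \<theta> * ((X n x - s * real n) + (X k y - s * real k))"
      using X_sub[OF that, of k n] \<theta> by (intro mult_left_mono) (auto simp: algebra_simps)
    then show ?thesis by (simp add: E_def distrib_left flip: exp_add)
  qed
  have u_sub: "u (k + n) \<le> u k * u n" for k n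
  proof -
    have "u (k + n) = (\<integral>x. (\<integral>y. E (k + n) (comb_seq n x y) \<partial>S) \<partial>S)"
      unfolding u_def by (rule integral_comb_seq[OF ei])
    also have "\<dots> \<le> (\<integral>x. E n x * u k \<partial>S)"
    proof (rule integral_mono')
      fix x assume x: "x \<in> space S"
      have "(\<integral>y. E (k + n) (comb_seq n x y) \<partial>S) \<le> (\<integral>y. E n x * E k y \<partial>S)"
        by (intro integral_mono' integrable_mult_right ei E_sub x) (simp_all add: E0)
      then show "(\<integral>y. E (k + n) (comb_seq n x y) \<partial>S) \<le> E n x * u k"
        by (simp add: u_def)
    qed (auto simp: u_def ei E0)
    also have "\<dots> = u k * u n"
      by (simp add: u_def)
    finally show ?thesis .
  qed
  have sm: "summable u"
    by (rule submultiplicative_summable[OF _ u_sub m(1) \<open>u m < 1\<close>]) (simp add: u_def E0)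
  have Markov: "measure S {x \<in> space S. X n x > s * real n} \<le> u n" for n
  proof -
    have "measure S {x \<in> space S. X n x > s * real n} = (\<integral>x. indicator {x \<in> space S. X n x > s * real n} x \<partial>S)"
      by simp
    also have "\<dots> \<le> u n"
      unfolding u_def
      using \<theta> by (intro integral_mono' ei) (auto simp: indicator_def E_def)
    finally show ?thesis .
  qed
  have "AE x in S. eventually (\<lambda>n. x \<in> space S - {x \<in> space S. X n x > s * real n}) sequentially"
  proof (rule borel_cantelli_AE1)
    show "summable (\<lambda>n. measure S {x \<in> space S. X n x > s * real n})"
      by (rule summable_comparison_test'[OF sm, of 0]) (use Markov in auto)
  qed (auto simp: P.emeasure_eq_measure)
  then show ?thesis
    by eventually_elim (auto elim!: eventually_mono simp: not_less)
qed

text \<open>The set \<open>B\<close> where \<open>X n\<close> falls arbitrarily far below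
  \<open>s * n\<close> does not depend on finitely many coordinates, so it has probability
  \<open>0\<close> or \<open>1\<close>. If it had probability \<open>1\<close>, almost every point
  would reach \<open>Y j \<le> 0\<close> at some time, so bad points would become rare as
  \<open>N\<close> grows. The integrated covering bound would then push the mean growth rate, which
  is at least \<open>\<gamma>\<close>, down to \<open>s\<close>.\<close>

lemma AE_lower:
  assumes s: "s < \<gamma>"
  shows "AE x in S. \<exists>C. \<forall>n. s * real n - C < X n x"
proof -
  define B where "B = {x \<in> space S. \<forall>C::nat. \<exists>n. X n x \<le> s * real n - real C}"
  have [measurable]: "B \<in> sets S" unfolding B_def by measurable
  have inv: "comb_seq n x y \<in> B \<longleftrightarrow> y \<in> B" if x: "x \<in> space S" and y: "y \<in> space S" for n x y
  proof
    assume L: "comb_seq n x y \<in> B"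
    show "y \<in> B" unfolding B_def
    proof (safe intro!: y)
      fix C :: nat
      \<comment> \<open>\<open>D\<close> beats the a priori bound at all times below
        \<open>n\<close>, which forces \<open>k \<ge> n\<close>, and still leaves \<open>C\<close>
        after the shift of the time by \<open>n\<close>.\<close>
      obtain D :: nat where D: "real D > C + c * real n + c + \<bar>s\<bar> * real n + \<bar>s\<bar> * real n + c * real n + c"
        using reals_Archimedean2 by blast
      obtain k where k: "X k (comb_seq n x y) \<le> s * real k - real D"
        using L unfolding B_def by blast
      have "k \<ge> n"
      proof (rule ccontr)
        assume "\<not> k \<ge> n"
        then have kn: "real k \<le> real n" by simp
        have "- (c * real k + c) \<le> X k (comb_seq n x y)"
          using X_bound[OF space_comb_seq[OF x y], of k n] by linarith
        moreover have "c * real k \<le> c * real n" using c_nonneg kn by (rule mult_left_mono[rotated])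
        moreover have "s * real k \<le> \<bar>s\<bar> * real n"
          using kn by (intro mult_mono) auto
        ultimately show False using D k by (smt (verit) c_nonneg mult_nonneg_nonneg of_nat_0_le_iff abs_ge_zero)
      qed
      then obtain j where j: "k = j + n" by (metis le_add_diff_inverse2)
      have "X j y \<le> s * real k - real D + c * real n"
        using X_tail[OF x y, of j n] k j by simp
      also have "\<dots> \<le> s * real j - real C"
      proof -
        have "s * real k = s * real j + s * real n" by (simp add: j algebra_simps)
        moreover have "s * real n \<le> \<bar>s\<bar> * real n" by (intro mult_right_mono) auto
        ultimately show ?thesis using D c_nonneg by (smt (verit) mult_nonneg_nonneg of_nat_0_le_iff abs_ge_zero)
      qed
      finally show "\<exists>n. X n y \<le> s * real n - real C" by blast
    qed
  next
    assume R: "y \<in> B"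
    show "comb_seq n x y \<in> B" unfolding B_def
    proof (safe intro!: space_comb_seq x y)
      fix C :: nat
      obtain D :: nat where D: "real D > C + c * real n + c + \<bar>s\<bar> * real n"
        using reals_Archimedean2 by blast
      obtain k where k: "X k y \<le> s * real k - real D"
        using R unfolding B_def by blast
      have "X (k + n) (comb_seq n x y) \<le> X n x + X k y" by (rule X_sub[OF x y])
      also have "X n x \<le> c * real n + c" using X_bound[OF x, of n] by linarith
      finally have "X (k + n) (comb_seq n x y) \<le> s * real k - real D + c * real n + c" using k by simp
      also have "\<dots> \<le> s * real (k + n) - real C"
      proof -
        have "- s * real n \<le> \<bar>s\<bar> * real n" by (intro mult_right_mono) auto
        then show ?thesis using D by (simp add: algebra_simps)
      qed
      finally show "\<exists>n'. X n' (comb_seq n x y) \<le> s * real n' - real C" by blast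
    qed
  qed
  have "measure S B = 0 \<or> measure S B = 1"
  proof (rule zero_one)
    fix n x assume "x \<in> space S"
    then have "{y \<in> space S. comb_seq n x y \<in> B} = {y \<in> space S. y \<in> B}" using inv by blast
    also have "\<dots> = B" by (auto simp: B_def)
    finally show "measure S {y \<in> space S. comb_seq n x y \<in> B} \<le> measure S B" by simp
  qed measurable
  moreover have "measure S B \<noteq> 1"
  proof
    assume 1: "measure S B = 1"
    \<comment> \<open>The a priori constant for \<open>Y\<close>, since subtracting
      \<open>s * n\<close> adds at most \<open>\<bar>s\<bar> * n\<close>.\<close>
    define c' where "c' = c + \<bar>s\<bar>"
    have c': "c' \<ge> 0" using c_nonneg by (simp add: c'_def)
    define Y where "Y n x = X n x - s * real n" for n x
    have [measurable]: "Y n \<in> borel_measurable S" for n unfolding Y_def by measurable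
    define bad where "bad N = {x \<in> space S. \<forall>j\<in>{1..N}. Y j x > 0}" for N :: nat
    have [measurable]: "bad N \<in> sets S" for N unfolding bad_def by measurable
    have Y_le: "Y n x \<le> 2 * c' * (\<Sum>k<n. indicator (bad N) (sshift k x)) + c' * real N + c'"
      if x: "x \<in> space S" for n N x
    proof -
      have "Y n x \<le> 2 * c' * (\<Sum>k<n. indicator {x. \<forall>j\<in>{1..N}. Y j x > 0} (sshift k x)) + c' * real N + c'"
      proof (rule covering_bound[where X = "space S" and \<tau> = sshift])
        fix m n x assume x: "x \<in> space S"
        show "Y (n + m) x \<le> Y n x + Y m (sshift n x)"
          using X_sub[OF x space_sshift[OF x, of n], of m n]
          by (simp add: Y_def comb_seq_sshift algebra_simps)
        have "- s * real n \<le> \<bar>s\<bar> * real n" by (intro mult_right_mono) auto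
        then show "Y n x \<le> c' * real n + c'"
          using X_bound[OF x, of n] unfolding Y_def c'_def by (simp add: algebra_simps)
      qed (use x c' space_sshift in \<open>auto simp: sshift_sshift\<close>)
      also have "(\<Sum>k<n. indicator {x. \<forall>j\<in>{1..N}. Y j x > 0} (sshift k x) :: real) =
          (\<Sum>k<n. indicator (bad N) (sshift k x))"
        using space_sshift[OF x] by (intro sum.cong) (auto simp: bad_def indicator_def)
      finally show ?thesis .
    qed
    have mean: "real n * (\<gamma> - s) \<le> 2 * c' * real n * measure S (bad N) + c' * real N + c'" for n N
    proof -
      have "real n * (\<gamma> - s) \<le> (\<integral>x. Y n x \<partial>S)"
        using \<gamma>_le[of n] X_integrable[of n] by (simp add: Y_def P.prob_space algebra_simps)
      also have "\<dots> \<le> (\<integral>x. 2 * c' * (\<Sum>k<n. indicator (bad N) (sshift k x)) + c' * real N + c' \<partial>S)"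
      proof (rule integral_mono)
        show "integrable S (Y n)" unfolding Y_def using X_integrable by simp
        have "integrable S (\<lambda>x. indicator (bad N) (sshift k x) :: real)" for k
          by (rule P.integrable_bounded[where B = 1]) (auto simp: indicator_def)
        then show "integrable S (\<lambda>x. 2 * c' * (\<Sum>k<n. indicator (bad N) (sshift k x)) + c' * real N + c')"
          by (intro Bochner_Integration.integrable_add integrable_mult_right Bochner_Integration.integrable_sum) auto
      qed (use Y_le in auto)
      also have "\<dots> = 2 * c' * (\<Sum>k<n. (\<integral>x. indicator (bad N) (sshift k x) \<partial>S)) + c' * real N + c'"
      proof -
        have "integrable S (\<lambda>x. indicator (bad N) (sshift k x) :: real)" for k
          by (rule P.integrable_bounded[where B = 1]) (auto simp: indicator_def)
        then show ?thesis by (simp add: P.prob_space)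
      qed
      also have "(\<Sum>k<n. (\<integral>x. indicator (bad N) (sshift k x) \<partial>S)) = (\<Sum>k<n. measure S (bad N))"
        by (intro sum.cong refl, subst integral_sshift[where B = 1]) (auto simp: indicator_def)
      finally show ?thesis by (simp add: algebra_simps)
    qed
    have "(\<lambda>N. measure S (bad N)) \<longlonglongrightarrow> measure S (\<Inter>N. bad N)"
      by (rule P.finite_Lim_measure_decseq) (auto simp: decseq_def bad_def)
    moreover have "measure S (\<Inter>N. bad N) = 0"
    proof -
      have "(\<Inter>N. bad N) \<inter> B = {}"
      proof (rule ccontr)
        assume "(\<Inter>N. bad N) \<inter> B \<noteq> {}"
        then obtain x where x: "x \<in> B" "\<And>N. x \<in> bad N" by auto
        then have xS: "x \<in> space S" by (simp add: B_def)
        \<comment> \<open>Badness tests the times from \<open>1\<close> on. At time \<open>0\<close>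
          the process is bounded by \<open>c\<close>, so \<open>C > c\<close> excludes that time as
          a witness.\<close>
        obtain C :: nat where C: "real C > c" using reals_Archimedean2 by blast
        obtain n where n: "X n x \<le> s * real n - real C" using x(1) unfolding B_def by blast
        have "n \<noteq> 0"
        proof
          assume "n = 0"
          then show False using n C X_bound[OF xS, of 0] by simp
        qed
        then have "Y n x > 0" using x(2)[of n] by (simp add: bad_def)
        then show False using n C c_nonneg by (simp add: Y_def)
      qed
      then have "(\<Inter>N. bad N) \<subseteq> space S - B" by (auto simp: bad_def)
      then have "measure S (\<Inter>N. bad N) \<le> measure S (space S - B)"
        by (intro P.finite_measure_mono) auto
      also have "\<dots> = 0" using 1 by (simp add: P.prob_compl)
      finally show ?thesis by (simp add: measure_le_0_iff)
    qed
    ultimately have lim0: "(\<lambda>N. 2 * c' * measure S (bad N)) \<longlonglongrightarrow> 0"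
      using tendsto_mult_left[of "\<lambda>N. measure S (bad N)" 0 sequentially "2 * c'"] by simp
    \<comment> \<open>The order of the limits matters: \<open>n\<close> tends to infinity for fixed
      \<open>N\<close>, which removes \<open>c' * real N + c'\<close>, and only then
      \<open>N\<close> grows.\<close>
    have "\<gamma> - s \<le> 2 * c' * measure S (bad N)" for N
    proof (rule LIMSEQ_le_const)
      show "(\<lambda>n. 2 * c' * measure S (bad N) + (c' * real N + c') / real n) \<longlonglongrightarrow> 2 * c' * measure S (bad N)"
        using tendsto_add[OF tendsto_const[of "2 * c' * measure S (bad N)"]
            lim_const_over_n[of "c' * real N + c'"]] by simp
      show "\<exists>k. \<forall>n\<ge>k. \<gamma> - s \<le> 2 * c' * measure S (bad N) + (c' * real N + c') / real n"
      proof (intro exI[of _ 1] allI impI)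
        fix n :: nat assume "n \<ge> 1"
        then show "\<gamma> - s \<le> 2 * c' * measure S (bad N) + (c' * real N + c') / real n"
          using mean[of n N] by (simp add: field_simps)
      qed
    qed
    then have "\<gamma> - s \<le> 0" by (intro LIMSEQ_le_const[OF lim0]) auto
    with s show False by simp
  qed
  ultimately have "measure S B = 0" by blast
  then have "AE x in S. x \<notin> B"
    by (subst AE_iff_measurable[OF \<open>B \<in> sets S\<close>]) (auto simp: B_def P.emeasure_eq_measure)
  with AE_space show ?thesis
  proof eventually_elim
    case (elim x)
    then obtain C :: nat where "\<forall>n. \<not> X n x \<le> s * real n - real C"
      unfolding B_def by blast
    then show ?case by (intro exI[of _ "real C"]) (simp add: not_le)
  qed
qed

theorem AE_tendsto_\<gamma>: "AE x in S. (\<lambda>n. X n x / real n) \<longlonglongrightarrow> \<gamma>"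
proof -
  have "AE x in S. \<forall>k::nat. eventually (\<lambda>n. X n x \<le> (\<gamma> + 1 / Suc k) * real n) sequentially"
    by (subst AE_all_countable, intro allI AE_upper) auto
  moreover have "AE x in S. \<forall>k::nat. \<exists>C. \<forall>n. (\<gamma> - 1 / Suc k) * real n - C < X n x"
    by (subst AE_all_countable, intro allI AE_lower) auto
  ultimately show ?thesis
  proof eventually_elim
    case (elim x)
    show ?case
    proof (rule tendstoI)
      fix e :: real assume e: "e > 0"
      obtain k :: nat where k: "1 / Suc k < e / 2" using nat_approx_posE[of "e/2"] e by auto
      obtain C where C: "\<And>n. (\<gamma> - 1 / Suc k) * real n - C < X n x" using elim(2) by blast
      have "(\<lambda>n. C / real n) \<longlonglongrightarrow> 0" by (rule lim_const_over_n)
      then have "eventually (\<lambda>n. C / real n < e / 2) sequentially"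
        using e by (intro order_tendstoD) auto
      moreover have "eventually (\<lambda>n. n > (0::nat)) sequentially" by (rule eventually_gt_at_top)
      moreover have "eventually (\<lambda>n. X n x \<le> (\<gamma> + 1 / Suc k) * real n) sequentially" using elim(1) by blast
      ultimately show "eventually (\<lambda>n. dist (X n x / real n) \<gamma> < e) sequentially"
      proof eventually_elim
        case (elim n)
        have "X n x / real n \<le> \<gamma> + 1 / Suc k" using elim by (simp add: pos_divide_le_eq)
        moreover have "\<gamma> - 1 / Suc k - C / real n \<le> X n x / real n"
        proof -
          have "(\<gamma> - 1 / Suc k - C / real n) * real n = (\<gamma> - 1 / Suc k) * real n - C"
            using elim(2) by (simp add: left_diff_distrib)
          then show ?thesis using C[of n] elim(2) by (simp add: pos_le_divide_eq)
        qed
        ultimately show ?case using k elim(1) by (simp add: dist_real_def abs_less_iff)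
      qed
    qed
  qed
qed

theorem mean_tendsto_\<gamma>: "(\<lambda>n. (\<integral>x. X n x \<partial>S) / real n) \<longlonglongrightarrow> \<gamma>"
proof -
  have "(\<lambda>n. \<integral>x. X n x / real n \<partial>S) \<longlonglongrightarrow> (\<integral>x. \<gamma> \<partial>S)"
  proof (rule integral_dominated_convergence[where w = "\<lambda>_. 2 * c"])
    show "AE x in S. (\<lambda>n. X n x / real n) \<longlonglongrightarrow> \<gamma>" by (rule AE_tendsto_\<gamma>)
    show "AE x in S. norm (X n x / real n) \<le> 2 * c" for n
    proof (rule AE_I2)
      fix x assume x: "x \<in> space S"
      show "norm (X n x / real n) \<le> 2 * c"
      proof (cases "n = 0")
        case False
        then have "c \<le> c * real n" using c_nonneg by (simp add: mult_le_cancel_left1)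
        then show ?thesis using X_bound[OF x, of n] False by (simp add: pos_divide_le_eq)
      qed (use c_nonneg in simp)
    qed
  qed auto
  then show ?thesis by (simp add: P.prob_space)
qed

end

section \<open>Singular values\<close>

definition orthonormal :: "'a::euclidean_space set \<Rightarrow> bool"
  where "orthonormal B \<longleftrightarrow> pairwise orthogonal B \<and> (\<forall>b\<in>B. norm b = 1)"

lemma orthonormal_Basis: "orthonormal (Basis :: 'a::euclidean_space set)"
  by (auto simp: orthonormal_def pairwise_def orthogonal_def inner_Basis)

lemma orthonormal_independent: "orthonormal B \<Longrightarrow> independent B"
  unfolding orthonormal_def
  by (metis norm_zero pairwise_orthogonal_independent zero_neq_one)

lemma orthonormal_finite: "orthonormal B \<Longrightarrow> finite B"
  using orthonormal_independent independent_imp_finite by blast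

lemma orthonormal_inner:
  assumes "orthonormal B" "b \<in> B" "c \<in> B"
  shows "b \<bullet> c = (if b = c then 1 else 0)"
  using assms by (auto simp: orthonormal_def pairwise_def orthogonal_def norm_eq_1)

lemma orthonormal_expansion:
  assumes B: "orthonormal B" and x: "x \<in> span B"
  shows "(\<Sum>b\<in>B. (x \<bullet> b) *\<^sub>R b) = x"
proof -
  define z where "z = x - (\<Sum>b\<in>B. (x \<bullet> b) *\<^sub>R b)"
  have z: "z \<in> span B"
    unfolding z_def by (intro span_diff x span_sum span_scale span_base)
  have "z \<bullet> c = 0" if c: "c \<in> B" for c
  proof -
    have "(\<Sum>b\<in>B. (x \<bullet> b) * (b \<bullet> c)) = (\<Sum>b\<in>B. if b = c then x \<bullet> c else 0)"
      using B c by (intro sum.cong) (auto simp: orthonormal_inner)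
    then show ?thesis
      using orthonormal_finite[OF B] c by (simp add: z_def inner_diff_left inner_sum_left)
  qed
  then have "orthogonal z z"
    by (intro orthogonal_to_span[OF z]) (simp add: orthogonal_def)
  then show ?thesis by (simp add: z_def orthogonal_def)
qed

text \<open>Parseval's identity for a basis whose images stay orthogonal. It is applied both to a
  matrix and to the identity map.\<close>

lemma orthonormal_inner_image:
  fixes f :: "'a::euclidean_space \<Rightarrow> 'b::real_inner"
  assumes B: "orthonormal B" and f: "linear f"
    and orth: "\<And>b c. b \<in> B \<Longrightarrow> c \<in> B \<Longrightarrow> b \<noteq> c \<Longrightarrow> f b \<bullet> f c = 0"
    and xy: "x \<in> span B" "y \<in> span B"
  shows "f x \<bullet> f y = (\<Sum>b\<in>B. (x \<bullet> b) * (y \<bullet> b) * (norm (f b))\<^sup>2)"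
proof -
  have fin: "finite B" by (rule orthonormal_finite[OF B])
  have e: "f z = (\<Sum>b\<in>B. (z \<bullet> b) *\<^sub>R f b)" if "z \<in> span B" for z
    by (subst orthonormal_expansion[OF B that, symmetric]) (simp add: linear_sum[OF f] linear_scale[OF f])
  have "f x \<bullet> f y = (\<Sum>b\<in>B. \<Sum>c\<in>B. (x \<bullet> b) * ((y \<bullet> c) * (f b \<bullet> f c)))"
    unfolding e[OF xy(1)] e[OF xy(2)]
    by (subst sum.swap) (simp add: inner_sum_left inner_sum_right sum_distrib_left mult_ac)
  also have "\<dots> = (\<Sum>b\<in>B. \<Sum>c\<in>B. if c = b then (x \<bullet> b) * (y \<bullet> b) * (norm (f b))\<^sup>2 else 0)"
    using orth by (intro sum.cong) (auto simp: power2_norm_eq_inner)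
  finally show ?thesis using fin by simp
qed

text \<open>Right singular vectors of the restriction of \<open>g\<close> to \<open>V\<close>,
  largest singular value first. As \<open>sorted_wrt\<close> speaks of all pairs of positions, one
  relation encodes orthogonality of the vectors, orthogonality of the images and the order.\<close>

definition sv_basis :: "(real^'n::finite) set \<Rightarrow> real^'n^'n \<Rightarrow> (real^'n) list \<Rightarrow> bool"
  where "sv_basis V g vs \<longleftrightarrow> set vs \<subseteq> V \<and> length vs = dim V \<and> (\<forall>v\<in>set vs. norm v = 1) \<and>
    sorted_wrt (\<lambda>v w. v \<bullet> w = 0 \<and> (g *v v) \<bullet> (g *v w) = 0 \<and> norm (g *v w) \<le> norm (g *v v)) vs"

text \<open>The first order condition at a maximum, without derivatives: for small \<open>t\<close>
  of the sign of \<open>a\<close> the linear term would win.\<close>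

lemma quadratic_first_order:
  fixes a b :: real
  assumes "\<And>t. 2 * t * a \<le> t\<^sup>2 * b"
  shows "a = 0"
proof (rule ccontr)
  assume a: "a \<noteq> 0"
  define B where "B = \<bar>b\<bar> + 1"
  have B: "B > 0" by (simp add: B_def)
  have "2 * (a / B) * a \<le> (a / B)\<^sup>2 * b" by (rule assms)
  then have "2 * a\<^sup>2 * B \<le> a\<^sup>2 * b"
    using B by (simp add: field_simps power2_eq_square)
  then have "2 * B \<le> b" using a by (simp add: mult.assoc)
  then show False by (simp add: B_def)
qed

text \<open>The spectral theorem by maximisation. A unit vector \<open>v\<close> of \<open>V\<close>
  with the longest image is split off; maximality makes \<open>g *v v\<close> orthogonal to the
  image of the complement \<open>U\<close> of \<open>v\<close> in \<open>V\<close>, so the induction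
  can continue inside \<open>U\<close>.\<close>

lemma sv_basis_exists:
  assumes "subspace V"
  shows "\<exists>vs. sv_basis V g vs"
  using assms
proof (induction "dim V" arbitrary: V)
  case 0
  then show ?case by (intro exI[of _ "[]"]) (simp add: sv_basis_def)
next
  case (Suc n V)
  let ?K = "V \<inter> sphere 0 1"
  have cont: "continuous_on ?K (\<lambda>w. norm (g *v w))"
    by (intro continuous_on_norm linear_continuous_on) simp
  have "V \<noteq> {0}" using Suc.hyps(2) by auto
  then obtain z where z: "z \<in> V" "z \<noteq> 0" using subspace_0[OF Suc.prems] by blast
  have "z /\<^sub>R norm z \<in> ?K" using z by (simp add: subspace_scale[OF Suc.prems])
  then have "?K \<noteq> {}" by blast
  moreover have "compact ?K" by (intro closed_Int_compact closed_subspace Suc.prems) auto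
  ultimately obtain v where v: "v \<in> ?K" "\<And>w. w \<in> ?K \<Longrightarrow> norm (g *v w) \<le> norm (g *v v)"
    using continuous_attains_sup[OF _ _ cont] by blast
  define s where "s = norm (g *v v)"
  have vV: "v \<in> V" and vn: "norm v = 1" using v by auto
  have max: "norm (g *v w) \<le> s * norm w" if w: "w \<in> V" for w
  proof (cases "w = 0")
    case False
    then have "norm (g *v (w /\<^sub>R norm w)) \<le> s"
      unfolding s_def using w by (intro v) (simp add: subspace_scale[OF Suc.prems])
    with False show ?thesis by (simp add: matrix_vector_mult_scaleR field_simps)
  qed simp
  define U where "U = {w \<in> V. w \<bullet> v = 0}"
  have U: "subspace U"
    using Suc.prems by (auto simp: U_def subspace_def inner_add_left)
  \<comment> \<open>Compare \<open>v\<close> with \<open>v + t *\<^sub>R w\<close>: expanding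
    \<open>norm (g *v (v + t *\<^sub>R w)) \<le> s * norm (v + t *\<^sub>R w)\<close> after squaring
    leaves a linear term that must vanish.\<close>
  have orth: "(g *v v) \<bullet> (g *v w) = 0" if w: "w \<in> U" for w
  proof (rule quadratic_first_order[where b = "s\<^sup>2 * (norm w)\<^sup>2 - (norm (g *v w))\<^sup>2"])
    fix t
    have "v + t *\<^sub>R w \<in> V" using w vV Suc.prems by (simp add: U_def subspace_add subspace_scale)
    then have "(norm (g *v (v + t *\<^sub>R w)))\<^sup>2 \<le> (s * norm (v + t *\<^sub>R w))\<^sup>2"
      using max by (intro power_mono) auto
    moreover have "(norm (g *v (v + t *\<^sub>R w)))\<^sup>2 = s\<^sup>2 + 2 * t * ((g *v v) \<bullet> (g *v w)) + t\<^sup>2 * (norm (g *v w))\<^sup>2"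
      by (simp add: s_def matrix_vector_right_distrib matrix_vector_mult_scaleR power2_norm_eq_inner
          inner_add_left inner_add_right inner_commute power2_eq_square[of t] algebra_simps)
    moreover have "(norm (v + t *\<^sub>R w))\<^sup>2 = 1 + t\<^sup>2 * (norm w)\<^sup>2"
      using w vn by (simp add: U_def power2_norm_eq_inner inner_add_left inner_add_right
          inner_commute power2_eq_square[of t] algebra_simps norm_eq_1)
    ultimately show "2 * t * ((g *v v) \<bullet> (g *v w)) \<le> t\<^sup>2 * (s\<^sup>2 * (norm w)\<^sup>2 - (norm (g *v w))\<^sup>2)"
      by (simp add: power_mult_distrib algebra_simps)
  qed
  have "v \<notin> span U"
    using vn by (simp add: span_eq_iff[THEN iffD2, OF U]) (auto simp: U_def norm_eq_1)
  moreover have "span (insert v U) = V"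
  proof
    show "span (insert v U) \<subseteq> V"
      using vV by (intro span_minimal Suc.prems) (auto simp: U_def)
    show "V \<subseteq> span (insert v U)"
    proof
      fix w assume w: "w \<in> V"
      have "w - (w \<bullet> v) *\<^sub>R v \<in> U"
        using w vV vn Suc.prems
        by (auto simp: U_def inner_diff_left norm_eq_1 intro!: subspace_diff subspace_scale)
      then have "(w - (w \<bullet> v) *\<^sub>R v) + (w \<bullet> v) *\<^sub>R v \<in> span (insert v U)"
        by (intro span_add span_scale span_base) auto
      then show "w \<in> span (insert v U)" by simp
    qed
  qed
  ultimately have dimU: "dim V = Suc (dim U)"
    using dim_insert[of v U] dim_span[of "insert v U"] by simp
  then obtain vs where vs: "sv_basis U g vs"
    using Suc.hyps(1)[of U] Suc.hyps(2) U by auto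
  have "sv_basis V g (v # vs)"
    unfolding sv_basis_def
  proof (intro conjI)
    show "sorted_wrt (\<lambda>v w. v \<bullet> w = 0 \<and> (g *v v) \<bullet> (g *v w) = 0 \<and> norm (g *v w) \<le> norm (g *v v)) (v # vs)"
    proof -
      have "v \<bullet> w = 0 \<and> (g *v v) \<bullet> (g *v w) = 0 \<and> norm (g *v w) \<le> norm (g *v v)" if w: "w \<in> set vs" for w
      proof -
        have "w \<in> U" "norm w = 1" using w vs by (auto simp: sv_basis_def)
        then show ?thesis
          using orth[of w] max[of w] by (simp add: U_def s_def inner_commute[of v w])
      qed
      then show ?thesis using vs by (simp add: sv_basis_def)
    qed
  qed (use vs vV vn dimU in \<open>auto simp: sv_basis_def U_def\<close>)
  then show ?case by blast
qed

lemma sv_basisD: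
  assumes V: "subspace V" and vs: "sv_basis V g vs"
  shows "distinct vs" "orthonormal (set vs)" "span (set vs) = V"
    "\<And>v w. v \<in> set vs \<Longrightarrow> w \<in> set vs \<Longrightarrow> v \<noteq> w \<Longrightarrow> (g *v v) \<bullet> (g *v w) = 0"
proof -
  let ?R = "\<lambda>v w. v \<bullet> w = 0 \<and> (g *v v) \<bullet> (g *v w) = 0 \<and> norm (g *v w) \<le> norm (g *v v)"
  have s: "sorted_wrt ?R vs" and n: "\<And>v. v \<in> set vs \<Longrightarrow> v \<bullet> v = 1"
    using vs by (auto simp: sv_basis_def norm_eq_1)
  have lt: "?R (vs ! i) (vs ! j)" if "i < j" "j < length vs" for i j
    using sorted_wrt_nth_less[OF s that] .
  show dist: "distinct vs"
  proof -
    have ne: "vs ! i \<noteq> vs ! j" if "i < j" "j < length vs" for i j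
      using lt[OF that] n[of "vs ! j"] that by auto
    show ?thesis
      unfolding distinct_conv_nth
    proof (intro allI impI)
      fix i j assume "i < length vs" "j < length vs" "i \<noteq> j"
      then show "vs ! i \<noteq> vs ! j" using ne[of i j] ne[of j i] by (cases "i < j") auto
    qed
  qed
  have sym: "v \<bullet> w = 0 \<and> (g *v v) \<bullet> (g *v w) = 0"
    if v: "v \<in> set vs" and w: "w \<in> set vs" and ne: "v \<noteq> w" for v w
  proof -
    obtain i j where ij: "v = vs ! i" "w = vs ! j" "i < length vs" "j < length vs"
      using v w by (auto simp: in_set_conv_nth)
    then have "i \<noteq> j" using ne by blast
    then have "i < j \<or> j < i" by linarith
    then show ?thesis
    proof
      assume "i < j"
      from lt[OF this ij(4)] show ?thesis by (simp add: ij)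
    next
      assume "j < i"
      from lt[OF this ij(3)] show ?thesis by (simp add: ij inner_commute)
    qed
  qed
  show o: "orthonormal (set vs)"
    using sym vs by (auto simp: orthonormal_def pairwise_def orthogonal_def sv_basis_def)
  show "span (set vs) = V"
  proof
    show "span (set vs) \<subseteq> V" using vs V by (intro span_minimal) (auto simp: sv_basis_def)
    have "card (set vs) = dim V" using dist vs by (simp add: distinct_card sv_basis_def)
    then show "V \<subseteq> span (set vs)"
      using card_eq_dim[of "set vs" V] orthonormal_independent[OF o] vs by (auto simp: sv_basis_def)
  qed
  show "(g *v v) \<bullet> (g *v w) = 0" if "v \<in> set vs" "w \<in> set vs" "v \<noteq> w" for v w
    using sym[OF that] by blast
qed

lemma sorted_desc_unique:
  fixes xs ys :: "real list"
  assumes "sorted_wrt (\<ge>) xs" "sorted_wrt (\<ge>) ys" "\<And>s. count_list xs s = count_list ys s"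
  shows "xs = ys"
proof -
  have "mset (rev xs) = mset (rev ys)"
    using assms(3) by (intro multiset_eqI) (simp add: count_mset count_list_eq_length_filter)
  moreover have "sorted (rev xs)" "sorted (rev ys)"
    using assms(1,2) by (simp_all add: sorted_wrt_rev)
  ultimately have "rev xs = rev ys"
    by (metis properties_for_sort)
  then show ?thesis by simp
qed

text \<open>Discharges the definite description. The eigenspace for \<open>s\<close> is spanned by
  the basis vectors whose image has norm \<open>s\<close>, so multiplicities are dimensions of
  eigenspaces; a decreasing list is determined by its multiplicities.\<close>

lemma singular_values_eq:
  assumes V: "subspace V" and vs: "sv_basis V g vs"
  shows "singular_values V g = map (\<lambda>v. norm (g *v v)) vs"
proof -
  note D = sv_basisD[OF V vs]
  let ?ss = "map (\<lambda>v. norm (g *v v)) vs"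
  have lin: "linear ((*v) g)" by simp
  have eig: "sv_eigenspace V g s = span {v \<in> set vs. norm (g *v v) = s}" if s: "0 \<le> s" for s
  proof
    show "sv_eigenspace V g s \<subseteq> span {v \<in> set vs. norm (g *v v) = s}"
    proof
      fix v assume v: "v \<in> sv_eigenspace V g s"
      then have vV: "v \<in> span (set vs)" by (simp add: sv_eigenspace_def D)
      \<comment> \<open>Testing the eigenvalue equation against \<open>b\<close> gives two multiples
        of \<open>v \<bullet> b\<close> that must agree although their factors, the squares of
        \<open>norm (g *v b)\<close> and of \<open>s\<close>, differ.\<close>
      have z: "v \<bullet> b = 0" if b: "b \<in> set vs" "norm (g *v b) \<noteq> s" for b
      proof -
        have bV: "b \<in> span (set vs)" using b by (simp add: span_base)
        have "(g *v v) \<bullet> (g *v b) = (\<Sum>c\<in>set vs. (v \<bullet> c) * (b \<bullet> c) * (norm (g *v c))\<^sup>2)"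
          using D by (intro orthonormal_inner_image lin vV bV) auto
        also have "\<dots> = (\<Sum>c\<in>set vs. if c = b then (v \<bullet> b) * (norm (g *v b))\<^sup>2 else 0)"
          using b by (intro sum.cong) (auto simp: orthonormal_inner[OF D(2)])
        finally have "(v \<bullet> b) * (norm (g *v b))\<^sup>2 = s\<^sup>2 * (v \<bullet> b)"
          using v b bV by (auto simp: sv_eigenspace_def D)
        moreover have "(norm (g *v b))\<^sup>2 \<noteq> s\<^sup>2" using b s by (metis norm_ge_zero power2_eq_iff_nonneg)
        ultimately show ?thesis by simp
      qed
      have "v = (\<Sum>b\<in>set vs. (v \<bullet> b) *\<^sub>R b)"
        using orthonormal_expansion[OF D(2) vV] by simp
      also have "\<dots> = (\<Sum>b\<in>{v \<in> set vs. norm (g *v v) = s}. (v \<bullet> b) *\<^sub>R b)"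
        using z by (intro sum.mono_neutral_right) auto
      also have "\<dots> \<in> span {v \<in> set vs. norm (g *v v) = s}"
        by (intro span_sum span_scale span_base)
      finally show "v \<in> span {v \<in> set vs. norm (g *v v) = s}" .
    qed
    show "span {v \<in> set vs. norm (g *v v) = s} \<subseteq> sv_eigenspace V g s"
    proof (rule span_minimal)
      show "subspace (sv_eigenspace V g s)"
        using V by (auto simp: subspace_def sv_eigenspace_def matrix_vector_right_distrib
            matrix_vector_mult_scaleR inner_add_left algebra_simps)
      show "{v \<in> set vs. norm (g *v v) = s} \<subseteq> sv_eigenspace V g s"
      proof safe
        fix b assume b: "b \<in> set vs" "s = norm (g *v b)"
        have bV: "b \<in> span (set vs)" using b by (simp add: span_base)
        have "(g *v b) \<bullet> (g *v w) = s\<^sup>2 * (b \<bullet> w)" if w: "w \<in> V" for w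
        proof -
          have "(g *v b) \<bullet> (g *v w) = (\<Sum>c\<in>set vs. (b \<bullet> c) * (w \<bullet> c) * (norm (g *v c))\<^sup>2)"
            using D w by (intro orthonormal_inner_image lin bV) auto
          also have "\<dots> = (\<Sum>c\<in>set vs. if c = b then (w \<bullet> b) * (norm (g *v b))\<^sup>2 else 0)"
            using b by (intro sum.cong) (auto simp: orthonormal_inner[OF D(2)])
          finally show ?thesis using b by (simp add: inner_commute)
        qed
        then show "b \<in> sv_eigenspace V g (norm (g *v b))"
          using b bV by (simp add: sv_eigenspace_def D)
      qed
    qed
  qed
  have cnt: "count_list ?ss s = dim (sv_eigenspace V g s)" if "0 \<le> s" for s
  proof -
    let ?F = "{v \<in> set vs. norm (g *v v) = s}"
    have "independent ?F"
      using orthonormal_independent[OF D(2)] by (rule independent_mono) auto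
    then have "dim (span ?F) = card ?F" by (simp add: dim_eq_card_independent)
    also have "?F = set (filter (\<lambda>v. norm (g *v v) = s) vs)" by auto
    also have "card \<dots> = length (filter (\<lambda>v. norm (g *v v) = s) vs)"
      using D(1) by (intro distinct_card) simp
    also have "\<dots> = count_list ?ss s"
      by (simp add: count_list_eq_length_filter filter_map o_def eq_commute)
    finally show ?thesis using eig[OF that] by simp
  qed
  have sorted: "sorted_wrt (\<ge>) ?ss"
    using vs by (auto simp: sv_basis_def sorted_wrt_map elim: sorted_wrt_mono_rel[rotated])
  show ?thesis
    unfolding singular_values_def
  proof (rule the_equality)
    show "length ?ss = dim V \<and> sorted_wrt (\<ge>) ?ss \<and> (\<forall>s\<in>set ?ss. 0 \<le> s) \<and>
        (\<forall>s\<ge>0. count_list ?ss s = dim (sv_eigenspace V g s))"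
      using vs cnt sorted by (auto simp: sv_basis_def)
    fix ss assume ss: "length ss = dim V \<and> sorted_wrt (\<ge>) ss \<and> (\<forall>s\<in>set ss. 0 \<le> s) \<and>
        (\<forall>s\<ge>0. count_list ss s = dim (sv_eigenspace V g s))"
    show "ss = ?ss"
    proof (rule sorted_desc_unique)
      fix s
      show "count_list ss s = count_list ?ss s"
      proof (cases "0 \<le> s")
        case False
        then have "s \<notin> set ss" "s \<notin> set ?ss" using ss by auto
        then show ?thesis by (metis count_list_0_iff)
      qed (use ss cnt in auto)
    qed (use ss sorted in auto)
  qed
qed

lemma singular_value_1:
  assumes V: "subspace V" "V \<noteq> {0}"
  obtains v where "v \<in> V" "norm v = 1" "singular_value V 1 g = norm (g *v v)"
    "\<And>w. w \<in> V \<Longrightarrow> norm (g *v w) \<le> singular_value V 1 g * norm w"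
proof -
  obtain vs where vs: "sv_basis V g vs" using sv_basis_exists V(1) by blast
  note D = sv_basisD[OF V(1) vs]
  have "vs \<noteq> []"
    using vs V subspace_0[OF V(1)] by (auto simp: sv_basis_def dim_eq_0)
  then obtain v ws where v: "vs = v # ws" by (cases vs) auto
  have s: "singular_value V 1 g = norm (g *v v)"
    by (simp add: singular_value_def singular_values_eq[OF V(1) vs] v)
  have le: "norm (g *v b) \<le> norm (g *v v)" if "b \<in> set vs" for b
    using vs that by (auto simp: sv_basis_def v)
  show thesis
  proof
    show "v \<in> V" "norm v = 1" using vs by (auto simp: sv_basis_def v)
    show "singular_value V 1 g = norm (g *v v)" by (rule s)
    fix w assume "w \<in> V"
    then have w: "w \<in> span (set vs)" by (simp add: D)
    have "(norm (g *v w))\<^sup>2 = (\<Sum>c\<in>set vs. (w \<bullet> c) * (w \<bullet> c) * (norm (g *v c))\<^sup>2)"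
      unfolding power2_norm_eq_inner[of "g *v w"]
      using D by (intro orthonormal_inner_image w) auto
    also have "\<dots> \<le> (\<Sum>c\<in>set vs. (w \<bullet> c) * (w \<bullet> c) * (norm (g *v v))\<^sup>2)"
      using le by (intro sum_mono mult_left_mono power_mono) auto
    also have "\<dots> = (norm (g *v v))\<^sup>2 * (norm w)\<^sup>2"
      using orthonormal_inner_image[OF D(2), of "\<lambda>x. x" w w] w D(2) orthonormal_inner[OF D(2)]
      by (simp add: power2_norm_eq_inner sum_distrib_left mult.commute orthonormal_def norm_eq_1 linear_iff)
    finally have "(norm (g *v w))\<^sup>2 \<le> (norm (g *v v) * norm w)\<^sup>2" by (simp add: power_mult_distrib)
    then show "norm (g *v w) \<le> singular_value V 1 g * norm w"
      unfolding s by (rule power2_le_imp_le) simp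
  qed
qed

section \<open>The exterior square\<close>

text \<open>\<open>norm\<close> on matrices is the Euclidean norm of the entries, i.e. the Frobenius
  norm; Cauchy-Schwarz in each row shows that it dominates the operator norm.\<close>

lemma norm_matrix_vector_le: "norm (A *v x) \<le> norm A * norm x" for A :: "real^'n::finite^'m::finite"
proof -
  have "norm (A *v x) = L2_set (\<lambda>i. \<bar>A $ i \<bullet> x\<bar>) UNIV"
    by (simp add: norm_vec_def matrix_vector_mul_component)
  also have "\<dots> \<le> L2_set (\<lambda>i. norm (A $ i) * norm x) UNIV"
    by (intro L2_set_mono Cauchy_Schwarz_ineq2) auto
  also have "\<dots> = norm A * norm x"
    by (simp add: norm_vec_def[of A] L2_set_left_distrib)
  finally show ?thesis .
qed

lemma norm_transpose: "norm (transpose A) = norm A" for A :: "real^'n::finite^'m::finite"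
proof -
  have "(\<Sum>i\<in>UNIV. \<Sum>j\<in>UNIV. (A $ j $ i)\<^sup>2) = (\<Sum>j\<in>UNIV. \<Sum>i\<in>UNIV. (A $ j $ i)\<^sup>2)"
    by (rule sum.swap)
  then show ?thesis
    by (simp add: norm_vec_def L2_set_def transpose_def sum_nonneg)
qed

lemma norm_matrix_mult_le: "norm (A ** B) \<le> norm A * norm B"
  for A :: "real^'n::finite^'m::finite" and B :: "real^'k::finite^'n"
proof -
  have row: "(A ** B) $ i = transpose B *v (A $ i)" for i
    by (simp add: vec_eq_iff matrix_matrix_mult_def matrix_vector_mult_def transpose_def mult.commute)
  have "norm (A ** B) = L2_set (\<lambda>i. norm (transpose B *v (A $ i))) UNIV"
    by (simp add: norm_vec_def[of "A ** B"] row)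
  also have "\<dots> \<le> L2_set (\<lambda>i. norm B * norm (A $ i)) UNIV"
    using norm_matrix_vector_le[of "transpose B"] by (intro L2_set_mono) (auto simp: norm_transpose)
  also have "\<dots> = norm A * norm B"
    by (simp add: norm_vec_def[of A] L2_set_right_distrib mult.commute)
  finally show ?thesis .
qed

lemma norm_matrix_le_columns: "norm A \<le> (\<Sum>j\<in>UNIV. norm (A *v axis j 1))"
  for A :: "real^'n::finite^'m::finite"
proof -
  have "norm A = L2_set (\<lambda>j. norm (transpose A $ j)) UNIV"
    by (metis norm_transpose norm_vec_def)
  also have "\<dots> \<le> (\<Sum>j\<in>UNIV. norm (transpose A $ j))" by (rule L2_set_le_sum) auto
  also have "(\<lambda>j. transpose A $ j) = (\<lambda>j. A *v axis j 1)"
    by (simp add: matrix_vector_mult_basis fun_eq_iff vec_eq_iff transpose_def column_def)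
  then have "(\<Sum>j\<in>UNIV. norm (transpose A $ j)) = (\<Sum>j\<in>UNIV. norm (A *v axis j 1))"
    by (metis (mono_tags, lifting))
  finally show ?thesis .
qed

text \<open>The converse comparison of Frobenius and operator norm, column by column; it is the
  origin of the factors \<open>real CARD('n) * \<kappa>\<close> below.\<close>

lemma norm_matrix_le_bound:
  fixes A :: "real^'n::finite^'m::finite"
  assumes "\<And>v. norm (A *v v) \<le> \<kappa> * norm v"
  shows "norm A \<le> real CARD('n) * \<kappa>"
proof -
  have "norm (A *v axis j 1) \<le> \<kappa>" for j :: 'n
    using assms[of "axis j 1"] by simp
  then have "(\<Sum>j\<in>UNIV. norm (A *v axis j 1)) \<le> (\<Sum>j\<in>(UNIV :: 'n set). \<kappa>)"
    by (intro sum_mono)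
  with norm_matrix_le_columns[of A] show ?thesis by simp
qed

text \<open>The exterior product \<open>u \<and> v\<close> as an antisymmetric matrix. Its norm is \<open>sqrt 2\<close> times the area of
  the parallelogram spanned by \<open>u\<close> and \<open>v\<close>.\<close>

definition wedge :: "real^'n::finite \<Rightarrow> real^'n \<Rightarrow> real^'n^'n"
  where "wedge u v = (\<chi> i j. u $ i * v $ j - u $ j * v $ i)"

lemma wedge_nth: "wedge u v $ i $ j = u $ i * v $ j - u $ j * v $ i"
  by (simp add: wedge_def)

lemma Lagrange_identity:
  fixes a b :: "'a \<Rightarrow> real"
  shows "(\<Sum>i\<in>A. \<Sum>j\<in>A. (a i * b j - a j * b i)\<^sup>2) =
    2 * ((\<Sum>i\<in>A. (a i)\<^sup>2) * (\<Sum>i\<in>A. (b i)\<^sup>2) - (\<Sum>i\<in>A. a i * b i)\<^sup>2)"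
proof -
  have "(\<Sum>i\<in>A. \<Sum>j\<in>A. (a i * b j - a j * b i)\<^sup>2) =
      (\<Sum>i\<in>A. \<Sum>j\<in>A. (a i)\<^sup>2 * (b j)\<^sup>2) + (\<Sum>i\<in>A. \<Sum>j\<in>A. (b i)\<^sup>2 * (a j)\<^sup>2)
      - 2 * (\<Sum>i\<in>A. \<Sum>j\<in>A. (a i * b i) * (a j * b j))"
    by (simp add: power2_eq_square algebra_simps sum.distrib sum_subtractf sum_distrib_left)
  also have "\<dots> = 2 * ((\<Sum>i\<in>A. (a i)\<^sup>2) * (\<Sum>i\<in>A. (b i)\<^sup>2) - (\<Sum>i\<in>A. a i * b i)\<^sup>2)"
    unfolding sum_product[symmetric] by (simp add: power2_eq_square[of "\<Sum>i\<in>A. a i * b i"])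
  finally show ?thesis .
qed

lemma norm_wedge_sq: "(norm (wedge u v))\<^sup>2 = 2 * ((norm u)\<^sup>2 * (norm v)\<^sup>2 - (u \<bullet> v)\<^sup>2)"
proof -
  have "(norm (wedge u v))\<^sup>2 = (\<Sum>i\<in>UNIV. \<Sum>j\<in>UNIV. (u $ i * v $ j - u $ j * v $ i)\<^sup>2)"
    by (simp add: norm_vec_def L2_set_def sum_nonneg wedge_nth)
  also have "\<dots> = 2 * ((\<Sum>i\<in>UNIV. (u $ i)\<^sup>2) * (\<Sum>i\<in>UNIV. (v $ i)\<^sup>2) - (\<Sum>i\<in>UNIV. u $ i * v $ i)\<^sup>2)"
    by (rule Lagrange_identity)
  also have "\<dots> = 2 * ((norm u)\<^sup>2 * (norm v)\<^sup>2 - (u \<bullet> v)\<^sup>2)"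
    by (simp add: norm_vec_def L2_set_def sum_nonneg inner_vec_def)
  finally show ?thesis .
qed

lemma norm_wedge_le: "norm (wedge u v) \<le> 2 * norm u * norm v"
proof (rule power2_le_imp_le)
  show "(norm (wedge u v))\<^sup>2 \<le> (2 * norm u * norm v)\<^sup>2"
  proof -
    have eq: "(2 * norm u * norm v)\<^sup>2 = 4 * ((norm u)\<^sup>2 * (norm v)\<^sup>2)"
      by (simp add: power_mult_distrib)
    have t: "2 * (a - b) \<le> 4 * a" if "0 \<le> a" "0 \<le> b" for a b :: real
      using that by simp
    show ?thesis
      unfolding norm_wedge_sq eq by (rule t) auto
  qed
qed auto

lemma wedge_simps:
  "wedge (u + u') v = wedge u v + wedge u' v" "wedge u (v + v') = wedge u v + wedge u v'"
  "wedge (u - u') v = wedge u v - wedge u' v" "wedge u (v - v') = wedge u v - wedge u v'"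
  "wedge (c *\<^sub>R u) v = c *\<^sub>R wedge u v" "wedge u (c *\<^sub>R v) = c *\<^sub>R wedge u v"
  "wedge u u = 0"
  by (simp_all add: vec_eq_iff wedge_nth algebra_simps)

lemma wedge_commute: "wedge v u = - wedge u v"
  by (simp add: vec_eq_iff wedge_nth)

text \<open>A matrix acts on bivectors by congruence, so estimates of this action reduce to
  submultiplicativity of the matrix norm.\<close>

lemma wedge_matrix: "wedge (g *v u) (g *v v) = g ** wedge u v ** transpose g"
proof -
  have "(g ** wedge u v ** transpose g) $ i $ j = (g *v u) $ i * (g *v v) $ j - (g *v u) $ j * (g *v v) $ i" for i j
  proof -
    have "(g ** wedge u v ** transpose g) $ i $ j =
        (\<Sum>l\<in>UNIV. (\<Sum>k\<in>UNIV. g $ i $ k * (u $ k * v $ l - u $ l * v $ k)) * g $ j $ l)"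
      by (simp add: matrix_matrix_mult_def transpose_def wedge_nth)
    also have "\<dots> = (\<Sum>l\<in>UNIV. \<Sum>k\<in>UNIV. (g $ i $ k * u $ k) * (g $ j $ l * v $ l)) -
        (\<Sum>l\<in>UNIV. \<Sum>k\<in>UNIV. (g $ j $ l * u $ l) * (g $ i $ k * v $ k))"
      by (simp add: sum_distrib_right sum_distrib_left left_diff_distrib right_diff_distrib sum_subtractf mult_ac)
    also have "\<dots> = (g *v u) $ i * (g *v v) $ j - (g *v u) $ j * (g *v v) $ i"
      by (subst (1) sum.swap) (simp add: matrix_vector_mult_def sum_product)
    finally show ?thesis .
  qed
  then show ?thesis by (simp add: vec_eq_iff wedge_nth)
qed

text \<open>Telescoping the congruence in its two factors. The factor
  \<open>norm (wedge u v)\<close> on the right is what matters: perturbation errors stay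
  proportional to the distance of the directions.\<close>

lemma wedge_matrix_diff_le:
  fixes g h :: "real^'n::finite^'n"
  shows "norm (wedge (g *v u) (g *v v) - wedge (h *v u) (h *v v)) \<le>
    norm (g - h) * (norm g + norm h) * norm (wedge u v)"
proof -
  let ?X = "wedge u v"
  have "g ** ?X ** transpose g - h ** ?X ** transpose h =
      (g - h) ** ?X ** transpose g + h ** ?X ** transpose (g - h)"
    by (simp add: matrix_matrix_mult_def transpose_def vec_eq_iff sum_subtractf left_diff_distrib
        right_diff_distrib)
  also have "norm \<dots> \<le> norm (g - h) * norm ?X * norm g + norm h * norm ?X * norm (g - h)"
  proof (rule norm_triangle_mono)
    show "norm ((g - h) ** ?X ** transpose g) \<le> norm (g - h) * norm ?X * norm g"
      by (rule order_trans[OF norm_matrix_mult_le])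
        (auto simp: norm_transpose intro!: mult_right_mono norm_matrix_mult_le)
    show "norm (h ** ?X ** transpose (g - h)) \<le> norm h * norm ?X * norm (g - h)"
      by (rule order_trans[OF norm_matrix_mult_le])
        (auto simp: norm_transpose intro!: mult_right_mono norm_matrix_mult_le)
  qed
  finally show ?thesis by (simp add: wedge_matrix algebra_simps)
qed

lemma norm_wedge_matrix_le: "norm (wedge (g *v u) (g *v v)) \<le> (norm g)\<^sup>2 * norm (wedge u v)"
  for g :: "real^'n::finite^'n"
  using wedge_matrix_diff_le[of g u v 0] by (simp add: power2_eq_square wedge_simps)

text \<open>A substitute for the norm of the exterior square: comparable with the product of the two
  largest singular values, submultiplicative, and evidently measurable.\<close>

definition wedge_norm :: "real^'n::finite^'n \<Rightarrow> real"
  where "wedge_norm g = (\<Sum>i\<in>UNIV. \<Sum>j\<in>UNIV. norm (wedge (g *v axis i 1) (g *v axis j 1)))"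

lemma wedge_norm_bound: "norm (wedge (g *v u) (g *v v)) \<le> wedge_norm g * norm (wedge u v)"
  for g :: "real^'n::finite^'n"
proof -
  let ?e = "\<lambda>i. axis i 1 :: real^'n"
  define S where "S = (\<Sum>i\<in>UNIV. \<Sum>j\<in>UNIV. wedge u v $ i $ j *\<^sub>R wedge (g *v ?e i) (g *v ?e j))"
  have gexp: "g *v w = (\<Sum>i\<in>UNIV. w $ i *\<^sub>R (g *v ?e i))" for w
    by (simp add: matrix_mult_sum[of g w] matrix_vector_mult_basis scalar_mult_eq_scaleR)
  have sumL: "wedge (\<Sum>i\<in>I. f i) w = (\<Sum>i\<in>I. wedge (f i) w)" for I :: "'n set" and f and w :: "real^'n"
    by (simp add: vec_eq_iff wedge_nth sum_component sum_distrib_left sum_distrib_right sum_subtractf)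
  have sumR: "wedge w (\<Sum>i\<in>I. f i) = (\<Sum>i\<in>I. wedge w (f i))" for I :: "'n set" and f and w :: "real^'n"
    by (simp add: vec_eq_iff wedge_nth sum_component sum_distrib_left sum_distrib_right sum_subtractf)
  have W: "wedge (g *v x) (g *v y) = (\<Sum>i\<in>UNIV. \<Sum>j\<in>UNIV. (x $ i * y $ j) *\<^sub>R wedge (g *v ?e i) (g *v ?e j))" for x y
    unfolding gexp[of x] gexp[of y]
    by (subst sum.swap) (simp add: sumL sumR wedge_simps(5,6) scaleR_sum_right mult.commute)
  \<comment> \<open>The products \<open>u $ i * v $ j\<close> in the expansion are not controlled by
    \<open>wedge u v\<close>. Subtracting the expansion with \<open>u\<close> and \<open>v\<close>
    exchanged turns them into entries of \<open>wedge u v\<close>, at the cost of counting the left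
    side twice.\<close>
  have "S = wedge (g *v u) (g *v v) - wedge (g *v v) (g *v u)"
    unfolding W[of u v] W[of v u] S_def by (simp add: wedge_nth scaleR_diff_left sum_subtractf mult.commute)
  then have "S = 2 *\<^sub>R wedge (g *v u) (g *v v)"
    by (simp add: wedge_commute[of "g *v v"] scaleR_2)
  then have "2 * norm (wedge (g *v u) (g *v v)) = norm S" by simp
  also have "\<dots> \<le> (\<Sum>i\<in>UNIV. \<Sum>j\<in>UNIV. norm (wedge u v) * norm (wedge (g *v ?e i) (g *v ?e j)))"
    unfolding S_def
  proof (intro sum_norm_le)
    fix i j
    have "\<bar>wedge u v $ i $ j\<bar> \<le> norm (wedge u v)"
      using Finite_Cartesian_Product.norm_nth_le[of "wedge u v $ i" j]
        Finite_Cartesian_Product.norm_nth_le[of "wedge u v" i] by simp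
    then show "norm (wedge u v $ i $ j *\<^sub>R wedge (g *v ?e i) (g *v ?e j)) \<le>
        norm (wedge u v) * norm (wedge (g *v ?e i) (g *v ?e j))"
      by (simp add: mult_right_mono)
  qed
  also have "\<dots> = wedge_norm g * norm (wedge u v)"
    by (simp add: wedge_norm_def sum_distrib_left mult.commute)
  finally show ?thesis
    using norm_ge_zero[of "wedge (g *v u) (g *v v)"] by linarith
qed

text \<open>The lower bound tests \<open>wedge_norm\<close> on the first two singular vectors. For
  the upper bound, the image bivector has, in the singular basis, its coordinate at the pair
  \<open>b\<close>, \<open>c\<close> multiplied by \<open>norm (g *v b) * norm (g *v c)\<close>,
  which is at most \<open>s\<close> for \<open>b \<noteq> c\<close>.\<close>

lemma singular_value_12:
  fixes g :: "real^'n::finite^'n"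
  assumes d: "CARD('n) \<ge> 2"
  defines "s \<equiv> singular_value UNIV 1 g * singular_value UNIV 2 g"
  shows "s \<le> wedge_norm g" "wedge_norm g \<le> 2 * (real CARD('n))\<^sup>2 * s"
    "0 \<le> singular_value UNIV 1 g" "0 \<le> singular_value UNIV 2 g"
proof -
  obtain vs where vs: "sv_basis UNIV g vs" using sv_basis_exists subspace_UNIV by blast
  note D = sv_basisD[OF subspace_UNIV vs]
  have len: "length vs = CARD('n)" using vs by (simp add: sv_basis_def)
  let ?\<sigma> = "\<lambda>i. norm (g *v (vs ! i))"
  have s1: "singular_value UNIV 1 g = ?\<sigma> 0" and s2: "singular_value UNIV 2 g = ?\<sigma> 1"
    using len d by (simp_all add: singular_value_def singular_values_eq[OF subspace_UNIV vs])
  then show "0 \<le> singular_value UNIV 1 g" "0 \<le> singular_value UNIV 2 g" by auto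
  have s: "s = ?\<sigma> 0 * ?\<sigma> 1" unfolding s_def s1 s2 ..
  let ?R = "\<lambda>v w. v \<bullet> w = 0 \<and> (g *v v) \<bullet> (g *v w) = 0 \<and> norm (g *v w) \<le> norm (g *v v)"
  have lt: "?R (vs ! i) (vs ! j)" if "i < j" "j < length vs" for i j
    using sorted_wrt_nth_less[of ?R vs i j] vs that by (simp add: sv_basis_def)
  have n1: "norm (vs ! i) = 1" if "i < length vs" for i
    using vs that by (simp add: sv_basis_def)
  show "s \<le> wedge_norm g"
  proof -
    have "(norm (wedge (g *v (vs ! 0)) (g *v (vs ! 1))))\<^sup>2 = 2 * s\<^sup>2"
      using lt[of 0 1] len d by (simp add: norm_wedge_sq s power_mult_distrib)
    moreover have "(norm (wedge (vs ! 0) (vs ! 1)))\<^sup>2 = 2"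
      using lt[of 0 1] len d n1[of 0] n1[of 1] by (simp add: norm_wedge_sq)
    moreover have "(norm (wedge (g *v (vs ! 0)) (g *v (vs ! 1))))\<^sup>2 \<le>
        (wedge_norm g * norm (wedge (vs ! 0) (vs ! 1)))\<^sup>2"
      using wedge_norm_bound by (intro power_mono) auto
    ultimately have "s\<^sup>2 \<le> (wedge_norm g)\<^sup>2" by (simp add: power_mult_distrib)
    then show ?thesis
      by (rule power2_le_imp_le) (simp add: wedge_norm_def sum_nonneg)
  qed
  have le: "?\<sigma> i * ?\<sigma> j \<le> s" if "i < j" "j < length vs" for i j
  proof -
    have "?\<sigma> i \<le> ?\<sigma> 0" using lt[of 0 i] that by (cases "i = 0") auto
    moreover have "?\<sigma> j \<le> ?\<sigma> 1"
    proof (cases "j = 1")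
      case False
      then have "1 < j" using that by linarith
      from lt[OF this that(2)] show ?thesis by simp
    qed simp
    ultimately show ?thesis unfolding s by (intro mult_mono) auto
  qed
  have le': "norm (g *v b) * norm (g *v c) \<le> s" if b: "b \<in> set vs" and c: "c \<in> set vs" and ne: "b \<noteq> c" for b c
  proof -
    obtain i j where ij: "b = vs ! i" "c = vs ! j" "i < length vs" "j < length vs"
      using b c by (auto simp: in_set_conv_nth)
    then have "i \<noteq> j" using ne by blast
    then have "i < j \<or> j < i" by linarith
    then show ?thesis
    proof
      assume "i < j"
      from le[OF this ij(4)] show ?thesis by (simp add: ij)
    next
      assume "j < i"
      from le[OF this ij(3)] show ?thesis by (simp add: ij mult.commute)
    qed
  qed
  have s0: "0 \<le> s" by (simp add: s)
  \<comment> \<open>Lagrange's identity, first in the images of the basis and then in the basis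
    itself; the diagonal terms vanish by antisymmetry.\<close>
  have wle: "norm (wedge (g *v u) (g *v v)) \<le> s * norm (wedge u v)" for u v
  proof (rule power2_le_imp_le)
    let ?B = "set vs"
    let ?n = "\<lambda>b. norm (g *v b)"
    have sp: "x \<in> span ?B" for x by (simp add: D)
    have img: "(g *v x) \<bullet> (g *v y) = (\<Sum>b\<in>?B. (x \<bullet> b) * (y \<bullet> b) * (?n b)\<^sup>2)" for x y
      using D by (intro orthonormal_inner_image sp) auto
    have idt: "x \<bullet> y = (\<Sum>b\<in>?B. (x \<bullet> b) * (y \<bullet> b))" for x y
      using orthonormal_inner_image[OF D(2), of "\<lambda>x. x" x y] sp D(2) orthonormal_inner[OF D(2)]
      by (simp add: orthonormal_def linear_iff)
    have "(norm (wedge (g *v u) (g *v v)))\<^sup>2 = (\<Sum>b\<in>?B. \<Sum>c\<in>?B.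
        (((u \<bullet> b) * ?n b) * ((v \<bullet> c) * ?n c) - ((u \<bullet> c) * ?n c) * ((v \<bullet> b) * ?n b))\<^sup>2)"
      unfolding norm_wedge_sq
      unfolding Lagrange_identity power2_norm_eq_inner[of "g *v u"] power2_norm_eq_inner[of "g *v v"] img
      by (simp add: power2_eq_square mult_ac)
    also have "\<dots> \<le> (\<Sum>b\<in>?B. \<Sum>c\<in>?B. s\<^sup>2 * ((u \<bullet> b) * (v \<bullet> c) - (u \<bullet> c) * (v \<bullet> b))\<^sup>2)"
    proof (intro sum_mono)
      fix b c assume bc: "b \<in> ?B" "c \<in> ?B"
      show "(((u \<bullet> b) * ?n b) * ((v \<bullet> c) * ?n c) - ((u \<bullet> c) * ?n c) * ((v \<bullet> b) * ?n b))\<^sup>2 \<le>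
          s\<^sup>2 * ((u \<bullet> b) * (v \<bullet> c) - (u \<bullet> c) * (v \<bullet> b))\<^sup>2"
      proof (cases "b = c")
        case False
        have "(((u \<bullet> b) * ?n b) * ((v \<bullet> c) * ?n c) - ((u \<bullet> c) * ?n c) * ((v \<bullet> b) * ?n b))\<^sup>2 =
            (?n b * ?n c)\<^sup>2 * ((u \<bullet> b) * (v \<bullet> c) - (u \<bullet> c) * (v \<bullet> b))\<^sup>2"
          unfolding power_mult_distrib[symmetric] by (simp add: algebra_simps)
        also have "\<dots> \<le> s\<^sup>2 * ((u \<bullet> b) * (v \<bullet> c) - (u \<bullet> c) * (v \<bullet> b))\<^sup>2"
          using le'[OF bc False] by (intro mult_right_mono power_mono) auto
        finally show ?thesis .
      qed (simp add: mult.commute)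
    qed
    also have "\<dots> = s\<^sup>2 * (\<Sum>b\<in>?B. \<Sum>c\<in>?B. ((u \<bullet> b) * (v \<bullet> c) - (u \<bullet> c) * (v \<bullet> b))\<^sup>2)"
      by (simp add: sum_distrib_left)
    also have "\<dots> = s\<^sup>2 * (norm (wedge u v))\<^sup>2"
      unfolding norm_wedge_sq
      unfolding Lagrange_identity power2_norm_eq_inner[of u] power2_norm_eq_inner[of v] 
        idt[of u u] idt[of v v] idt[of u v]
      by (simp add: power2_eq_square)
    finally show "(norm (wedge (g *v u) (g *v v)))\<^sup>2 \<le> (s * norm (wedge u v))\<^sup>2"
      by (simp add: power_mult_distrib)
  qed (use s0 in simp)
  have "wedge_norm g \<le> (\<Sum>i\<in>(UNIV::'n set). \<Sum>j\<in>(UNIV::'n set). s * 2)"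
    unfolding wedge_norm_def
  proof (intro sum_mono)
    fix i j :: 'n
    have "norm (wedge (axis i 1) (axis j 1) :: real^'n^'n) \<le> 2"
      using norm_wedge_le[of "axis i 1 :: real^'n" "axis j 1"] by simp
    then show "norm (wedge (g *v axis i 1) (g *v axis j 1)) \<le> s * 2"
      by (intro order_trans[OF wle] mult_left_mono s0)
  qed
  then show "wedge_norm g \<le> 2 * (real CARD('n))\<^sup>2 * s"
    by (simp add: power2_eq_square mult_ac)
qed

section \<open>Matrices acting on directions\<close>

text \<open>The lower bound stands in for a norm bound of the inverse. The condition is symmetric,
  so inverses lie in the same class.\<close>

definition bilip :: "real \<Rightarrow> (real^'n::finite^'n) set"
  where "bilip \<kappa> = {g. \<forall>v. norm (g *v v) \<le> \<kappa> * norm v \<and> norm v \<le> \<kappa> * norm (g *v v)}"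

lemma bilipD:
  assumes "g \<in> bilip \<kappa>"
  shows "norm (g *v v) \<le> \<kappa> * norm v" "norm v \<le> \<kappa> * norm (g *v v)"
  using assms by (auto simp: bilip_def)

lemma bilip_mat_1: "mat 1 \<in> bilip 1"
  by (simp add: bilip_def)

lemma bilip_mult:
  assumes "g \<in> bilip a" "h \<in> bilip b" "0 \<le> a" "0 \<le> b"
  shows "g ** h \<in> bilip (a * b)"
  unfolding bilip_def
proof safe
  fix v
  have "norm (g *v (h *v v)) \<le> a * norm (h *v v)" by (rule bilipD[OF assms(1)])
  also have "\<dots> \<le> a * (b * norm v)" using assms by (intro mult_left_mono bilipD)
  finally show "norm (g ** h *v v) \<le> a * b * norm v" by (simp add: matrix_vector_mul_assoc mult.assoc)
  have "norm v \<le> b * norm (h *v v)" by (rule bilipD[OF assms(2)])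
  also have "\<dots> \<le> b * (a * norm (g *v (h *v v)))" using assms by (intro mult_left_mono bilipD)
  finally show "norm v \<le> a * b * norm (g ** h *v v)" by (simp add: matrix_vector_mul_assoc mult_ac)
qed

lemma bilip_mono: "g \<in> bilip a \<Longrightarrow> a \<le> b \<Longrightarrow> g \<in> bilip b"
  unfolding bilip_def using mult_right_mono[OF _ norm_ge_zero, of a b] by (blast intro: order_trans)

lemma bilip_nonzero: "g \<in> bilip \<kappa> \<Longrightarrow> v \<noteq> 0 \<Longrightarrow> g *v v \<noteq> 0"
  using bilipD(2)[of g \<kappa> v] by auto

lemma bilip_norm_le: "g \<in> bilip \<kappa> \<Longrightarrow> norm g \<le> real CARD('n) * \<kappa>" for g :: "real^'n::finite^'n"
  by (intro norm_matrix_le_bound bilipD)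

lemma bilip_inverse:
  assumes g: "g \<in> bilip \<kappa>"
  obtains h where "h \<in> bilip \<kappa>" "g ** h = mat 1" "h ** g = mat 1"
proof -
  have "inj ((*v) g)"
    using bilip_nonzero[OF g] by (subst linear_injective_0) auto
  then obtain h where h: "h ** g = mat 1" using matrix_left_invertible_injective by blast
  then have h': "g ** h = mat 1" by (simp add: matrix_left_right_inverse)
  have "h \<in> bilip \<kappa>"
    unfolding bilip_def
  proof safe
    fix v
    have "g *v (h *v v) = v" by (simp add: matrix_vector_mul_assoc h')
    then show "norm (h *v v) \<le> \<kappa> * norm v" "norm v \<le> \<kappa> * norm (h *v v)"
      using bilipD[OF g, of "h *v v"] by simp_all
  qed
  then show thesis using that h h' by blast
qed

lemma bilip_subspace_onto:
  assumes "g \<in> bilip \<kappa>" "subspace V" "(\<lambda>v. g *v v) ` V \<subseteq> V"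
  shows "(\<lambda>v. g *v v) ` V = V"
proof -
  have lin: "linear ((*v) g)" by simp
  have "inj ((*v) g)"
    using bilip_nonzero[OF assms(1)] by (subst linear_injective_0) auto
  then have "dim ((\<lambda>v. g *v v) ` V) = dim V"
    by (intro dim_image_eq lin) (auto intro: inj_on_subset)
  then show ?thesis
    by (intro subspace_dim_equal assms linear_subspace_image lin) auto
qed

text \<open>\<open>sqrt 2\<close> times the sine of the angle between \<open>u\<close> and
  \<open>v\<close>, because \<open>norm (wedge u v)\<close> is \<open>sqrt 2\<close> times an area.
  It is \<open>0\<close> when one of the vectors vanishes.\<close>

definition pdist :: "real^'n::finite \<Rightarrow> real^'n \<Rightarrow> real"
  where "pdist u v = norm (wedge u v) / (norm u * norm v)"

definition ln_stretch :: "real^'n::finite^'n \<Rightarrow> real^'n \<Rightarrow> real"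
  where "ln_stretch g v = ln (norm (g *v v) / norm v)"

lemma pdist_nonneg: "0 \<le> pdist u v"
  by (simp add: pdist_def)

lemma pdist_le_2: "pdist u v \<le> 2"
proof (cases "u = 0 \<or> v = 0")
  case False
  then show ?thesis using norm_wedge_le[of u v] by (simp add: pdist_def pos_divide_le_eq)
qed (auto simp: pdist_def)

lemma pdist_scale: "a > 0 \<Longrightarrow> b > 0 \<Longrightarrow> pdist (a *\<^sub>R u) (b *\<^sub>R v) = pdist u v"
  by (simp add: pdist_def wedge_simps)

lemma ln_stretch_scale: "a > 0 \<Longrightarrow> ln_stretch g (a *\<^sub>R v) = ln_stretch g v"
  by (simp add: ln_stretch_def matrix_vector_mult_scaleR)

lemma unit_decomposition:
  fixes v :: "'a::real_normed_vector"
  assumes "v \<noteq> 0"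
  obtains c w where "c > 0" "norm w = 1" "v = c *\<^sub>R w"
  using assms by (intro that[of "norm v" "v /\<^sub>R norm v"]) auto

lemma ln_stretch_bound:
  assumes "g \<in> bilip \<kappa>" "1 \<le> \<kappa>" "v \<noteq> 0"
  shows "\<bar>ln_stretch g v\<bar> \<le> ln \<kappa>"
proof -
  have pos: "norm (g *v v) > 0" "norm v > 0" using bilip_nonzero assms by auto
  have "norm (g *v v) / norm v \<le> \<kappa>" "1 / \<kappa> \<le> norm (g *v v) / norm v"
    using bilipD[OF assms(1), of v] pos assms(2) by (auto simp: field_simps)
  moreover have "norm (g *v v) / norm v > 0" using pos by simp
  ultimately have "ln_stretch g v \<le> ln \<kappa>" "ln (1 / \<kappa>) \<le> ln_stretch g v"
    unfolding ln_stretch_def using assms(2) by (auto simp: ln_le_cancel_iff)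
  then show ?thesis using assms(2) by (simp add: ln_div abs_le_iff)
qed

lemma ln_stretch_mult:
  assumes "h *v v \<noteq> 0" "g *v (h *v v) \<noteq> 0" "v \<noteq> 0"
  shows "ln_stretch (g ** h) v = ln_stretch g (h *v v) + ln_stretch h v"
  using assms by (simp add: ln_stretch_def ln_div matrix_vector_mul_assoc[symmetric])

lemma abs_ln_diff_le:
  fixes a b m :: real
  assumes "0 < m" "m \<le> a" "m \<le> b"
  shows "\<bar>ln a - ln b\<bar> \<le> \<bar>a - b\<bar> / m"
proof -
  have *: "ln a - ln b \<le> \<bar>a - b\<bar> / m" if "m \<le> a" "m \<le> b" for a b
  proof -
    have "ln a - ln b = ln (a / b)" using that assms by (simp add: ln_div)
    also have "\<dots> \<le> a / b - 1" using that assms by (intro ln_le_minus_one) auto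
    also have "\<dots> = (a - b) / b" using that assms by (simp add: field_simps)
    also have "\<dots> \<le> \<bar>a - b\<bar> / b" using that assms by (intro divide_right_mono) auto
    also have "\<dots> \<le> \<bar>a - b\<bar> / m" using that assms by (intro divide_left_mono) auto
    finally show ?thesis .
  qed
  show ?thesis using *[of a b] *[of b a] assms by (simp add: abs_minus_commute abs_le_iff)
qed

lemma ln_stretch_lipschitz_matrix:
  assumes g: "g \<in> bilip \<kappa>" and h: "h \<in> bilip \<kappa>" and k: "1 \<le> \<kappa>" and v: "v \<noteq> 0"
  shows "\<bar>ln_stretch g v - ln_stretch h v\<bar> \<le> \<kappa> * norm (g - h)"
proof -
  obtain c w where w: "c > 0" "norm w = 1" "v = c *\<^sub>R w" using unit_decomposition[OF v] .
  have "1 / \<kappa> \<le> norm (g *v w)" "1 / \<kappa> \<le> norm (h *v w)"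
    using bilipD(2)[OF g, of w] bilipD(2)[OF h, of w] w k by (auto simp: field_simps)
  then have "\<bar>ln (norm (g *v w)) - ln (norm (h *v w))\<bar> \<le> \<bar>norm (g *v w) - norm (h *v w)\<bar> / (1 / \<kappa>)"
    using k by (intro abs_ln_diff_le) auto
  also have "\<bar>norm (g *v w) - norm (h *v w)\<bar> \<le> norm (g *v w - h *v w)" by (rule norm_triangle_ineq3)
  also have "\<dots> = norm ((g - h) *v w)" by (simp add: matrix_vector_mult_diff_rdistrib)
  also have "\<dots> \<le> norm (g - h)" using norm_matrix_vector_le[of "g - h" w] w by simp
  finally show ?thesis
    using k w(1) unfolding w(3) by (simp add: ln_stretch_scale) (simp add: ln_stretch_def w divide_right_mono mult.commute)
qed

text \<open>Replacing \<open>v\<close> by its negative if necessary, unit vectors form an angle that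
  is not obtuse; then \<open>u \<bullet> v\<close> dominates its square, whence
  \<open>norm (u - v) \<le> norm (wedge u v)\<close>. One factor \<open>\<kappa>\<close> comes from
  the logarithm above \<open>1 / \<kappa>\<close>, the other from \<open>g\<close>.\<close>

lemma ln_stretch_lipschitz:
  assumes g: "g \<in> bilip \<kappa>" and k: "1 \<le> \<kappa>" and u: "u \<noteq> 0" and v: "v \<noteq> 0"
  shows "\<bar>ln_stretch g u - ln_stretch g v\<bar> \<le> \<kappa>\<^sup>2 * pdist u v"
proof -
  have unit: "\<bar>ln_stretch g u - ln_stretch g v\<bar> \<le> \<kappa>\<^sup>2 * pdist u v" if "norm u = 1" "norm v = 1" "0 \<le> u \<bullet> v" for u v
  proof -
    have "1 / \<kappa> \<le> norm (g *v u)" "1 / \<kappa> \<le> norm (g *v v)"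
      using bilipD(2)[OF g, of u] bilipD(2)[OF g, of v] that k by (auto simp: field_simps)
    then have "\<bar>ln_stretch g u - ln_stretch g v\<bar> \<le> \<bar>norm (g *v u) - norm (g *v v)\<bar> / (1 / \<kappa>)"
      unfolding ln_stretch_def using k that by (simp only: div_by_1) (intro abs_ln_diff_le, auto)
    also have "\<dots> = \<kappa> * \<bar>norm (g *v u) - norm (g *v v)\<bar>" by simp
    also have "\<bar>norm (g *v u) - norm (g *v v)\<bar> \<le> norm (g *v u - g *v v)" by (rule norm_triangle_ineq3)
    also have "\<dots> = norm (g *v (u - v))" by (simp add: matrix_vector_mult_diff_distrib)
    also have "\<dots> \<le> \<kappa> * norm (u - v)" by (rule bilipD[OF g])
    also have "norm (u - v) \<le> norm (wedge u v)"
    proof (rule power2_le_imp_le)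
      have "\<bar>u \<bullet> v\<bar> \<le> 1" using Cauchy_Schwarz_ineq2[of u v] that by simp
      then have "(u \<bullet> v)\<^sup>2 \<le> u \<bullet> v" using that(3) by (simp add: power2_eq_square mult_left_le)
      moreover have "(norm (u - v))\<^sup>2 = 2 - 2 * (u \<bullet> v)"
        using that by (simp add: power2_norm_eq_inner inner_diff_left inner_diff_right inner_commute norm_eq_1)
      moreover have "(norm (wedge u v))\<^sup>2 = 2 - 2 * (u \<bullet> v)\<^sup>2" using that by (simp add: norm_wedge_sq)
      ultimately show "(norm (u - v))\<^sup>2 \<le> (norm (wedge u v))\<^sup>2" by simp
    qed simp
    finally show ?thesis
      using k that by (simp add: pdist_def power2_eq_square mult.assoc mult_left_mono)
  qed
  have neg: "ln_stretch g (- v) = ln_stretch g v" "pdist u (- v) = pdist u v" for u v :: "real^'a"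
    by (auto simp: ln_stretch_def pdist_def wedge_simps vector_matrix_mult_def matrix_vector_mult_def vec_eq_iff sum_negf
        norm_vec_def L2_set_def wedge_nth power2_commute)
  have unit': "\<bar>ln_stretch g u - ln_stretch g v\<bar> \<le> \<kappa>\<^sup>2 * pdist u v" if "norm u = 1" "norm v = 1" for u v
    using unit[of u v] unit[of u "- v"] that by (cases "0 \<le> u \<bullet> v") (auto simp: neg)
  obtain a x where x: "a > 0" "norm x = 1" "u = a *\<^sub>R x" using unit_decomposition[OF u] .
  obtain b y where y: "b > 0" "norm y = 1" "v = b *\<^sub>R y" using unit_decomposition[OF v] .
  show ?thesis using unit'[of x y] x y by (simp add: ln_stretch_scale pdist_scale)
qed

lemma pdist_matrix_le:
  fixes g :: "real^'n::finite^'n"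
  assumes g: "g \<in> bilip \<kappa>" and k: "1 \<le> \<kappa>" and u: "u \<noteq> 0" and v: "v \<noteq> 0"
  shows "pdist (g *v u) (g *v v) \<le> (real CARD('n))\<^sup>2 * \<kappa> ^ 4 * pdist u v"
proof -
  have unit: "pdist (g *v u) (g *v v) \<le> (real CARD('n))\<^sup>2 * \<kappa> ^ 4 * pdist u v" if "norm u = 1" "norm v = 1" for u v
  proof -
    have nz: "u \<noteq> 0" "v \<noteq> 0" using that by auto
    have pos: "norm (g *v u) > 0" "norm (g *v v) > 0"
      using bilip_nonzero[OF g nz(1)] bilip_nonzero[OF g nz(2)] by auto
    have "1 / \<kappa> \<le> norm (g *v u)" "1 / \<kappa> \<le> norm (g *v v)"
      using bilipD(2)[OF g, of u] bilipD(2)[OF g, of v] that k by (auto simp: field_simps)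
    then have "1 / \<kappa> * (1 / \<kappa>) \<le> norm (g *v u) * norm (g *v v)"
      using k by (intro mult_mono) auto
    then have "norm (wedge (g *v u) (g *v v)) / (norm (g *v u) * norm (g *v v)) \<le>
        norm (wedge (g *v u) (g *v v)) / (1 / \<kappa> * (1 / \<kappa>))"
      using pos k by (intro divide_left_mono) auto
    also have "\<dots> = \<kappa>\<^sup>2 * norm (wedge (g *v u) (g *v v))" by (simp add: power2_eq_square)
    also have "\<dots> \<le> \<kappa>\<^sup>2 * ((norm g)\<^sup>2 * norm (wedge u v))"
      by (intro mult_left_mono norm_wedge_matrix_le) auto
    also have "\<dots> \<le> \<kappa>\<^sup>2 * ((real CARD('n) * \<kappa>)\<^sup>2 * norm (wedge u v))"
      by (intro mult_left_mono mult_right_mono power_mono bilip_norm_le g) auto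
    also have "\<dots> = (real CARD('n))\<^sup>2 * \<kappa> ^ 4 * pdist u v"
      using that by (simp add: pdist_def power_mult_distrib power4_eq_xxxx power2_eq_square mult_ac)
    finally show ?thesis by (simp add: pdist_def)
  qed
  obtain a x where x: "a > 0" "norm x = 1" "u = a *\<^sub>R x" using unit_decomposition[OF u] .
  obtain b y where y: "b > 0" "norm y = 1" "v = b *\<^sub>R y" using unit_decomposition[OF v] .
  show ?thesis using unit[of x y] x y by (simp add: matrix_vector_mult_scaleR pdist_scale)
qed

lemma pdist_image_le:
  assumes g: "g \<in> bilip \<kappa>" and h: "h \<in> bilip \<kappa>" and k: "1 \<le> \<kappa>" and v: "v \<noteq> 0"
  shows "pdist (g *v v) (h *v v) \<le> 2 * \<kappa> * norm (g - h)"
proof -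
  obtain c w where w: "c > 0" "norm w = 1" "v = c *\<^sub>R w" using unit_decomposition[OF v] .
  have nz: "w \<noteq> 0" using w by auto
  have pos: "norm (g *v w) > 0" "norm (h *v w) > 0"
    using bilip_nonzero[OF g nz] bilip_nonzero[OF h nz] by auto
  have "wedge (g *v w) (h *v w) = wedge ((g - h) *v w) (h *v w)"
    by (simp add: matrix_vector_mult_diff_rdistrib wedge_simps)
  then have "norm (wedge (g *v w) (h *v w)) \<le> 2 * norm ((g - h) *v w) * norm (h *v w)"
    by (simp add: norm_wedge_le)
  also have "\<dots> \<le> 2 * norm (g - h) * norm (h *v w)"
    using norm_matrix_vector_le[of "g - h" w] w by (intro mult_left_mono mult_right_mono) auto
  finally have "pdist (g *v w) (h *v w) \<le> 2 * norm (g - h) * norm (h *v w) / (norm (g *v w) * norm (h *v w))"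
    unfolding pdist_def by (intro divide_right_mono) auto
  also have "\<dots> = 2 * norm (g - h) * (1 / norm (g *v w))" using pos by simp
  also have "1 / norm (g *v w) \<le> \<kappa>"
    using bilipD(2)[OF g, of w] w pos by (simp add: field_simps)
  finally have "pdist (g *v w) (h *v w) \<le> 2 * norm (g - h) * \<kappa>"
    by (simp add: mult_left_mono)
  then show ?thesis using w by (simp add: matrix_vector_mult_scaleR pdist_scale mult_ac)
qed

text \<open>The algebra behind \<open>pdist_lipschitz_matrix\<close>: \<open>A\<close>,
  \<open>B\<close>, \<open>A'\<close>, \<open>B'\<close> are the lengths of the images of two unit
  vectors, \<open>W\<close> and \<open>W'\<close> the norms of the image bivectors. There
  \<open>P\<close> and \<open>Q\<close> are both multiples of
  \<open>norm (wedge u v)\<close>.\<close>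

lemma quotient_diff_bound:
  fixes A B A' B' W W' :: real
  assumes k: "1 \<le> \<kappa>"
    and lo: "1 / \<kappa> \<le> A" "1 / \<kappa> \<le> B" "1 / \<kappa> \<le> A'" "1 / \<kappa> \<le> B'"
    and up: "A \<le> \<kappa>" "B' \<le> \<kappa>"
    and d: "\<bar>A - A'\<bar> \<le> \<eta>" "\<bar>B - B'\<bar> \<le> \<eta>" "\<bar>W - W'\<bar> \<le> \<eta> * P" "0 \<le> W'" "W' \<le> Q"
  shows "\<bar>W / (A * B) - W' / (A' * B')\<bar> \<le> \<eta> * (\<kappa>\<^sup>2 * P + 2 * \<kappa> ^ 5 * Q)"
proof -
  have kp: "0 < 1 / \<kappa>" using k by simp
  have pos: "0 < A" "0 < B" "0 < A'" "0 < B'" using lo kp by linarith+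
  have \<eta>: "0 \<le> \<eta>" using d(1) by linarith
  have P: "0 \<le> \<eta> * P" using d(3) by linarith
  have "1 / A \<le> \<kappa>" "1 / B \<le> \<kappa>" "1 / A' \<le> \<kappa>" "1 / B' \<le> \<kappa>"
    using lo pos k by (auto simp: field_simps)
  then have inv: "1 / (A * B) \<le> \<kappa>\<^sup>2" "1 / (A' * B') \<le> \<kappa>\<^sup>2"
    using pos k mult_mono[of "1 / A" \<kappa> "1 / B" \<kappa>] mult_mono[of "1 / A'" \<kappa> "1 / B'" \<kappa>]
    by (auto simp: power2_eq_square)
  have AB: "\<bar>A' * B' - A * B\<bar> \<le> 2 * \<kappa> * \<eta>"
  proof -
    have "A' * B' - A * B = (A' - A) * B' + A * (B' - B)" by (simp add: algebra_simps)
    then have "\<bar>A' * B' - A * B\<bar> \<le> \<bar>A' - A\<bar> * B' + A * \<bar>B' - B\<bar>"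
      using pos abs_triangle_ineq[of "(A' - A) * B'" "A * (B' - B)"] by (simp add: abs_mult)
    also have "\<dots> \<le> \<eta> * \<kappa> + \<kappa> * \<eta>"
      using d pos up \<eta> k by (intro add_mono mult_mono) (auto simp: abs_minus_commute)
    finally show ?thesis by (simp add: mult_ac)
  qed
  have e: "W / (A * B) - W' / (A' * B') =
      (W - W') * (1 / (A * B)) + W' * ((A' * B' - A * B) * (1 / (A * B)) * (1 / (A' * B')))"
    using pos by (simp add: field_simps)
  have "\<bar>(W - W') * (1 / (A * B))\<bar> \<le> \<eta> * P * \<kappa>\<^sup>2"
    unfolding abs_mult using d inv pos P by (intro mult_mono) auto
  moreover have "\<bar>W' * ((A' * B' - A * B) * (1 / (A * B)) * (1 / (A' * B')))\<bar> \<le> Q * (2 * \<kappa> * \<eta> * \<kappa>\<^sup>2 * \<kappa>\<^sup>2)"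
    unfolding abs_mult using d inv pos AB k \<eta> by (intro mult_mono mult_nonneg_nonneg) auto
  ultimately have "\<bar>W / (A * B) - W' / (A' * B')\<bar> \<le> \<eta> * P * \<kappa>\<^sup>2 + Q * (2 * \<kappa> * \<eta> * \<kappa>\<^sup>2 * \<kappa>\<^sup>2)"
    unfolding e by linarith
  also have "\<dots> = \<eta> * (\<kappa>\<^sup>2 * P + 2 * \<kappa> ^ 5 * Q)"
    by (simp add: algebra_simps power2_eq_square eval_nat_numeral)
  finally show ?thesis .
qed

text \<open>The bound vanishes with \<open>pdist u v\<close>; a bound by \<open>norm (g - h)\<close>
  alone could not preserve a contraction for nearly parallel vectors.\<close>

lemma pdist_lipschitz_matrix:
  fixes g :: "real^'n::finite^'n"
  assumes k: "1 \<le> \<kappa>"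
  obtains C where "0 < C"
    "\<And>g h u v. g \<in> bilip \<kappa> \<Longrightarrow> h \<in> bilip \<kappa> \<Longrightarrow> u \<noteq> 0 \<Longrightarrow> v \<noteq> 0 \<Longrightarrow>
      \<bar>pdist (g *v u) (g *v v) - pdist (h *v u) (h *v v :: real^'n)\<bar> \<le> C * norm (g - h) * pdist u v"
proof -
  define p where "p = 2 * (real CARD('n) * \<kappa>)"
  define q where "q = (real CARD('n) * \<kappa>)\<^sup>2"
  define C where "C = \<kappa>\<^sup>2 * p + 2 * \<kappa> ^ 5 * q"
  have unit: "\<bar>pdist (g *v u) (g *v v) - pdist (h *v u) (h *v v)\<bar> \<le> C * norm (g - h) * pdist u v"
    if g: "g \<in> bilip \<kappa>" and h: "h \<in> bilip \<kappa>" and n: "norm u = 1" "norm v = 1" for g h :: "real^'n^'n" and u v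
  proof -
    have lo: "1 / \<kappa> \<le> norm (f *v w)" "norm (f *v w) \<le> \<kappa>" if "norm w = 1" "f \<in> bilip \<kappa>" for f w
      using bilipD[OF that(2), of w] that k by (auto simp: field_simps)
    have df: "\<bar>norm (g *v w) - norm (h *v w)\<bar> \<le> norm (g - h)" if "norm w = 1" for w
    proof -
      have "\<bar>norm (g *v w) - norm (h *v w)\<bar> \<le> norm (g *v w - h *v w)" by (rule norm_triangle_ineq3)
      also have "\<dots> = norm ((g - h) *v w)" by (simp add: matrix_vector_mult_diff_rdistrib)
      also have "\<dots> \<le> norm (g - h)" using norm_matrix_vector_le[of "g - h" w] that by simp
      finally show ?thesis .
    qed
    have "\<bar>pdist (g *v u) (g *v v) - pdist (h *v u) (h *v v)\<bar> \<le>
        norm (g - h) * (\<kappa>\<^sup>2 * (p * norm (wedge u v)) + 2 * \<kappa> ^ 5 * (q * norm (wedge u v)))"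
      unfolding pdist_def
    proof (intro quotient_diff_bound k lo n g h df)
      have "\<bar>norm (wedge (g *v u) (g *v v)) - norm (wedge (h *v u) (h *v v))\<bar> \<le>
          norm (wedge (g *v u) (g *v v) - wedge (h *v u) (h *v v))" by (rule norm_triangle_ineq3)
      also have "\<dots> \<le> norm (g - h) * (norm g + norm h) * norm (wedge u v)" by (rule wedge_matrix_diff_le)
      also have "\<dots> \<le> norm (g - h) * p * norm (wedge u v)"
        using bilip_norm_le[OF g] bilip_norm_le[OF h] unfolding p_def
        by (intro mult_right_mono mult_left_mono) auto
      finally show "\<bar>norm (wedge (g *v u) (g *v v)) - norm (wedge (h *v u) (h *v v))\<bar> \<le>
          norm (g - h) * (p * norm (wedge u v))" by (simp add: mult_ac)
      have "norm (wedge (h *v u) (h *v v)) \<le> (norm h)\<^sup>2 * norm (wedge u v)" by (rule norm_wedge_matrix_le)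
      also have "\<dots> \<le> q * norm (wedge u v)"
        unfolding q_def by (intro mult_right_mono power_mono bilip_norm_le h) auto
      finally show "norm (wedge (h *v u) (h *v v)) \<le> q * norm (wedge u v)" .
    qed auto
    also have "\<dots> = C * norm (g - h) * pdist u v" using n by (simp add: C_def pdist_def algebra_simps)
    finally show ?thesis .
  qed
  show thesis
  proof (rule that[of C])
    show "0 < C" unfolding C_def p_def q_def using k by (intro add_pos_pos) auto
    fix g h :: "real^'n^'n" and u v :: "real^'n"
    assume g: "g \<in> bilip \<kappa>" and h: "h \<in> bilip \<kappa>" and u: "u \<noteq> 0" and v: "v \<noteq> 0"
    obtain a x where x: "a > 0" "norm x = 1" "u = a *\<^sub>R x" using unit_decomposition[OF u] .
    obtain b y where y: "b > 0" "norm y = 1" "v = b *\<^sub>R y" using unit_decomposition[OF v] .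
    show "\<bar>pdist (g *v u) (g *v v) - pdist (h *v u) (h *v v)\<bar> \<le> C * norm (g - h) * pdist u v"
      using unit[OF g h, of x y] x y by (simp add: matrix_vector_mult_scaleR pdist_scale)
  qed
qed

section \<open>Powers of distances\<close>

lemma powr_add_le:
  fixes x y \<alpha> :: real
  assumes "0 \<le> x" "0 \<le> y" "0 < \<alpha>" "\<alpha> \<le> 1"
  shows "(x + y) powr \<alpha> \<le> x powr \<alpha> + y powr \<alpha>"
proof (cases "x + y = 0")
  case False
  then have pos: "x + y > 0" using assms by linarith
  have le: "t \<le> t powr \<alpha>" if "0 \<le> t" "t \<le> 1" for t :: real
    using powr_mono'[of \<alpha> 1 t] that assms by (cases "t = 0") auto
  have "x powr \<alpha> + y powr \<alpha> = (x + y) powr \<alpha> * ((x / (x + y)) powr \<alpha> + (y / (x + y)) powr \<alpha>)"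
    using assms pos by (simp add: powr_divide distrib_left)
  moreover have "1 \<le> (x / (x + y)) powr \<alpha> + (y / (x + y)) powr \<alpha>"
  proof -
    have "x / (x + y) + y / (x + y) = 1" using pos by (simp add: add_divide_distrib[symmetric])
    moreover have "x / (x + y) \<le> (x / (x + y)) powr \<alpha>" "y / (x + y) \<le> (y / (x + y)) powr \<alpha>"
      using assms pos by (auto intro!: le)
    ultimately show ?thesis by linarith
  qed
  ultimately show ?thesis using mult_left_mono[of 1 _ "(x + y) powr \<alpha>"] by fastforce
qed (use assms in auto)

lemma powr_diff_le:
  fixes x y \<alpha> :: real
  assumes "0 \<le> x" "0 \<le> y" "0 < \<alpha>" "\<alpha> \<le> 1"
  shows "\<bar>x powr \<alpha> - y powr \<alpha>\<bar> \<le> \<bar>x - y\<bar> powr \<alpha>"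
proof -
  have *: "x powr \<alpha> - y powr \<alpha> \<le> \<bar>x - y\<bar> powr \<alpha>" if "0 \<le> x" "0 \<le> y" for x y :: real
  proof -
    have "x powr \<alpha> \<le> (y + \<bar>x - y\<bar>) powr \<alpha>" using that assms by (intro powr_mono2) auto
    also have "\<dots> \<le> y powr \<alpha> + \<bar>x - y\<bar> powr \<alpha>" using that assms by (intro powr_add_le) auto
    finally show ?thesis by simp
  qed
  show ?thesis using *[of x y] *[of y x] assms by (simp add: abs_minus_commute abs_le_iff)
qed

text \<open>An affine majorant of the concave power, used in place of Jensen's inequality:
  integrating it needs only the mean of \<open>t\<close>. If the mean is at most \<open>e\<close>,
  both terms are of order \<open>e powr \<alpha>\<close>.\<close>

lemma powr_le_linear:
  fixes t \<alpha> e :: real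
  assumes "0 \<le> t" "0 < e" "0 < \<alpha>" "\<alpha> \<le> 1"
  shows "t powr \<alpha> \<le> e powr \<alpha> + e powr (\<alpha> - 1) * t"
proof (cases "t \<le> e")
  case True
  then have "t powr \<alpha> \<le> e powr \<alpha>" using assms by (intro powr_mono2) auto
  moreover have "0 \<le> e powr (\<alpha> - 1) * t" using assms by auto
  ultimately show ?thesis by linarith
next
  case False
  then have t: "t > 0" using assms by linarith
  have "t powr \<alpha> = t powr (\<alpha> - 1) * t" using t by (simp add: powr_diff)
  also have "\<dots> \<le> e powr (\<alpha> - 1) * t"
    using False assms t by (intro mult_right_mono powr_mono2') auto
  finally show ?thesis by (smt (verit) powr_ge_zero)
qed

text \<open>This is where the gap of the exponents enters. For an \<open>n\<close>-step product the
  exponent grows in mean like \<open>n (L1 + L2)\<close> minus twice the growth of a vector, i.e.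
  like \<open>n (L2 - L1)\<close> when vectors grow at rate \<open>L1\<close>.\<close>

lemma pdist_wedge_norm_bound:
  fixes g :: "real^'n::finite^'n"
  assumes g: "g \<in> bilip \<kappa>" and u: "u \<noteq> 0" and v: "v \<noteq> 0" and pos: "wedge_norm g > 0"
  shows "pdist (g *v u) (g *v v) \<le> exp (ln (wedge_norm g) - ln_stretch g u - ln_stretch g v) * pdist u v"
proof -
  have n: "norm (g *v u) > 0" "norm (g *v v) > 0" "norm u > 0" "norm v > 0"
    using bilip_nonzero[OF g u] bilip_nonzero[OF g v] u v by auto
  have "pdist (g *v u) (g *v v) \<le> wedge_norm g * norm (wedge u v) / (norm (g *v u) * norm (g *v v))"
    unfolding pdist_def by (intro divide_right_mono wedge_norm_bound) auto
  also have "\<dots> = wedge_norm g / (norm (g *v u) / norm u) / (norm (g *v v) / norm v) * pdist u v"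
    using n by (simp add: pdist_def)
  also have "\<dots> = exp (ln (wedge_norm g) - ln_stretch g u - ln_stretch g v) * pdist u v"
    using n pos by (simp add: exp_diff ln_stretch_def)
  finally show ?thesis .
qed

lemma bilip_wedge_lower:
  fixes g :: "real^'n::finite^'n"
  assumes g: "g \<in> bilip \<kappa>"
  shows "norm (wedge u v) \<le> (real CARD('n) * \<kappa>)\<^sup>2 * norm (wedge (g *v u) (g *v v))"
proof -
  obtain h where h: "h \<in> bilip \<kappa>" "h ** g = mat 1" using bilip_inverse[OF g] by blast
  then have e: "h *v (g *v w) = w" for w by (simp add: matrix_vector_mul_assoc)
  have "norm (wedge (h *v (g *v u)) (h *v (g *v v))) \<le> (norm h)\<^sup>2 * norm (wedge (g *v u) (g *v v))"
    by (rule norm_wedge_matrix_le)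
  also have "\<dots> \<le> (real CARD('n) * \<kappa>)\<^sup>2 * norm (wedge (g *v u) (g *v v))"
    by (intro mult_right_mono power_mono bilip_norm_le h) auto
  finally show ?thesis by (simp add: e)
qed

lemma wedge_norm_mult: "wedge_norm (g ** h) \<le> wedge_norm g * wedge_norm h"
proof -
  have "wedge_norm (g ** h) \<le> (\<Sum>i\<in>UNIV. \<Sum>j\<in>UNIV. wedge_norm g * norm (wedge (h *v axis i 1) (h *v axis j 1)))"
    unfolding wedge_norm_def[of "g ** h"] matrix_vector_mul_assoc[symmetric]
    by (intro sum_mono wedge_norm_bound)
  then show ?thesis by (simp add: wedge_norm_def[of h] sum_distrib_left)
qed

lemma wedge_norm_lower:
  fixes g :: "real^'n::finite^'n"
  assumes d: "CARD('n) \<ge> 2" and g: "g \<in> bilip \<kappa>" and k: "1 \<le> \<kappa>"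
  shows "1 / (real CARD('n) * \<kappa>)\<^sup>2 \<le> wedge_norm g"
proof -
  obtain i j :: 'n where ij: "i \<noteq> j"
    using d by (metis card_2_iff' ex_card UNIV_I)
  let ?w = "wedge (axis i 1 :: real^'n) (axis j 1)"
  have "(norm ?w)\<^sup>2 = 2" using ij by (simp add: norm_wedge_sq inner_axis_axis)
  then have "1 \<le> norm ?w" by (smt (verit) norm_ge_zero power_le_one)
  also have "\<dots> \<le> (real CARD('n) * \<kappa>)\<^sup>2 * norm (wedge (g *v axis i 1) (g *v axis j 1))"
    by (rule bilip_wedge_lower[OF g])
  also have "norm (wedge (g *v axis i 1) (g *v axis j 1)) \<le> wedge_norm g"
  proof -
    have "norm (wedge (g *v axis i 1) (g *v axis j 1)) \<le> (\<Sum>j\<in>UNIV. norm (wedge (g *v axis i 1) (g *v axis j 1)))"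
      by (rule member_le_sum) auto
    also have "\<dots> \<le> wedge_norm g"
      unfolding wedge_norm_def
      by (rule member_le_sum[of i UNIV "\<lambda>i. \<Sum>j\<in>UNIV. norm (wedge (g *v axis i 1) (g *v axis j 1))"])
        (auto intro: sum_nonneg)
    finally show ?thesis .
  qed
  finally have "1 \<le> (real CARD('n) * \<kappa>)\<^sup>2 * wedge_norm g" by (simp add: mult_left_mono)
  then show ?thesis using k d by (simp add: divide_le_eq mult.commute)
qed

lemma wedge_norm_upper:
  fixes g :: "real^'n::finite^'n"
  assumes g: "g \<in> bilip \<kappa>"
  shows "wedge_norm g \<le> 2 * (real CARD('n))\<^sup>2 * (real CARD('n) * \<kappa>)\<^sup>2"
proof -
  have "wedge_norm g \<le> (\<Sum>i\<in>(UNIV::'n set). \<Sum>j\<in>(UNIV::'n set). (real CARD('n) * \<kappa>)\<^sup>2 * 2)"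
    unfolding wedge_norm_def
  proof (intro sum_mono)
    fix i j :: 'n
    have "norm (wedge (g *v axis i 1) (g *v axis j 1)) \<le> (norm g)\<^sup>2 * norm (wedge (axis i 1 :: real^'n) (axis j 1))"
      by (rule norm_wedge_matrix_le)
    also have "\<dots> \<le> (real CARD('n) * \<kappa>)\<^sup>2 * 2"
      using norm_wedge_le[of "axis i 1 :: real^'n" "axis j 1"]
      by (intro mult_mono power_mono bilip_norm_le g) auto
    finally show "norm (wedge (g *v axis i 1) (g *v axis j 1)) \<le> (real CARD('n) * \<kappa>)\<^sup>2 * 2" .
  qed
  then show ?thesis by (simp add: power2_eq_square mult_ac)
qed

text \<open>Write \<open>g\<close> as \<open>g ** h\<close> times the inverse of \<open>h\<close>.
  This supplies the hypothesis \<open>X_tail\<close> of Kingman's theorem.\<close>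

lemma wedge_norm_tail:
  fixes g h :: "real^'n::finite^'n"
  assumes h: "h \<in> bilip \<kappa>"
  shows "wedge_norm g \<le> 2 * (real CARD('n))\<^sup>2 * (real CARD('n) * \<kappa>)\<^sup>2 * wedge_norm (g ** h)"
proof -
  obtain h' where h': "h' \<in> bilip \<kappa>" "h ** h' = mat 1" using bilip_inverse[OF h] by blast
  then have e: "g = (g ** h) ** h'" by (simp add: matrix_mul_assoc[symmetric])
  have "wedge_norm ((g ** h) ** h') \<le> wedge_norm (g ** h) * wedge_norm h'" by (rule wedge_norm_mult)
  also have "\<dots> \<le> wedge_norm (g ** h) * (2 * (real CARD('n))\<^sup>2 * (real CARD('n) * \<kappa>)\<^sup>2)"
    by (intro mult_left_mono wedge_norm_upper h') (simp add: wedge_norm_def sum_nonneg)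
  finally show ?thesis using e by (simp add: mult.commute)
qed

text \<open>Comparable with the operator norm on the span of \<open>B\<close>, but evidently measurable.\<close>

definition frame_norm :: "(real^'n::finite) set \<Rightarrow> real^'n^'n \<Rightarrow> real"
  where "frame_norm B g = (\<Sum>b\<in>B. norm (g *v b))"

lemma frame_norm_bound:
  assumes B: "orthonormal B" and x: "x \<in> span B"
  shows "norm (g *v x) \<le> frame_norm B g * norm x"
proof -
  have "g *v x = (\<Sum>b\<in>B. (x \<bullet> b) *\<^sub>R (g *v b))"
    by (subst orthonormal_expansion[OF B x, symmetric])
      (simp add: linear_sum[of "(*v) g"] matrix_vector_mult_scaleR)
  then have "norm (g *v x) \<le> (\<Sum>b\<in>B. \<bar>x \<bullet> b\<bar> * norm (g *v b))"
    using norm_sum[of "\<lambda>b. (x \<bullet> b) *\<^sub>R (g *v b)" B] by simp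
  also have "\<dots> \<le> (\<Sum>b\<in>B. norm x * norm (g *v b))"
  proof (intro sum_mono mult_right_mono)
    fix b assume "b \<in> B"
    then show "\<bar>x \<bullet> b\<bar> \<le> norm x"
      using Cauchy_Schwarz_ineq2[of x b] B by (simp add: orthonormal_def)
  qed auto
  finally show ?thesis by (simp add: frame_norm_def sum_distrib_left mult.commute)
qed

lemma frame_norm_mult:
  assumes B: "orthonormal B" and h: "(\<lambda>v. h *v v) ` span B \<subseteq> span B"
  shows "frame_norm B (g ** h) \<le> frame_norm B g * frame_norm B h"
proof -
  have "frame_norm B (g ** h) \<le> (\<Sum>b\<in>B. frame_norm B g * norm (h *v b))"
    unfolding frame_norm_def[of B "g ** h"] matrix_vector_mul_assoc[symmetric]
    using h by (intro sum_mono frame_norm_bound[OF B]) (auto simp: span_base)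
  then show ?thesis by (simp add: frame_norm_def[of B h] sum_distrib_left)
qed

lemma frame_norm_lower:
  assumes B: "orthonormal B" "B \<noteq> {}" and g: "g \<in> bilip \<kappa>" and k: "1 \<le> \<kappa>"
  shows "1 / \<kappa> \<le> frame_norm B g"
proof -
  obtain b where b: "b \<in> B" using B(2) by blast
  have "1 / \<kappa> \<le> norm (g *v b)"
    using bilipD(2)[OF g, of b] B b k by (simp add: orthonormal_def field_simps)
  also have "\<dots> \<le> frame_norm B g"
    unfolding frame_norm_def using orthonormal_finite[OF B(1)] b by (intro member_le_sum) auto
  finally show ?thesis .
qed

lemma frame_norm_upper:
  assumes B: "orthonormal B" and g: "g \<in> bilip \<kappa>"
  shows "frame_norm B g \<le> real (card B) * \<kappa>"
proof -
  have "frame_norm B g \<le> (\<Sum>b\<in>B. \<kappa>)"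
    unfolding frame_norm_def using bilipD(1)[OF g] B by (intro sum_mono) (metis mult.right_neutral orthonormal_def)
  then show ?thesis by simp
qed

text \<open>A basis vector \<open>b\<close> is itself an image \<open>h *v w\<close> with
  \<open>w\<close> in the span and \<open>norm w \<le> \<kappa>\<close>, as an injective matrix
  preserving a subspace maps it onto itself.\<close>

lemma frame_norm_tail:
  assumes B: "orthonormal B" and h: "(\<lambda>v. h *v v) ` span B \<subseteq> span B" "h \<in> bilip \<kappa>"
  shows "frame_norm B g \<le> real (card B) * \<kappa> * frame_norm B (g ** h)"
proof -
  have onto: "(\<lambda>v. h *v v) ` span B = span B"
    by (rule bilip_subspace_onto[OF h(2) _ h(1)]) simp
  have "norm (g *v b) \<le> \<kappa> * frame_norm B (g ** h)" if b: "b \<in> B" for b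
  proof -
    obtain w where w: "w \<in> span B" "b = h *v w" using onto span_base[OF b] by blast
    have "norm (g *v b) = norm ((g ** h) *v w)" by (simp add: w matrix_vector_mul_assoc)
    also have "\<dots> \<le> frame_norm B (g ** h) * norm w" by (rule frame_norm_bound[OF B w(1)])
    also have "\<dots> \<le> frame_norm B (g ** h) * \<kappa>"
      using bilipD(2)[OF h(2), of w] w B b
      by (intro mult_left_mono) (auto simp: orthonormal_def frame_norm_def sum_nonneg)
    finally show ?thesis by (simp add: mult.commute)
  qed
  then have "frame_norm B g \<le> (\<Sum>b\<in>B. \<kappa> * frame_norm B (g ** h))"
    unfolding frame_norm_def[of B g] by (intro sum_mono)
  then show ?thesis by simp
qed

section \<open>Random walks on matrices\<close>

lemma continuous_on_matrix_mult [continuous_intros]: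
  fixes f :: "'a::topological_space \<Rightarrow> real^'n::finite^'m::finite" and g :: "'a \<Rightarrow> real^'k::finite^'n"
  assumes "continuous_on S f" "continuous_on S g"
  shows "continuous_on S (\<lambda>x. f x ** g x)"
  unfolding matrix_matrix_mult_def by (intro continuous_intros assms)

lemma continuous_on_matrix_vector_mult [continuous_intros]:
  fixes f :: "'a::topological_space \<Rightarrow> real^'n::finite^'m::finite"
  assumes "continuous_on S f" "continuous_on S g"
  shows "continuous_on S (\<lambda>x. f x *v g x)"
  unfolding matrix_vector_mult_def by (intro continuous_intros assms)

lemma borel_measurable_matrix_mult [measurable (raw)]:
  fixes f :: "'a \<Rightarrow> real^'n::finite^'n" and g :: "'a \<Rightarrow> real^'n^'n"
  assumes "f \<in> borel_measurable N" "g \<in> borel_measurable N"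
  shows "(\<lambda>x. f x ** g x) \<in> borel_measurable N"
  by (intro borel_measurable_continuous_Pair[OF assms] continuous_intros)

lemma borel_measurable_matrix_vector_mult [measurable (raw)]:
  fixes f :: "'a \<Rightarrow> real^'n::finite^'n"
  assumes "f \<in> borel_measurable N" "g \<in> borel_measurable N"
  shows "(\<lambda>x. f x *v g x) \<in> borel_measurable N"
  by (intro borel_measurable_continuous_Pair[OF assms] continuous_intros)

lemma borel_measurable_wedge [measurable (raw)]:
  fixes f g :: "'a \<Rightarrow> real^'n::finite"
  assumes "f \<in> borel_measurable N" "g \<in> borel_measurable N"
  shows "(\<lambda>x. wedge (f x) (g x)) \<in> borel_measurable N"
  unfolding wedge_def
  by (intro borel_measurable_continuous_Pair[OF assms] continuous_intros)

lemma borel_measurable_pdist [measurable (raw)]: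
  fixes f g :: "'a \<Rightarrow> real^'n::finite"
  assumes "f \<in> borel_measurable N" "g \<in> borel_measurable N"
  shows "(\<lambda>x. pdist (f x) (g x)) \<in> borel_measurable N"
  using assms unfolding pdist_def by measurable

lemma borel_measurable_ln_stretch [measurable (raw)]:
  fixes f :: "'a \<Rightarrow> real^'n::finite^'n"
  assumes "f \<in> borel_measurable N" "g \<in> borel_measurable N"
  shows "(\<lambda>x. ln_stretch (f x) (g x)) \<in> borel_measurable N"
  using assms unfolding ln_stretch_def by measurable

lemma borel_measurable_frame_norm [measurable]: "frame_norm B \<in> borel_measurable borel"
  unfolding frame_norm_def by measurable

lemma borel_measurable_wedge_norm [measurable]: "wedge_norm \<in> borel_measurable borel"
  unfolding wedge_norm_def by measurable

primrec mprod :: "nat \<Rightarrow> (nat \<Rightarrow> real^'n::finite^'n) \<Rightarrow> real^'n^'n" where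
  "mprod 0 x = mat 1"
| "mprod (Suc n) x = x n ** mprod n x"

lemma mprod_cong: "(\<And>i. i < n \<Longrightarrow> x i = y i) \<Longrightarrow> mprod n x = mprod n y"
  by (induction n) auto

lemma mprod_add: "mprod (m + n) x = mprod m (sshift n x) ** mprod n x"
  by (induction m) (simp_all add: sshift_def matrix_mul_assoc)

lemma mprod_comb_seq: "mprod (m + n) (comb_seq n x y) = mprod m y ** mprod n x"
  by (simp add: mprod_add sshift_comb_seq mprod_cong[of n "comb_seq n x y" x] comb_seq_less)

lemma mprod_case_nat: "mprod (Suc n) (case_nat g y) = mprod n y ** g"
  by (induction n) (simp_all add: matrix_mul_assoc)

text \<open>All of \<open>space M\<close> lies in \<open>bilip \<kappa>\<close>, so bounds for
  products hold at every point of the sequence space and no null sets have to be carried along. Laws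
  on \<open>SL\<close> reach this form by restriction to their supports.\<close>

locale walk = prob_space M for M :: "(real^'n::finite^'n) measure" +
  fixes \<kappa> :: real
  assumes sets_M: "sets M = sets (restrict_space borel (space M))"
    and space_bilip: "space M \<subseteq> bilip \<kappa>"
    and \<kappa>_ge_1: "1 \<le> \<kappa>"
begin

sublocale sequence_space M
  by unfold_locales

lemma measurable_M_borel [measurable]: "(\<lambda>g. g) \<in> borel_measurable M"
  using measurable_restrict_space1[OF measurable_ident, of borel "space M"]
  by (simp add: id_def cong: measurable_cong_sets[OF sets_M refl])

lemma measurable_coordinate [measurable]: "(\<lambda>x. x n) \<in> borel_measurable S"
proof -
  have "(\<lambda>x. x n) \<in> measurable S M" by (rule measurable_component_singleton) simp
  from measurable_compose[OF this measurable_M_borel] show ?thesis .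
qed

lemma measurable_mprod [measurable]: "mprod n \<in> borel_measurable S"
proof (induction n)
  case (Suc n)
  have "(\<lambda>x. x n ** mprod n x) \<in> borel_measurable S" using Suc by measurable
  then show ?case by simp
qed simp

lemma coordinate_in_space: "x \<in> space S \<Longrightarrow> x n \<in> space M"
  by (auto simp: space_PiM)

lemma mprod_bilip: "x \<in> space S \<Longrightarrow> mprod n x \<in> bilip (\<kappa> ^ n)"
proof (induction n)
  case (Suc n)
  then show ?case
    using bilip_mult[of "x n" \<kappa> "mprod n x" "\<kappa> ^ n"] coordinate_in_space[of x n] space_bilip \<kappa>_ge_1 by auto
qed (simp add: bilip_mat_1)

lemma \<kappa>_power_ge_1: "1 \<le> \<kappa> ^ n"
  using \<kappa>_ge_1 by simp

lemma mprod_nonzero: "x \<in> space S \<Longrightarrow> v \<noteq> 0 \<Longrightarrow> mprod n x *v v \<noteq> 0"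
  using mprod_bilip bilip_nonzero by blast

text \<open>Common source of the exponents of \<open>frame_norm\<close> and
  \<open>wedge_norm\<close>: the logarithm of such an \<open>N\<close> along the products is a
  subadditive process with constant \<open>ln C\<close>. The set \<open>G\<close> must contain all
  products, whose bilipschitz constants are unbounded, and is the domain on which \<open>N\<close>
  behaves like a norm.\<close>

lemma matrix_norm_exponent:
  fixes N :: "real^'n^'n \<Rightarrow> real"
  assumes N [measurable]: "N \<in> borel_measurable borel" and C: "1 \<le> C"
    and G: "mat 1 \<in> G" "\<And>g h. g \<in> G \<Longrightarrow> h \<in> G \<Longrightarrow> g ** h \<in> G" "space M \<subseteq> G"
    and pos: "\<And>g. g \<in> G \<Longrightarrow> 0 < N g"
    and sub: "\<And>g h. g \<in> G \<Longrightarrow> h \<in> G \<Longrightarrow> N (g ** h) \<le> N g * N h"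
    and tail: "\<And>g h. g \<in> G \<Longrightarrow> h \<in> space M \<Longrightarrow> N g \<le> C * N (g ** h)"
    and one: "1 / C \<le> N (mat 1)" "N (mat 1) \<le> C"
    and up: "\<And>g. g \<in> space M \<Longrightarrow> N g \<le> C"
  shows "\<exists>\<gamma>. (AE x in S. (\<lambda>n. ln (N (mprod n x)) / real n) \<longlonglongrightarrow> \<gamma>) \<and>
    (\<lambda>n. (\<integral>x. ln (N (mprod n x)) \<partial>S) / real n) \<longlonglongrightarrow> \<gamma>"
proof -
  have prdG: "mprod n x \<in> G" if "x \<in> space S" for n x
    by (induction n) (use that G(1,3) coordinate_in_space in \<open>auto intro!: G(2)\<close>)
  have tails: "N g \<le> C ^ n * N (g ** mprod n x)" if "g \<in> G" "x \<in> space S" for g n x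
    using that(1)
  proof (induction n arbitrary: g)
    case (Suc n)
    have x: "x n \<in> space M" using coordinate_in_space that by blast
    then have "N g \<le> C * N (g ** x n)" by (intro tail Suc.prems)
    also have "\<dots> \<le> C * (C ^ n * N (g ** x n ** mprod n x))"
      using C G Suc.prems x by (intro mult_left_mono Suc.IH) auto
    finally show ?case by (simp add: matrix_mul_assoc)
  qed (use pos in auto)
  have upper: "N (mprod n x) \<le> C ^ Suc n" if "x \<in> space S" for n x
  proof (induction n)
    case (Suc n)
    have x: "x n \<in> space M" using coordinate_in_space that by blast
    have "N (mprod (Suc n) x) \<le> N (x n) * N (mprod n x)"
      using sub[of "x n" "mprod n x"] x G prdG[OF that] by auto
    also have "\<dots> \<le> C * C ^ Suc n"
      using up[OF x] Suc C pos[OF prdG[OF that, of n]] by (intro mult_mono) auto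
    finally show ?case by simp
  qed (use one in simp)
  have lower: "1 \<le> C ^ Suc n * N (mprod n x)" if "x \<in> space S" for n x
  proof -
    have "1 \<le> C * N (mat 1)" using one C by (simp add: field_simps)
    also have "\<dots> \<le> C * (C ^ n * N (mat 1 ** mprod n x))"
      using C by (intro mult_left_mono tails that G) auto
    finally show ?thesis by (simp add: mult.assoc)
  qed
  interpret K: subadditive_process M "\<lambda>n x. ln (N (mprod n x))" "ln C"
  proof
    fix n
    show "(\<lambda>x. ln (N (mprod n x))) \<in> borel_measurable S" by measurable
  next
    fix n x assume x: "x \<in> space S"
    have "ln (N (mprod n x)) \<le> ln (C ^ Suc n)"
      using upper[OF x] pos[OF prdG[OF x]] C by (subst ln_le_cancel_iff) auto
    moreover have "0 \<le> ln (C ^ Suc n * N (mprod n x))" using lower[OF x] by (rule ln_ge_zero)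
    moreover have "ln (C ^ Suc n * N (mprod n x)) = ln (C ^ Suc n) + ln (N (mprod n x))"
      using C pos[OF prdG[OF x]] by (intro ln_mult_pos) auto
    moreover have "ln (C ^ Suc n) = ln C * real n + ln C" using C by (simp add: ln_realpow algebra_simps ln_mult)
    ultimately show "\<bar>ln (N (mprod n x))\<bar> \<le> ln C * real n + ln C" by linarith
  next
    fix m n x y assume x: "x \<in> space S" and y: "y \<in> space S"
    have "ln (N (mprod m y ** mprod n x)) \<le> ln (N (mprod m y) * N (mprod n x))"
      using sub[OF prdG[OF y] prdG[OF x]] pos[OF G(2)[OF prdG[OF y] prdG[OF x]]] by (intro ln_mono) auto
    also have "\<dots> = ln (N (mprod m y)) + ln (N (mprod n x))"
      using pos[OF prdG[OF y]] pos[OF prdG[OF x]] by (intro ln_mult_pos) auto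
    finally show "ln (N (mprod (m + n) (comb_seq n x y))) \<le> ln (N (mprod n x)) + ln (N (mprod m y))"
      by (simp add: mprod_comb_seq)
    have p: "0 < N (mprod m y ** mprod n x)" by (intro pos G(2) prdG x y)
    have "ln (N (mprod m y)) \<le> ln (C ^ n * N (mprod m y ** mprod n x))"
      using tails[OF prdG[OF y] x] pos[OF prdG[OF y]] by (intro ln_mono) auto
    also have "\<dots> = ln (N (mprod m y ** mprod n x)) + ln C * real n"
      using C p by (subst ln_mult_pos) (auto simp: ln_realpow)
    finally show "ln (N (mprod m y)) \<le> ln (N (mprod (m + n) (comb_seq n x y))) + ln C * real n"
      by (simp add: mprod_comb_seq)
  qed
  show ?thesis using K.AE_tendsto_\<gamma> K.mean_tendsto_\<gamma> by blast
qed

lemma frame_exponent: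
  assumes B: "orthonormal B" "B \<noteq> {}" and inv: "\<And>g. g \<in> space M \<Longrightarrow> (\<lambda>v. g *v v) ` span B \<subseteq> span B"
  shows "\<exists>\<gamma>. (AE x in S. (\<lambda>n. ln (frame_norm B (mprod n x)) / real n) \<longlonglongrightarrow> \<gamma>) \<and>
    (\<lambda>n. (\<integral>x. ln (frame_norm B (mprod n x)) \<partial>S) / real n) \<longlonglongrightarrow> \<gamma>"
proof -
  \<comment> \<open>Submultiplicativity of \<open>frame_norm B\<close> needs the right factor to
    preserve \<open>span B\<close>, hence invariance is part of \<open>G\<close>.\<close>
  define G where "G = {g. (\<exists>a\<ge>1. g \<in> bilip a) \<and> (\<lambda>v. g *v v) ` span B \<subseteq> span B}"
  have GD: "\<exists>a\<ge>1. g \<in> bilip a" "(\<lambda>v. g *v v) ` span B \<subseteq> span B" if "g \<in> G" for g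
    using that by (simp_all add: G_def)
  have GI: "g \<in> G" if "1 \<le> a" "g \<in> bilip a" "(\<lambda>v. g *v v) ` span B \<subseteq> span B" for g a
    using that by (auto simp: G_def)
  show ?thesis
  proof (rule matrix_norm_exponent[where C = "real (card B) * \<kappa>" and G = G])
  have cB: "1 \<le> real (card B)"
    using B orthonormal_finite[of B] by (simp add: Suc_le_eq card_gt_0_iff)
  show C: "1 \<le> real (card B) * \<kappa>"
    using cB \<kappa>_ge_1 mult_mono[of 1 "real (card B)" 1 \<kappa>] by simp
  show "1 / (real (card B) * \<kappa>) \<le> frame_norm B (mat 1)"
    using frame_norm_lower[OF B bilip_mat_1] C by (auto intro: order_trans[of _ 1] simp: divide_le_eq_1)
  show "frame_norm B (mat 1) \<le> real (card B) * \<kappa>"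
    using frame_norm_upper[OF B(1) bilip_mat_1] cB \<kappa>_ge_1 by (auto intro: order_trans[of _ "real (card B)"])
  show "0 < frame_norm B g" if g: "g \<in> G" for g
  proof -
    obtain a where a: "a \<ge> 1" "g \<in> bilip a" using GD(1)[OF g] by blast
    then have "0 < 1 / a" by simp
    with frame_norm_lower[OF B a(2,1)] show ?thesis by linarith
  qed
  show "g ** h \<in> G" if g: "g \<in> G" and h: "h \<in> G" for g h
  proof -
    obtain a b where a: "a \<ge> 1" "g \<in> bilip a" and b: "b \<ge> 1" "h \<in> bilip b"
      using GD(1)[OF g] GD(1)[OF h] by blast
    have "1 \<le> a * b" using a(1) b(1) mult_mono[of 1 a 1 b] by simp
    moreover have "g ** h \<in> bilip (a * b)" using a b by (intro bilip_mult) auto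
    moreover have "(\<lambda>v. (g ** h) *v v) ` span B \<subseteq> span B"
      using GD(2)[OF g] GD(2)[OF h] by (simp add: matrix_vector_mul_assoc[symmetric] image_subset_iff)
    ultimately show ?thesis by (rule GI)
  qed
  show "mat 1 \<in> G"
    using bilip_mat_1 by (intro GI[of 1]) auto
  show "space M \<subseteq> G"
    using space_bilip \<kappa>_ge_1 inv by (intro subsetI GI[of \<kappa>]) auto
  show "frame_norm B (g ** h) \<le> frame_norm B g * frame_norm B h" if "g \<in> G" "h \<in> G" for g h
    using that by (intro frame_norm_mult B GD)
  show "frame_norm B g \<le> real (card B) * \<kappa> * frame_norm B (g ** h)" if "g \<in> G" "h \<in> space M" for g h
    using that space_bilip by (intro frame_norm_tail B inv) auto
  show "frame_norm B g \<le> real (card B) * \<kappa>" if "g \<in> space M" for g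
    using that space_bilip by (intro frame_norm_upper B) auto
  qed measurable
qed

lemma wedge_exponent:
  assumes d: "CARD('n) \<ge> 2"
  shows "\<exists>\<gamma>. (AE x in S. (\<lambda>n. ln (wedge_norm (mprod n x)) / real n) \<longlonglongrightarrow> \<gamma>) \<and>
    (\<lambda>n. (\<integral>x. ln (wedge_norm (mprod n x)) \<partial>S) / real n) \<longlonglongrightarrow> \<gamma>"
proof (rule matrix_norm_exponent[where C = "2 * (real CARD('n))\<^sup>2 * (real CARD('n) * \<kappa>)\<^sup>2"
      and G = "{g. \<exists>a\<ge>1. g \<in> bilip a}"])
  let ?d = "real CARD('n)"
  have dk: "?d * 1 \<le> ?d * \<kappa>" using \<kappa>_ge_1 by (intro mult_left_mono) auto
  have d1: "1 \<le> ?d" using d by simp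
  moreover have "1 \<le> ?d * \<kappa>" using d1 dk by linarith
  ultimately have d2: "1 \<le> ?d\<^sup>2" "1 \<le> (?d * \<kappa>)\<^sup>2" "?d\<^sup>2 \<le> (?d * \<kappa>)\<^sup>2"
    using dk by (auto intro!: one_le_power power_mono simp del: mult_le_cancel_left1)
  show C: "1 \<le> 2 * ?d\<^sup>2 * (?d * \<kappa>)\<^sup>2"
  proof -
    have "1 \<le> 2 * ?d\<^sup>2" using d2(1) by linarith
    from mult_mono[OF this d2(2)] show ?thesis by simp
  qed
  show "wedge_norm (mat 1 :: real^'n^'n) \<le> 2 * ?d\<^sup>2 * (?d * \<kappa>)\<^sup>2"
    using bilip_mono[OF bilip_mat_1 \<kappa>_ge_1] by (rule wedge_norm_upper)
  have "1 / (2 * ?d\<^sup>2 * (?d * \<kappa>)\<^sup>2) \<le> 1 / (?d * \<kappa>)\<^sup>2"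
  proof (rule frac_le)
    have "1 \<le> 2 * ?d\<^sup>2" using d2(1) by linarith
    from mult_right_mono[OF this, of "(?d * \<kappa>)\<^sup>2"]
    show "(?d * \<kappa>)\<^sup>2 \<le> 2 * ?d\<^sup>2 * (?d * \<kappa>)\<^sup>2" by simp
    show "0 < (?d * \<kappa>)\<^sup>2" using d2(2) by linarith
  qed auto
  also have "\<dots> \<le> wedge_norm (mat 1 :: real^'n^'n)"
    using bilip_mono[OF bilip_mat_1 \<kappa>_ge_1] \<kappa>_ge_1 by (intro wedge_norm_lower d)
  finally show "1 / (2 * ?d\<^sup>2 * (?d * \<kappa>)\<^sup>2) \<le> wedge_norm (mat 1 :: real^'n^'n)" .
  show "0 < wedge_norm g" if g: "g \<in> {g. \<exists>a\<ge>1. g \<in> bilip a}" for g :: "real^'n^'n"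
  proof -
    obtain a where a: "a \<ge> 1" "g \<in> bilip a" using g by blast
    have "0 < 1 / (?d * a)\<^sup>2" using a d1 by simp
    with wedge_norm_lower[OF d a(2,1)] show ?thesis by linarith
  qed
  show "g ** h \<in> {g. \<exists>a\<ge>1. g \<in> bilip a}"
    if g: "g \<in> {g. \<exists>a\<ge>1. g \<in> bilip a}" and h: "h \<in> {g. \<exists>a\<ge>1. g \<in> bilip a}" for g h :: "real^'n^'n"
  proof -
    obtain a b where a: "a \<ge> 1" "g \<in> bilip a" and b: "b \<ge> 1" "h \<in> bilip b" using g h by blast
    have "1 \<le> a * b" using a(1) b(1) mult_mono[of 1 a 1 b] by simp
    moreover have "g ** h \<in> bilip (a * b)" using a b by (intro bilip_mult) auto
    ultimately show ?thesis by blast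
  qed
  show "space M \<subseteq> {g. \<exists>a\<ge>1. g \<in> bilip a}" using space_bilip \<kappa>_ge_1 by blast
  show "mat 1 \<in> {g :: real^'n^'n. \<exists>a\<ge>1. g \<in> bilip a}" using bilip_mat_1 by blast
qed (use space_bilip in \<open>auto intro!: wedge_norm_mult wedge_norm_tail wedge_norm_upper\<close>)

lemma singular_value_frame_norm:
  assumes B: "orthonormal B" "B \<noteq> {}" and g: "g \<in> bilip a" "1 \<le> a"
  shows "0 < singular_value (span B) 1 g"
    "\<bar>ln (singular_value (span B) 1 g) - ln (frame_norm B g)\<bar> \<le> ln (real (card B))"
proof -
  obtain b where b: "b \<in> B" using B(2) by blast
  then have "b \<noteq> 0" using B by (auto simp: orthonormal_def)
  then have "span B \<noteq> {0}" using b span_base[OF b] by blast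
  then obtain v where v: "v \<in> span B" "norm v = 1" "singular_value (span B) 1 g = norm (g *v v)"
      and le: "\<And>w. w \<in> span B \<Longrightarrow> norm (g *v w) \<le> singular_value (span B) 1 g * norm w"
    using singular_value_1[OF subspace_span] by metis
  have "v \<noteq> 0" using v by auto
  then show pos: "0 < singular_value (span B) 1 g" using v bilip_nonzero[OF g(1)] by simp
  have up: "singular_value (span B) 1 g \<le> frame_norm B g"
    using frame_norm_bound[OF B(1) v(1), of g] v by simp
  have "frame_norm B g \<le> (\<Sum>b\<in>B. singular_value (span B) 1 g)"
    unfolding frame_norm_def
  proof (rule sum_mono)
    fix b assume b: "b \<in> B"
    then show "norm (g *v b) \<le> singular_value (span B) 1 g"
      using le[OF span_base[OF b]] B by (simp add: orthonormal_def)
  qed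
  then have lo: "frame_norm B g \<le> real (card B) * singular_value (span B) 1 g" by simp
  have cB: "0 < real (card B)"
    using B orthonormal_finite[of B] by (simp add: card_gt_0_iff)
  have "ln (singular_value (span B) 1 g) \<le> ln (frame_norm B g)" using up pos by (intro ln_mono) auto
  moreover have "ln (frame_norm B g) \<le> ln (real (card B) * singular_value (span B) 1 g)"
    using lo up pos by (intro ln_mono) auto
  moreover have "ln (real (card B) * singular_value (span B) 1 g) = ln (real (card B)) + ln (singular_value (span B) 1 g)"
    using cB pos by (intro ln_mult_pos)
  ultimately show "\<bar>ln (singular_value (span B) 1 g) - ln (frame_norm B g)\<bar> \<le> ln (real (card B))"
    by linarith
qed

lemma singular_value_exponent:
  assumes B: "orthonormal B" "B \<noteq> {}"
    and lim: "AE x in S. (\<lambda>n. ln (frame_norm B (mprod n x)) / real n) \<longlonglongrightarrow> \<gamma>"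
  shows "AE x in S. (\<lambda>n. ln (singular_value (span B) 1 (mprod n x)) / real n) \<longlonglongrightarrow> \<gamma>"
  using lim AE_space
proof eventually_elim
  case (elim x)
  show ?case
    by (rule tendsto_divide_const_add[OF elim(1)], rule singular_value_frame_norm(2)[OF B mprod_bilip[OF elim(2)] \<kappa>_power_ge_1])
qed

text \<open>\<open>wedge_norm\<close> is within a constant factor of the product of the two largest
  singular values, so its exponent is the sum of theirs.\<close>

lemma singular_value_2_exponent:
  assumes d: "CARD('n) \<ge> 2"
    and lim1: "AE x in S. (\<lambda>n. ln (singular_value UNIV 1 (mprod n x)) / real n) \<longlonglongrightarrow> \<gamma>"
    and lim2: "AE x in S. (\<lambda>n. ln (wedge_norm (mprod n x)) / real n) \<longlonglongrightarrow> \<gamma>'"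
  shows "AE x in S. (\<lambda>n. ln (singular_value UNIV 2 (mprod n x)) / real n) \<longlonglongrightarrow> \<gamma>' - \<gamma>"
  using lim1 lim2 AE_space
proof eventually_elim
  case (elim x)
  let ?s = "\<lambda>k n. singular_value UNIV k (mprod n x)"
  let ?C = "2 * (real CARD('n))\<^sup>2"
  have C: "0 < ?C" by simp
  have w: "0 < wedge_norm (mprod n x)" for n
  proof -
    have "0 < 1 / (real CARD('n) * \<kappa> ^ n)\<^sup>2" using \<kappa>_ge_1 by auto
    with wedge_norm_lower[OF d mprod_bilip[OF elim(3)] \<kappa>_power_ge_1, of n] show ?thesis by linarith
  qed
  note sv = singular_value_12[OF d]
  have "0 < ?s 1 n * ?s 2 n" for n
  proof (rule ccontr)
    assume "\<not> 0 < ?s 1 n * ?s 2 n"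
    then have "?C * (?s 1 n * ?s 2 n) \<le> 0" using C by (simp add: not_less mult_le_0_iff)
    with w[of n] sv(2)[of "mprod n x"] show False by simp
  qed
  then have pos: "0 < ?s 1 n" "0 < ?s 2 n" for n
    using sv(3,4)[of "mprod n x"] unfolding zero_less_mult_iff by (smt (verit))+
  have "\<bar>(ln (?s 1 n) + ln (?s 2 n)) - ln (wedge_norm (mprod n x))\<bar> \<le> ln ?C" for n
  proof -
    have "ln (?s 1 n * ?s 2 n) \<le> ln (wedge_norm (mprod n x))"
      using sv(1)[of "mprod n x"] pos by (intro ln_mono) auto
    moreover have "ln (wedge_norm (mprod n x)) \<le> ln (?C * (?s 1 n * ?s 2 n))"
      using sv(2)[of "mprod n x"] w by (intro ln_mono) auto
    moreover have "ln (?C * (?s 1 n * ?s 2 n)) = ln ?C + ln (?s 1 n * ?s 2 n)"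
      using pos C by (intro ln_mult_pos) auto
    moreover have "ln (?s 1 n * ?s 2 n) = ln (?s 1 n) + ln (?s 2 n)"
      using pos by (intro ln_mult_pos) auto
    ultimately show ?thesis by linarith
  qed
  then have "(\<lambda>n. (ln (?s 1 n) + ln (?s 2 n)) / real n) \<longlonglongrightarrow> \<gamma>'"
    by (rule tendsto_divide_const_add[OF elim(2)])
  from tendsto_diff[OF this elim(1)] show ?case by (simp add: diff_divide_distrib[symmetric])
qed

end

section \<open>Uniform growth in mean\<close>

lemma sphere_subsequence:
  fixes v :: "nat \<Rightarrow> 'a::euclidean_space"
  assumes "\<And>i. norm (v i) = 1"
  obtains l r where "norm l = 1" "strict_mono (r :: nat \<Rightarrow> nat)" "(\<lambda>i. v (r i)) \<longlonglongrightarrow> l"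
proof -
  have "\<forall>i. v i \<in> sphere 0 1" using assms by simp
  then obtain l r where "l \<in> sphere 0 1" "strict_mono r" "(v \<circ> r) \<longlonglongrightarrow> l"
    using compact_sphere[of "0::'a" 1] unfolding compact_def by blast
  then show thesis by (intro that[of l r]) (auto simp: o_def)
qed

text \<open>The constant \<open>C\<close> may depend on the sequence and on the vector. Asking for a
  bound at all times makes the slow vectors a subspace and gives a measurable event.\<close>

definition slow :: "real \<Rightarrow> (nat \<Rightarrow> real^'n::finite^'n) \<Rightarrow> real^'n \<Rightarrow> bool"
  where "slow s x v \<longleftrightarrow> (\<exists>C. \<forall>n. norm (mprod n x *v v) \<le> C * exp (s * real n))"

lemma subspace_slow: "subspace {v. slow s x v}"
  unfolding subspace_def
proof safe
  show "slow s x 0" unfolding slow_def by (intro exI[of _ 0]) simp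
  fix v w assume "slow s x v" "slow s x w"
  then obtain C D where "\<And>n. norm (mprod n x *v v) \<le> C * exp (s * real n)" "\<And>n. norm (mprod n x *v w) \<le> D * exp (s * real n)"
    unfolding slow_def by blast
  then have "norm (mprod n x *v (v + w)) \<le> (C + D) * exp (s * real n)" for n
    unfolding matrix_vector_right_distrib distrib_right by (intro norm_triangle_mono)
  then show "slow s x (v + w)" unfolding slow_def by blast
next
  fix c :: real and v assume "slow s x v"
  then obtain C where C: "\<And>n. norm (mprod n x *v v) \<le> C * exp (s * real n)"
    unfolding slow_def by blast
  have "norm (mprod n x *v (c *\<^sub>R v)) \<le> (\<bar>c\<bar> * C) * exp (s * real n)" for n
    using mult_left_mono[OF C[of n], of "\<bar>c\<bar>"] by (simp add: matrix_vector_mult_scaleR mult.assoc)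
  then show "slow s x (c *\<^sub>R v)" unfolding slow_def by blast
qed

lemma slow_scale: "c \<noteq> 0 \<Longrightarrow> slow s x (c *\<^sub>R v) \<longleftrightarrow> slow s x v"
  using subspace_scale[OF subspace_slow, of v s x c] subspace_scale[OF subspace_slow, of "c *\<^sub>R v" s x "1 / c"] by auto

text \<open>The first \<open>n\<close> factors change only the constant. The zero-one law for
  slowness and the invariance of the almost surely slow vectors both rest on this.\<close>

lemma slow_comb_seq: "slow s (comb_seq n x y) v \<longleftrightarrow> slow s y (mprod n x *v v)"
proof
  assume "slow s (comb_seq n x y) v"
  then obtain C where C: "\<And>k. norm (mprod k (comb_seq n x y) *v v) \<le> C * exp (s * real k)"
    unfolding slow_def by blast
  have "norm (mprod m y *v (mprod n x *v v)) \<le> (C * exp (s * real n)) * exp (s * real m)" for m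
    using C[of "m + n"] by (simp add: mprod_comb_seq matrix_vector_mul_assoc distrib_left exp_add mult_ac)
  then show "slow s y (mprod n x *v v)" unfolding slow_def by blast
next
  assume "slow s y (mprod n x *v v)"
  then obtain C where C: "\<And>m. norm (mprod m y *v (mprod n x *v v)) \<le> C * exp (s * real m)"
    unfolding slow_def by blast
  have C0: "0 \<le> C" using order_trans[OF norm_ge_zero C[of 0]] by simp
  let ?z = "comb_seq n x y"
  \<comment> \<open>\<open>D\<close> covers the times before \<open>n\<close>, about which slowness
    of the image under the future sequence says nothing.\<close>
  define D where "D = (\<Sum>k<n. norm (mprod k ?z *v v) * exp (- s * real k))"
  have D0: "0 \<le> D" unfolding D_def by (intro sum_nonneg) auto
  have "norm (mprod k ?z *v v) \<le> (C * exp (- s * real n) + D) * exp (s * real k)" for k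
  proof (cases "k < n")
    case True
    have "norm (mprod k ?z *v v) * exp (- s * real k) \<le> D"
      unfolding D_def using True by (intro member_le_sum) auto
    also have "\<dots> \<le> C * exp (- s * real n) + D" using C0 by simp
    finally have "norm (mprod k ?z *v v) * exp (- s * real k) * exp (s * real k) \<le>
        (C * exp (- s * real n) + D) * exp (s * real k)" by (rule mult_right_mono) simp
    then show ?thesis by (simp add: mult.assoc flip: exp_add)
  next
    case False
    then obtain m where m: "k = m + n" by (metis le_add_diff_inverse2 not_less)
    have "norm (mprod k ?z *v v) \<le> C * exp (s * real m)"
      using C[of m] by (simp add: m mprod_comb_seq matrix_vector_mul_assoc)
    also have "\<dots> = C * exp (- s * real n) * exp (s * real k)"
      by (simp add: m mult.assoc algebra_simps flip: exp_add)
    also have "\<dots> \<le> (C * exp (- s * real n) + D) * exp (s * real k)"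
      using D0 by (intro mult_right_mono) auto
    finally show ?thesis .
  qed
  then show "slow s ?z v" unfolding slow_def by blast
qed

context walk
begin

definition slow_set :: "real \<Rightarrow> real^'n \<Rightarrow> (nat \<Rightarrow> real^'n^'n) set"
  where "slow_set s v = {x \<in> space S. slow s x v}"

lemma sets_slow_set [measurable]: "slow_set s v \<in> sets S"
proof -
  have "slow s x v \<longleftrightarrow> (\<exists>C::nat. \<forall>n. norm (mprod n x *v v) \<le> real C * exp (s * real n))" for x
  proof
    assume "slow s x v"
    then obtain C where C: "\<And>n. norm (mprod n x *v v) \<le> C * exp (s * real n)" unfolding slow_def by blast
    obtain D :: nat where D: "C \<le> real D" using real_arch_simple by blast
    have "norm (mprod n x *v v) \<le> real D * exp (s * real n)" for n
      by (rule order_trans[OF C]) (use D in simp)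
    then show "\<exists>C::nat. \<forall>n. norm (mprod n x *v v) \<le> real C * exp (s * real n)" by blast
  qed (auto simp: slow_def)
  then have "slow_set s v = {x \<in> space S. \<exists>C::nat. \<forall>n. norm (mprod n x *v v) \<le> real C * exp (s * real n)}"
    by (simp add: slow_set_def)
  also have "\<dots> \<in> sets S" by measurable
  finally show ?thesis .
qed

lemma AE_slow_step:
  assumes "AE x in S. slow s x w"
  shows "AE g in M. AE y in S. slow s y (g *v w)"
proof -
  interpret MS: pair_sigma_finite M S ..
  have m: "(\<lambda>(g, y). case_nat g y) \<in> measurable (M \<Otimes>\<^sub>M S) S" by measurable
  have "AE x in distr (M \<Otimes>\<^sub>M S) S (\<lambda>(g, y). case_nat g y). slow s x w"
    unfolding PiM_iter by (rule assms)
  from AE_distrD[OF m this]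
  have "AE g in M. AE y in S. slow s (case_nat g y) w"
    using MS.AE_pair by fastforce
  then show ?thesis
  proof eventually_elim
    case (elim g)
    have "case_nat g y = comb_seq 1 (\<lambda>_. g) y" for y by simp
    with elim show ?case by (simp only: slow_comb_seq) simp
  qed
qed

text \<open>The slow vectors of a sequence form a closed subspace, so the probability that \<open>v\<close> is slow is upper
  semicontinuous in \<open>v\<close> and attains its maximum over the unit sphere; the maximum is \<open>0\<close> or \<open>1\<close> by
  the zero-one law.\<close>

lemma slow_dichotomy:
  obtains l where "norm l = 1" "measure S (slow_set s l) = 1"
  | "\<And>v. v \<noteq> 0 \<Longrightarrow> measure S (slow_set s v) = 0"
proof -
  define h where "h v = measure S (slow_set s v)" for v
  have hscale: "h (c *\<^sub>R v) = h v" if "c \<noteq> 0" for c v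
    unfolding h_def slow_set_def slow_scale[OF that] ..
  define m where "m = (SUP v\<in>sphere 0 1. h v)"
  have bdd: "bdd_above (h ` sphere 0 1)"
    by (rule bdd_aboveI[where M = 1]) (auto simp: h_def)
  have ne: "sphere (0 :: real^'n) 1 \<noteq> {}" by simp
  have "\<exists>v. norm v = 1 \<and> m - 1 / Suc i < h v" for i :: nat
    using less_cSUP_iff[OF ne bdd, of "m - 1 / Suc i"] by (auto simp: m_def)
  then obtain v where v: "\<And>i. norm (v i) = 1" "\<And>i. m - 1 / Suc i < h (v i)" by metis
  obtain l r where l: "norm l = 1" and r: "strict_mono r" and lim: "(\<lambda>i. v (r i)) \<longlonglongrightarrow> l"
    using sphere_subsequence[OF v(1)] .
  \<comment> \<open>The subsequence is shifted by \<open>k\<close>, so that all its members have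
    probability above \<open>m - 1 / Suc k\<close> before the limit superior of the events is
    taken.\<close>
  have "m - 1 / Suc k \<le> h l" for k
  proof -
    have "m - 1 / Suc k \<le> h (v (r (i + k)))" for i
    proof -
      have "k \<le> r (i + k)" using seq_suble[OF r, of "i + k"] by simp
      then have "1 / real (Suc (r (i + k))) \<le> 1 / real (Suc k)" by (intro divide_left_mono) auto
      then show ?thesis using v(2)[of "r (i + k)"] by linarith
    qed
    then have "m - 1 / Suc k \<le> measure S {x \<in> space S. \<forall>j. \<exists>i\<ge>j. x \<in> slow_set s (v (r (i + k)))}"
      unfolding h_def by (intro P.limsup_events) auto
    also have "\<dots> \<le> h l"
      unfolding h_def
    proof (intro P.finite_measure_mono subsetI)
      fix x assume "x \<in> {x \<in> space S. \<forall>j. \<exists>i\<ge>j. x \<in> slow_set s (v (r (i + k)))}"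
      then have x: "x \<in> space S" and fr: "\<And>j. \<exists>i\<ge>j. slow s x (v (r (i + k)))"
        by (auto simp: slow_set_def)
      have "closed {w. slow s x w}" by (rule closed_subspace[OF subspace_slow])
      then have op: "open (- {w. slow s x w})" by (simp add: open_Compl)
      have "slow s x l"
      proof (rule ccontr)
        assume "\<not> slow s x l"
        moreover have "(\<lambda>i. v (r (i + k))) \<longlonglongrightarrow> l" using lim by (rule LIMSEQ_ignore_initial_segment)
        ultimately have "eventually (\<lambda>i. v (r (i + k)) \<in> - {w. slow s x w}) sequentially"
          using op by (intro topological_tendstoD) auto
        then obtain j where "\<forall>i\<ge>j. \<not> slow s x (v (r (i + k)))" by (auto simp: eventually_sequentially)
        with fr[of j] show False by blast
      qed
      then show "x \<in> slow_set s l" using x by (simp add: slow_set_def)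
    qed measurable
    finally show ?thesis .
  qed
  then have "(\<lambda>k. m - 1 / Suc k) \<longlonglongrightarrow> m - 0 \<Longrightarrow> m - 0 \<le> h l" by (intro LIMSEQ_le_const2) auto
  moreover have "(\<lambda>k. m - 1 / Suc k) \<longlonglongrightarrow> m - 0"
    using LIMSEQ_inverse_real_of_nat by (intro tendsto_diff tendsto_const) (simp add: inverse_eq_divide)
  ultimately have m: "m \<le> h l" by simp
  have le: "h w \<le> h l" if w: "w \<noteq> 0" for w
  proof -
    have "h w = h ((1 / norm w) *\<^sub>R w)" using w by (intro hscale[symmetric]) auto
    also have "\<dots> \<le> m" unfolding m_def using w by (intro cSUP_upper bdd) auto
    finally show ?thesis using m by simp
  qed
  have "measure S (slow_set s l) = 0 \<or> measure S (slow_set s l) = 1"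
  proof (rule zero_one)
    fix n x assume x: "x \<in> space S"
    \<comment> \<open>Given the first \<open>n\<close> factors, the event is slowness of the image
      of \<open>l\<close>, whose probability cannot exceed the maximum attained at
      \<open>l\<close>.\<close>
    have "{y \<in> space S. comb_seq n x y \<in> slow_set s l} = slow_set s (mprod n x *v l)"
      using space_comb_seq[OF x] by (auto simp: slow_set_def slow_comb_seq)
    moreover have "l \<noteq> 0" using l by auto
    ultimately show "measure S {y \<in> space S. comb_seq n x y \<in> slow_set s l} \<le> measure S (slow_set s l)"
      using le[OF mprod_nonzero[OF x]] by (simp add: h_def)
  qed measurable
  then show thesis
  proof
    assume "measure S (slow_set s l) = 1"
    then show thesis using that(1) l by blast
  next
    assume 0: "measure S (slow_set s l) = 0"
    show thesis
    proof (rule that(2))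
      fix v :: "real^'n" assume "v \<noteq> 0"
      from le[OF this] 0 show "measure S (slow_set s v) = 0" by (simp add: h_def measure_le_0_iff)
    qed
  qed
qed

text \<open>Compactness. If for every \<open>N\<close> some direction stayed at rate
  \<open>s\<close> up to time \<open>N\<close> with probability above \<open>\<delta>\<close>, then
  a limit of these directions would stay there forever with probability at least
  \<open>\<delta>\<close>, hence be slow.\<close>

lemma uniform_escape:
  assumes null: "\<And>v. v \<noteq> 0 \<Longrightarrow> measure S (slow_set s v) = 0" and \<delta>: "\<delta> > 0"
  shows "\<exists>N. \<forall>v. v \<noteq> 0 \<longrightarrow>
    measure S {x \<in> space S. \<forall>j\<in>{1..N}. norm (mprod j x *v v) \<le> exp (s * real j) * norm v} \<le> \<delta>"
proof (rule ccontr)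
  define bad where "bad N v = {x \<in> space S. \<forall>j\<in>{1..N}. norm (mprod j x *v v) \<le> exp (s * real j) * norm v}" for N :: nat and v
  have [measurable]: "bad N v \<in> sets S" for N v unfolding bad_def by measurable
  have scale: "bad N (c *\<^sub>R v) = bad N v" if "c > 0" for N c v
    using that by (auto simp: bad_def matrix_vector_mult_scaleR)
  assume "\<not> ?thesis"
  then have "\<forall>N. \<exists>v. v \<noteq> 0 \<and> \<delta> < measure S (bad N v)" by (auto simp: bad_def not_le)
  then obtain w where w: "\<And>N. w N \<noteq> 0" "\<And>N. \<delta> < measure S (bad N (w N))" by metis
  define v where "v N = (1 / norm (w N)) *\<^sub>R w N" for N
  have v1: "norm (v N) = 1" for N using w by (simp add: v_def)
  have v2: "\<delta> < measure S (bad N (v N))" for N using w scale[of "1 / norm (w N)" N "w N"] by (simp add: v_def)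
  obtain l r where l: "norm l = 1" and r: "strict_mono r" and lim: "(\<lambda>i. v (r i)) \<longlonglongrightarrow> l"
    using sphere_subsequence[OF v1] .
  have "\<delta> \<le> measure S {x \<in> space S. \<forall>j. \<exists>i\<ge>j. x \<in> bad (r i) (v (r i))}"
    using v2 by (intro P.limsup_events) (auto intro: less_imp_le)
  also have "\<dots> \<le> measure S (slow_set s l)"
  proof (intro P.finite_measure_mono subsetI)
    fix x assume "x \<in> {x \<in> space S. \<forall>j. \<exists>i\<ge>j. x \<in> bad (r i) (v (r i))}"
    then have x: "x \<in> space S" and fr: "\<And>j. \<exists>i\<ge>j. x \<in> bad (r i) (v (r i))" by auto
    have "norm (mprod j x *v l) \<le> exp (s * real j) * norm l" if j: "1 \<le> j" for j
    proof (rule ccontr)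
      assume "\<not> ?thesis"
      then have "0 < norm (mprod j x *v l) - exp (s * real j) * norm l" by simp
      moreover have "(\<lambda>i. norm (mprod j x *v v (r i)) - exp (s * real j) * norm (v (r i))) \<longlonglongrightarrow>
          norm (mprod j x *v l) - exp (s * real j) * norm l"
        by (intro tendsto_intros bounded_linear.tendsto[OF matrix_vector_mul_bounded_linear] lim)
      ultimately have "eventually (\<lambda>i. 0 < norm (mprod j x *v v (r i)) - exp (s * real j) * norm (v (r i))) sequentially"
        by (intro order_tendstoD)
      then obtain i0 where i0: "\<And>i. i \<ge> i0 \<Longrightarrow> 0 < norm (mprod j x *v v (r i)) - exp (s * real j) * norm (v (r i))"
        by (auto simp: eventually_sequentially)
      obtain i where i: "i \<ge> max i0 j" "x \<in> bad (r i) (v (r i))" using fr by blast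
      \<comment> \<open>The time horizon \<open>r i\<close> has passed \<open>j\<close>, so the
        event at index \<open>i\<close> does constrain time \<open>j\<close>.\<close>
      then have "j \<le> r i" using seq_suble[OF r, of i] by simp
      then have "norm (mprod j x *v v (r i)) \<le> exp (s * real j) * norm (v (r i))"
        using i j by (auto simp: bad_def)
      with i0[of i] i show False by simp
    qed
    then have "norm (mprod j x *v l) \<le> norm l * exp (s * real j)" for j
      by (cases "j = 0") (auto simp: mult.commute)
    then show "x \<in> slow_set s l" using x by (auto simp: slow_set_def slow_def)
  qed measurable
  also have "\<dots> = 0" using l by (intro null) auto
  finally show False using \<delta> by simp
qed

lemma ln_stretch_mprod_bound: "x \<in> space S \<Longrightarrow> v \<noteq> 0 \<Longrightarrow> \<bar>ln_stretch (mprod n x) v\<bar> \<le> real n * ln \<kappa>"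
  using ln_stretch_bound[OF mprod_bilip \<kappa>_power_ge_1, of x v n] \<kappa>_ge_1 by (simp add: ln_realpow)

lemma ln_stretch_mprod_add:
  assumes "x \<in> space S" "v \<noteq> 0"
  shows "ln_stretch (mprod (n + m) x) v = ln_stretch (mprod n x) v + ln_stretch (mprod m (sshift n x)) (mprod n x *v v)"
proof -
  have "ln_stretch (mprod (m + n) x) v = ln_stretch (mprod m (sshift n x)) (mprod n x *v v) + ln_stretch (mprod n x) v"
    unfolding mprod_add using assms by (intro ln_stretch_mult mprod_nonzero space_sshift) auto
  then show ?thesis by (simp add: add.commute)
qed

lemma ln_stretch_mprod_integrable: "v \<noteq> 0 \<Longrightarrow> integrable S (\<lambda>x. ln_stretch (mprod n x) v)"
  by (rule P.integrable_bounded[where B = "real n * ln \<kappa>"]) (auto simp: ln_stretch_mprod_bound)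

text \<open>The covering argument again, now applied to the deficit
  \<open>s * n - ln_stretch\<close> of the current direction. A time is bad if within
  \<open>N\<close> further steps the direction reached has not exceeded rate \<open>s\<close>; by
  \<open>uniform_escape\<close> this has small probability whatever the direction, so the mean
  deficit grows slowly, uniformly in the starting vector.\<close>

lemma uniform_growth:
  assumes no_slow: "\<And>s W. s < \<gamma> \<Longrightarrow> subspace W \<Longrightarrow> W \<noteq> {0} \<Longrightarrow> (\<And>w. w \<in> W \<Longrightarrow> AE g in M. g *v w \<in> W) \<Longrightarrow>
      (\<And>w. w \<in> W \<Longrightarrow> AE x in S. slow s x w) \<Longrightarrow> False"
    and \<epsilon>: "\<epsilon> > 0"
  shows "\<exists>C. \<forall>n v. v \<noteq> 0 \<longrightarrow> real n * (\<gamma> - \<epsilon>) - C \<le> (\<integral>x. ln_stretch (mprod n x) v \<partial>S)"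
proof -
  \<comment> \<open>Half of \<open>\<epsilon>\<close> is spent on the rate; the other half pays for
    the bad times, at price \<open>2 * c * \<delta> = \<epsilon> / 2\<close> per step.\<close>
  define s where "s = \<gamma> - \<epsilon> / 2"
  have s: "s < \<gamma>" using \<epsilon> by (simp add: s_def)
  have null: "measure S (slow_set s v) = 0" if "v \<noteq> 0" for v
  proof (rule slow_dichotomy[of s])
    fix l assume l: "norm l = 1" "measure S (slow_set s l) = 1"
    define W where "W = {w. AE x in S. slow s x w}"
    have "AE x in S. x \<in> slow_set s l" using l by (subst P.AE_in_set_eq_1) auto
    then have "AE x in S. slow s x l" by eventually_elim (simp add: slow_set_def)
    then have lW: "l \<in> W" by (simp add: W_def)
    have "subspace W"
      unfolding subspace_def
    proof safe
      show "0 \<in> W" by (simp add: W_def subspace_0[OF subspace_slow, simplified])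
      show "v + w \<in> W" if "v \<in> W" "w \<in> W" for v w
      proof -
        from that have "AE x in S. slow s x v" "AE x in S. slow s x w" by (simp_all add: W_def)
        then have "AE x in S. slow s x (v + w)"
          by eventually_elim (use subspace_add[OF subspace_slow] in auto)
        then show ?thesis by (simp add: W_def)
      qed
      show "c *\<^sub>R v \<in> W" if "v \<in> W" for c v
      proof -
        from that have "AE x in S. slow s x v" by (simp add: W_def)
        then have "AE x in S. slow s x (c *\<^sub>R v)"
          by eventually_elim (use subspace_scale[OF subspace_slow] in auto)
        then show ?thesis by (simp add: W_def)
      qed
    qed
    moreover have "W \<noteq> {0}" using lW l by auto
    moreover have "AE g in M. g *v w \<in> W" if "w \<in> W" for w
      using AE_slow_step[of s w] that by (simp add: W_def)
    ultimately have False by (rule no_slow[OF s]) (simp_all add: W_def)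
    then show ?thesis ..
  qed (use that in blast)
  define c where "c = \<bar>s\<bar> + ln \<kappa> + 1"
  have c: "c > 0" unfolding c_def using \<kappa>_ge_1 by (simp add: add_nonneg_pos)
  define \<delta> where "\<delta> = \<epsilon> / (4 * c)"
  have \<delta>: "\<delta> > 0" using \<epsilon> c by (simp add: \<delta>_def)
  obtain N where N: "\<And>v. v \<noteq> 0 \<Longrightarrow>
      measure S {x \<in> space S. \<forall>j\<in>{1..N}. norm (mprod j x *v v) \<le> exp (s * real j) * norm v} \<le> \<delta>"
    using uniform_escape[OF null \<delta>] by auto
  define bad where "bad k v = {x \<in> space S. \<forall>j\<in>{1..N}. norm (mprod j (sshift k x) *v (mprod k x *v v)) \<le>
      exp (s * real j) * norm (mprod k x *v v)}" for k v
  have [measurable]: "bad k v \<in> sets S" for k v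
    unfolding bad_def by (rule sets.sets_Collect_finite_All) measurable
  \<comment> \<open>The factors after time \<open>k\<close> are independent of the direction reached
    at time \<open>k\<close>, and the bound \<open>N\<close> holds for every direction.\<close>
  have bad_le: "measure S (bad k v) \<le> \<delta>" if v: "v \<noteq> 0" for k v
  proof -
    have bi: "integrable S (\<lambda>x. indicat_real (bad k v) x)"
      by (rule P.integrable_bounded[where B = 1]) (auto simp: indicator_def)
    have "measure S (bad k v) = (\<integral>x. indicat_real (bad k v) x \<partial>S)" by simp
    also have "\<dots> = (\<integral>x. (\<integral>y. indicat_real (bad k v) (comb_seq k x y) \<partial>S) \<partial>S)"
      by (rule integral_comb_seq[OF bi])
    also have "\<dots> \<le> (\<integral>x. \<delta> \<partial>S)"
    proof (rule integral_mono')
      fix x assume x: "x \<in> space S"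
      have p: "mprod k (comb_seq k x y) = mprod k x" for y by (rule mprod_cong) (simp add: comb_seq_less)
      let ?w = "mprod k x *v v"
      let ?E = "{x \<in> space S. \<forall>j\<in>{1..N}. norm (mprod j x *v ?w) \<le> exp (s * real j) * norm ?w}"
      have "(\<integral>y. indicat_real (bad k v) (comb_seq k x y) \<partial>S) = (\<integral>y. indicat_real ?E y \<partial>S)"
        using space_comb_seq[OF x] by (intro Bochner_Integration.integral_cong)
          (auto simp: bad_def indicator_def sshift_comb_seq p)
      also have "\<dots> = measure S ?E"
        by (simp add: Int_absorb2)
      also have "\<dots> \<le> \<delta>" by (rule N[OF mprod_nonzero[OF x v]])
      finally show "(\<integral>y. indicat_real (bad k v) (comb_seq k x y) \<partial>S) \<le> \<delta>" .
    qed (use \<delta> in auto)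
    finally show ?thesis by (simp add: P.prob_space)
  qed
  \<comment> \<open>The dynamics is the skew product on pairs of a vector and a sequence; by the
    cocycle identity \<open>Y\<close> is even additive along it.\<close>
  define Y where "Y n p = s * real n - ln_stretch (mprod n (snd p)) (fst p)" for n and p :: "(real^'n) \<times> (nat \<Rightarrow> real^'n^'n)"
  define \<tau> where "\<tau> n p = (mprod n (snd p) *v fst p, sshift n (snd p))" for n and p :: "(real^'n) \<times> (nat \<Rightarrow> real^'n^'n)"
  have cover: "s * real n - ln_stretch (mprod n x) v \<le> 2 * c * (\<Sum>k<n. indicat_real (bad k v) x) + c * real N + c"
    if x: "x \<in> space S" and v: "v \<noteq> 0" for n x v
  proof -
    have "Y n (v, x) \<le> 2 * c * (\<Sum>k<n. indicator {p. \<forall>j\<in>{1..N}. Y j p > 0} (\<tau> k (v, x))) + c * real N + c"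
    proof (rule covering_bound[where X = "{p. fst p \<noteq> 0 \<and> snd p \<in> space S}"])
      fix m n and p :: "(real^'n) \<times> (nat \<Rightarrow> real^'n^'n)"
      assume p: "p \<in> {p. fst p \<noteq> 0 \<and> snd p \<in> space S}"
      show "\<tau> 0 p = p" by (simp add: \<tau>_def)
      show "\<tau> m (\<tau> n p) = \<tau> (m + n) p"
        by (simp add: \<tau>_def sshift_sshift mprod_add matrix_vector_mul_assoc)
      show "\<tau> n p \<in> {p. fst p \<noteq> 0 \<and> snd p \<in> space S}"
        using p mprod_nonzero space_sshift by (simp add: \<tau>_def)
      show "Y (n + m) p \<le> Y n p + Y m (\<tau> n p)"
        using ln_stretch_mprod_add[of "snd p" "fst p" n m] p by (simp add: Y_def \<tau>_def algebra_simps)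
      have "s * real n \<le> \<bar>s\<bar> * real n" by (intro mult_right_mono) auto
      moreover have "- ln_stretch (mprod n (snd p)) (fst p) \<le> real n * ln \<kappa>"
        using ln_stretch_mprod_bound[of "snd p" "fst p" n] p by auto
      moreover have "c * real n + c = \<bar>s\<bar> * real n + real n * ln \<kappa> + real n + c"
        by (simp add: c_def algebra_simps)
      ultimately show "Y n p \<le> c * real n + c" using c unfolding Y_def by simp
    qed (use x v c in auto)
    also have "2 * c * (\<Sum>k<n. indicator {p. \<forall>j\<in>{1..N}. Y j p > 0} (\<tau> k (v, x))) \<le>
        2 * c * (\<Sum>k<n. indicat_real (bad k v) x)"
    proof (intro mult_left_mono sum_mono)
      fix k
      show "indicator {p. \<forall>j\<in>{1..N}. Y j p > 0} (\<tau> k (v, x)) \<le> indicat_real (bad k v) x"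
      proof (cases "\<forall>j\<in>{1..N}. Y j (\<tau> k (v, x)) > 0")
        case True
        let ?w = "mprod k x *v v"
        have w: "norm ?w > 0" using mprod_nonzero[OF x v] by simp
        have "norm (mprod j (sshift k x) *v ?w) \<le> exp (s * real j) * norm ?w" if "j \<in> {1..N}" for j
        proof -
          have pos: "norm (mprod j (sshift k x) *v ?w) / norm ?w > 0"
            using w mprod_nonzero[OF space_sshift[OF x] mprod_nonzero[OF x v], of j k k] by simp
          have "ln (norm (mprod j (sshift k x) *v ?w) / norm ?w) < s * real j"
            using True that by (simp add: Y_def \<tau>_def ln_stretch_def)
          then have "norm (mprod j (sshift k x) *v ?w) / norm ?w \<le> exp (s * real j)"
            using pos by (metis exp_le_cancel_iff exp_ln less_imp_le)
          then show ?thesis using w by (simp add: divide_le_eq)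
        qed
        then have "x \<in> bad k v" using x by (simp add: bad_def)
        then show ?thesis by (simp add: indicator_def)
      qed (auto simp: indicator_def)
    qed (use c in auto)
    finally show ?thesis by (simp add: Y_def)
  qed
  have "real n * (\<gamma> - \<epsilon>) - (c * real N + c) \<le> (\<integral>x. ln_stretch (mprod n x) v \<partial>S)" if v: "v \<noteq> 0" for n v
  proof -
    have bi: "integrable S (\<lambda>x. indicat_real (bad k v) x)" for k
      by (rule P.integrable_bounded[where B = 1]) (auto simp: indicator_def)
    have "s * real n - (\<integral>x. ln_stretch (mprod n x) v \<partial>S) = (\<integral>x. s * real n - ln_stretch (mprod n x) v \<partial>S)"
      using ln_stretch_mprod_integrable[OF v] by (simp add: P.prob_space)
    also have "\<dots> \<le> (\<integral>x. 2 * c * (\<Sum>k<n. indicat_real (bad k v) x) + c * real N + c \<partial>S)"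
      using ln_stretch_mprod_integrable[OF v] bi cover[OF _ v] by (intro integral_mono) auto
    also have "\<dots> = 2 * c * (\<Sum>k<n. measure S (bad k v)) + c * real N + c"
      using bi by (simp add: P.prob_space)
    also have "\<dots> \<le> 2 * c * (\<Sum>k<n. \<delta>) + c * real N + c"
      using c bad_le[OF v] by (intro add_right_mono mult_left_mono sum_mono) auto
    also have "2 * c * (\<Sum>k<n. \<delta>) = real n * (\<epsilon> / 2)"
      using c by (simp add: \<delta>_def)
    finally show ?thesis by (simp add: s_def algebra_simps)
  qed
  then show ?thesis by blast
qed

end

section \<open>Contraction in mean of the projective distance\<close>

context walk
begin

lemma integrable_S_bounded:
  "f \<in> borel_measurable S \<Longrightarrow> (\<And>x. x \<in> space S \<Longrightarrow> \<bar>f x :: real\<bar> \<le> B) \<Longrightarrow> integrable S f"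
  by (rule P.integrable_bounded)

lemma ln_wedge_norm_bound:
  assumes d: "CARD('n) \<ge> 2" and x: "x \<in> space S"
  shows "0 < wedge_norm (mprod n x)"
    "\<bar>ln (wedge_norm (mprod n x))\<bar> \<le> ln (2 * (real CARD('n))\<^sup>2 * (real CARD('n) * \<kappa> ^ n)\<^sup>2)"
proof -
  let ?d = "real CARD('n)"
  let ?X = "(?d * \<kappa> ^ n)\<^sup>2"
  let ?Y = "2 * ?d\<^sup>2"
  have d1: "1 \<le> ?d" using d by simp
  have "1 * 1 \<le> ?d * \<kappa> ^ n" using d1 \<kappa>_power_ge_1 by (intro mult_mono) auto
  then have X: "1 \<le> ?X" by (intro one_le_power) simp
  have "1 \<le> ?d\<^sup>2" using d1 by (intro one_le_power)
  then have Y: "1 \<le> ?Y" by linarith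
  have lo: "1 / ?X \<le> wedge_norm (mprod n x)" by (rule wedge_norm_lower[OF d mprod_bilip[OF x] \<kappa>_power_ge_1])
  have up: "wedge_norm (mprod n x) \<le> ?Y * ?X" by (rule wedge_norm_upper[OF mprod_bilip[OF x]])
  have "0 < 1 / ?X" using X by (intro divide_pos_pos) linarith+
  then show pos: "0 < wedge_norm (mprod n x)" using lo by linarith
  have ln_inv: "ln (1 / t) = - ln t" if "1 \<le> t" for t :: real using that by (simp add: ln_div)
  have "ln (1 / ?X) \<le> ln (wedge_norm (mprod n x))" using lo \<open>0 < 1 / ?X\<close> by (intro ln_mono)
  moreover have "ln (1 / ?X) = - ln ?X" by (rule ln_inv[OF X])
  moreover have "ln (wedge_norm (mprod n x)) \<le> ln (?Y * ?X)" using up pos by (intro ln_mono)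
  moreover have "ln (?Y * ?X) = ln ?Y + ln ?X" using X Y by (intro ln_mult_pos) linarith+
  moreover have "0 \<le> ln ?Y" using Y by (rule ln_ge_zero)
  ultimately show "\<bar>ln (wedge_norm (mprod n x))\<bar> \<le> ln (?Y * ?X)" by linarith
qed

definition moment :: "nat \<Rightarrow> real \<Rightarrow> real^'n \<Rightarrow> real^'n \<Rightarrow> real"
  where "moment j \<alpha> u v = (\<integral>x. pdist (mprod j x *v u) (mprod j x *v v) powr \<alpha> \<partial>S)"

text \<open>By \<open>pdist_wedge_norm_bound\<close> the logarithm of the contraction factor is at
  most \<open>Z u v\<close>. Its mean is negative for long products, uniformly in the directions,
  and \<open>exp_moment_small\<close> turns this into a factor below \<open>1\<close> for the mean
  of a small power.\<close>

lemma contraction: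
  assumes d: "CARD('n) \<ge> 2"
    and growth: "\<And>\<epsilon>. \<epsilon> > 0 \<Longrightarrow> \<exists>C. \<forall>n v. v \<noteq> 0 \<longrightarrow> real n * (\<gamma> - \<epsilon>) - C \<le> (\<integral>x. ln_stretch (mprod n x) v \<partial>S)"
    and wedge: "(\<lambda>n. (\<integral>x. ln (wedge_norm (mprod n x)) \<partial>S) / real n) \<longlonglongrightarrow> \<gamma>'"
    and gap: "\<gamma>' < 2 * \<gamma>"
  obtains m \<alpha> r where "m \<ge> 1" "0 < \<alpha>" "\<alpha> \<le> 1" "0 < r" "r < 1"
    "\<And>u v. u \<noteq> 0 \<Longrightarrow> v \<noteq> 0 \<Longrightarrow> moment m \<alpha> u v \<le> r ^ m * pdist u v powr \<alpha>"
proof -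
  \<comment> \<open>A quarter of the gap: one \<open>\<epsilon>\<close> is lost for
    \<open>wedge_norm\<close> and two for the two vectors, so the rate of \<open>Z\<close> is at
    most \<open>- \<epsilon>\<close>. The threshold for \<open>m\<close> then also absorbs
    \<open>2 * C\<close> and brings the mean below \<open>- 1\<close>.\<close>
  define \<epsilon> where "\<epsilon> = (2 * \<gamma> - \<gamma>') / 4"
  have \<epsilon>: "\<epsilon> > 0" using gap by (simp add: \<epsilon>_def)
  obtain C where C: "\<And>n v. v \<noteq> 0 \<Longrightarrow> real n * (\<gamma> - \<epsilon>) - C \<le> (\<integral>x. ln_stretch (mprod n x) v \<partial>S)"
    using growth[OF \<epsilon>] by blast
  have "eventually (\<lambda>n. (\<integral>x. ln (wedge_norm (mprod n x)) \<partial>S) / real n < \<gamma>' + \<epsilon>) sequentially"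
    using wedge \<epsilon> by (intro order_tendstoD) auto
  moreover have "eventually (\<lambda>n. n \<ge> max 1 (nat \<lceil>(1 + 2 * C) / \<epsilon>\<rceil>)) sequentially" by (rule eventually_ge_at_top)
  ultimately have "eventually (\<lambda>n. (\<integral>x. ln (wedge_norm (mprod n x)) \<partial>S) / real n < \<gamma>' + \<epsilon> \<and>
      n \<ge> max 1 (nat \<lceil>(1 + 2 * C) / \<epsilon>\<rceil>)) sequentially" by eventually_elim blast
  then obtain m where m: "(\<integral>x. ln (wedge_norm (mprod m x)) \<partial>S) / real m < \<gamma>' + \<epsilon>" "m \<ge> 1"
      "m \<ge> nat \<lceil>(1 + 2 * C) / \<epsilon>\<rceil>"
    by (auto simp: eventually_sequentially)
  have "(1 + 2 * C) / \<epsilon> \<le> real m" using m(3) by linarith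
  then have mC: "1 + 2 * C \<le> real m * \<epsilon>" using \<epsilon> by (simp add: divide_le_eq)
  have mw: "(\<integral>x. ln (wedge_norm (mprod m x)) \<partial>S) \<le> real m * (\<gamma>' + \<epsilon>)"
    using m by (simp add: divide_less_eq mult.commute)
  define L where "L = ln (2 * (real CARD('n))\<^sup>2 * (real CARD('n) * \<kappa> ^ m)\<^sup>2)"
  define B where "B = L + 2 * (real m * ln \<kappa>)"
  define Z where "Z u v x = ln (wedge_norm (mprod m x)) - ln_stretch (mprod m x) u - ln_stretch (mprod m x) v" for u v :: "real^'n" and x
  have [measurable]: "Z u v \<in> borel_measurable S" for u v unfolding Z_def by measurable
  have ZB: "\<bar>Z u v x\<bar> \<le> B" if "u \<noteq> 0" "v \<noteq> 0" "x \<in> space S" for u v x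
    using ln_wedge_norm_bound(2)[OF d that(3), of m] ln_stretch_mprod_bound[OF that(3,1), of m] ln_stretch_mprod_bound[OF that(3,2), of m]
    unfolding Z_def B_def L_def by linarith
  obtain v0 :: "real^'n" where v0: "v0 \<noteq> 0" using zero_neq_one by blast
  obtain x0 where x0: "x0 \<in> space S" using P.not_empty by blast
  have "B \<ge> 0" using ZB[OF v0 v0 x0] by linarith
  have wi: "integrable S (\<lambda>x. ln (wedge_norm (mprod m x)))"
    by (rule integrable_S_bounded[where B = L]) (use ln_wedge_norm_bound(2)[OF d, of _ m] in \<open>auto simp: L_def\<close>)
  have ZE: "(\<integral>x. Z u v x \<partial>S) \<le> - 1" if uv: "u \<noteq> 0" "v \<noteq> 0" for u v
  proof -
    have "(\<integral>x. Z u v x \<partial>S) = (\<integral>x. ln (wedge_norm (mprod m x)) \<partial>S) - (\<integral>x. ln_stretch (mprod m x) u \<partial>S) - (\<integral>x. ln_stretch (mprod m x) v \<partial>S)"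
      unfolding Z_def using wi ln_stretch_mprod_integrable uv by simp
    also have "\<dots> \<le> real m * (\<gamma>' + \<epsilon>) - (real m * (\<gamma> - \<epsilon>) - C) - (real m * (\<gamma> - \<epsilon>) - C)"
    proof -
      have "a - b - c \<le> p - (q - C) - (q - C)" if "a \<le> p" "q - C \<le> b" "q - C \<le> c" for a b c p q :: real
        using that by linarith
      from this[OF mw C[OF uv(1), of m] C[OF uv(2), of m]] show ?thesis .
    qed
    also have "\<dots> = 2 * C - real m * \<epsilon>" by (simp add: \<epsilon>_def field_simps)
    finally show ?thesis using mC by linarith
  qed
  obtain \<theta> where \<theta>: "0 < \<theta>" "\<theta> \<le> 1"
    and small: "\<And>(M :: (nat \<Rightarrow> real^'n^'n) measure) Y. prob_space M \<Longrightarrow> Y \<in> borel_measurable M \<Longrightarrow>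
      (\<And>x. x \<in> space M \<Longrightarrow> \<bar>Y x\<bar> \<le> B) \<Longrightarrow> (\<integral>x. Y x \<partial>M) \<le> - 1 \<Longrightarrow>
      (\<integral>x. exp (\<theta> * Y x) \<partial>M) \<le> 1 - \<theta> * 1 / 2"
    using exp_moment_small[of 1 B] \<open>B \<ge> 0\<close> by (metis zero_less_one)
  define \<rho> where "\<rho> = 1 - \<theta> * 1 / 2"
  have \<rho>: "0 < \<rho>" "\<rho> < 1" using \<theta> by (auto simp: \<rho>_def)
  \<comment> \<open>The contraction over \<open>m\<close> steps is spread evenly, as a rate per
    step; the weights of the gauge need it in this form.\<close>
  define r where "r = root m \<rho>"
  have r: "0 < r" "r < 1" "r ^ m = \<rho>"
    using \<rho> m by (auto simp: r_def)
  show thesis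
  proof (rule that[OF m(2) \<theta> r(1,2)])
    fix u v :: "real^'n" assume u: "u \<noteq> 0" and v: "v \<noteq> 0"
    have ei: "integrable S (\<lambda>x. exp (\<theta> * Z u v x))"
    proof (rule integrable_S_bounded[where B = "exp (\<theta> * B)"])
      fix x assume "x \<in> space S"
      with ZB[OF u v] have "Z u v x \<le> B" by (simp add: abs_le_iff)
      then show "\<bar>exp (\<theta> * Z u v x)\<bar> \<le> exp (\<theta> * B)" using \<theta> by simp
    qed measurable
    have "moment m \<theta> u v \<le> (\<integral>x. exp (\<theta> * Z u v x) * pdist u v powr \<theta> \<partial>S)"
      unfolding moment_def
    proof (rule integral_mono')
      fix x assume x: "x \<in> space S"
      have "pdist (mprod m x *v u) (mprod m x *v v) \<le> exp (Z u v x) * pdist u v"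
        unfolding Z_def by (rule pdist_wedge_norm_bound[OF mprod_bilip[OF x] u v ln_wedge_norm_bound(1)[OF d x]])
      then have "pdist (mprod m x *v u) (mprod m x *v v) powr \<theta> \<le> (exp (Z u v x) * pdist u v) powr \<theta>"
        using \<theta> by (intro powr_mono2) (auto simp: pdist_nonneg)
      also have "\<dots> = exp (\<theta> * Z u v x) * pdist u v powr \<theta>"
        by (simp add: powr_mult pdist_nonneg exp_powr_real mult.commute)
      finally show "pdist (mprod m x *v u) (mprod m x *v v) powr \<theta> \<le> exp (\<theta> * Z u v x) * pdist u v powr \<theta>" .
    qed (use ei in auto)
    also have "\<dots> = (\<integral>x. exp (\<theta> * Z u v x) \<partial>S) * pdist u v powr \<theta>" by simp
    also have "\<dots> \<le> \<rho> * pdist u v powr \<theta>"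
      unfolding \<rho>_def using ZB[OF u v] ZE[OF u v] by (intro mult_right_mono small P.prob_space_axioms) auto
    finally show "moment m \<theta> u v \<le> r ^ m * pdist u v powr \<theta>" by (simp add: r)
  qed
qed

lemma measurable_moment:
  "(\<lambda>p. moment j \<alpha> (fst p) (snd p)) \<in> borel_measurable (borel \<Otimes>\<^sub>M borel)"
proof -
  have "(\<lambda>q. mprod j (snd q)) \<in> borel_measurable ((borel \<Otimes>\<^sub>M borel) \<Otimes>\<^sub>M S)"
    by (rule measurable_compose[OF measurable_snd measurable_mprod])
  then have "(\<lambda>(p, x). pdist (mprod j x *v fst p) (mprod j x *v snd p) powr \<alpha>) \<in> borel_measurable ((borel \<Otimes>\<^sub>M borel) \<Otimes>\<^sub>M S)"
    unfolding split_beta' by measurable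
  then show ?thesis
    unfolding moment_def by (rule P.borel_measurable_lebesgue_integral)
qed

lemma pdist_powr_integrable:
  assumes "0 < \<alpha>"
  shows "integrable S (\<lambda>x. pdist (mprod j x *v u) (mprod j x *v v) powr \<alpha>)"
  by (rule integrable_S_bounded[where B = "2 powr \<alpha>"])
    (use assms in \<open>auto intro!: powr_mono2 simp: pdist_le_2 pdist_nonneg\<close>)

lemma moment_nonneg: "0 \<le> moment j \<alpha> u v"
  unfolding moment_def by (intro Bochner_Integration.integral_nonneg) auto

lemma moment_0: "moment 0 \<alpha> u v = pdist u v powr \<alpha>"
  by (simp add: moment_def P.prob_space)

lemma moment_le:
  assumes \<alpha>: "0 < \<alpha>" and uv: "u \<noteq> 0" "v \<noteq> 0"
  shows "moment j \<alpha> u v \<le> ((real CARD('n))\<^sup>2 * (\<kappa> ^ j) ^ 4) powr \<alpha> * pdist u v powr \<alpha>"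
  unfolding moment_def
proof (rule P.integral_le_bound[OF pdist_powr_integrable[OF \<alpha>]])
  fix x assume x: "x \<in> space S"
  have "pdist (mprod j x *v u) (mprod j x *v v) powr \<alpha> \<le> ((real CARD('n))\<^sup>2 * (\<kappa> ^ j) ^ 4 * pdist u v) powr \<alpha>"
    using \<alpha> pdist_matrix_le[OF mprod_bilip[OF x] \<kappa>_power_ge_1 uv] by (intro powr_mono2) (auto simp: pdist_nonneg)
  also have "\<dots> = ((real CARD('n))\<^sup>2 * (\<kappa> ^ j) ^ 4) powr \<alpha> * pdist u v powr \<alpha>"
    by (simp add: powr_mult)
  finally show "pdist (mprod j x *v u) (mprod j x *v v) powr \<alpha> \<le>
      ((real CARD('n))\<^sup>2 * (\<kappa> ^ j) ^ 4) powr \<alpha> * pdist u v powr \<alpha>" .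
qed

lemma moment_Suc:
  assumes \<alpha>: "0 < \<alpha>"
  shows "(\<integral>g. moment j \<alpha> (g *v u) (g *v v) \<partial>M) = moment (Suc j) \<alpha> u v"
proof -
  have "moment (Suc j) \<alpha> u v = (\<integral>g. (\<integral>y. pdist (mprod (Suc j) (case_nat g y) *v u)
      (mprod (Suc j) (case_nat g y) *v v) powr \<alpha> \<partial>S) \<partial>M)"
    unfolding moment_def by (rule integral_case_nat[OF pdist_powr_integrable[OF \<alpha>]])
  also have "\<dots> = (\<integral>g. moment j \<alpha> (g *v u) (g *v v) \<partial>M)"
    by (simp only: mprod_case_nat moment_def matrix_vector_mul_assoc)
  finally show ?thesis by simp
qed

text \<open>Multiplying from the left by a \<open>j\<close>-step product stays within one class
  \<open>bilip\<close>, so the Lipschitz bound survives averaging and keeps the factor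
  \<open>pdist u v powr \<alpha>\<close>.\<close>

lemma moment_perturb:
  assumes \<alpha>: "0 < \<alpha>" "\<alpha> \<le> 1"
  shows "\<exists>C>0. \<forall>g\<in>bilip \<kappa>. \<forall>h\<in>bilip \<kappa>. \<forall>u v. u \<noteq> 0 \<longrightarrow> v \<noteq> 0 \<longrightarrow>
    moment j \<alpha> (g *v u) (g *v v) \<le> moment j \<alpha> (h *v u) (h *v v) + C * norm (g - h) powr \<alpha> * pdist u v powr \<alpha>"
proof -
  have k: "1 \<le> \<kappa> ^ j * \<kappa>" using \<kappa>_power_ge_1[of "Suc j"] by (simp add: mult.commute)
  obtain C where C: "0 < C" "\<And>g h u v. g \<in> bilip (\<kappa> ^ j * \<kappa>) \<Longrightarrow> h \<in> bilip (\<kappa> ^ j * \<kappa>) \<Longrightarrow> u \<noteq> 0 \<Longrightarrow> v \<noteq> 0 \<Longrightarrow>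
      \<bar>pdist (g *v u) (g *v v) - pdist (h *v u) (h *v v :: real^'n)\<bar> \<le> C * norm (g - h) * pdist u v"
    using pdist_lipschitz_matrix[OF k] by blast
  define D where "D = C * (real CARD('n) * \<kappa> ^ j)"
  have D: "0 < D" using C \<kappa>_ge_1 by (simp add: D_def)
  have "moment j \<alpha> (g *v u) (g *v v) \<le> moment j \<alpha> (h *v u) (h *v v) + D powr \<alpha> * norm (g - h) powr \<alpha> * pdist u v powr \<alpha>"
    if g: "g \<in> bilip \<kappa>" and h: "h \<in> bilip \<kappa>" and u: "u \<noteq> 0" and v: "v \<noteq> 0" for g h u v
  proof -
    let ?c = "D powr \<alpha> * norm (g - h) powr \<alpha> * pdist u v powr \<alpha>"
    have "moment j \<alpha> (g *v u) (g *v v) \<le> (\<integral>x. pdist (mprod j x *v (h *v u)) (mprod j x *v (h *v v)) powr \<alpha> + ?c \<partial>S)"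
      unfolding moment_def
    proof (intro integral_mono pdist_powr_integrable \<alpha> Bochner_Integration.integrable_add P.integrable_const)
      fix x assume x: "x \<in> space S"
      let ?A = "mprod j x"
      have bg: "?A ** g \<in> bilip (\<kappa> ^ j * \<kappa>)" "?A ** h \<in> bilip (\<kappa> ^ j * \<kappa>)"
        using \<kappa>_ge_1 by (auto intro!: bilip_mult mprod_bilip x g h)
      have "?A ** g - ?A ** h = ?A ** (g - h)"
        by (metis add_diff_cancel diff_add_cancel matrix_add_ldistrib)
      then have n: "norm (?A ** g - ?A ** h) \<le> real CARD('n) * \<kappa> ^ j * norm (g - h)"
        using order_trans[OF norm_matrix_mult_le mult_right_mono[OF bilip_norm_le[OF mprod_bilip[OF x, of j]] norm_ge_zero]] by metis
      let ?a = "pdist (?A *v (g *v u)) (?A *v (g *v v))" and ?b = "pdist (?A *v (h *v u)) (?A *v (h *v v))"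
      have "\<bar>?a - ?b\<bar> \<le> C * norm (?A ** g - ?A ** h) * pdist u v"
        using C(2)[OF bg u v] by (simp add: matrix_vector_mul_assoc)
      also have "\<dots> \<le> C * (real CARD('n) * \<kappa> ^ j * norm (g - h)) * pdist u v"
        using C(1) n by (intro mult_right_mono mult_left_mono) (auto simp: pdist_nonneg)
      also have "\<dots> = D * norm (g - h) * pdist u v" by (simp add: D_def mult.assoc)
      finally have le: "\<bar>?a - ?b\<bar> \<le> D * norm (g - h) * pdist u v" .
      have "?a powr \<alpha> - ?b powr \<alpha> \<le> \<bar>?a - ?b\<bar> powr \<alpha>"
        using powr_diff_le[OF pdist_nonneg pdist_nonneg \<alpha>, of "?A *v (g *v u)" "?A *v (g *v v)" "?A *v (h *v u)" "?A *v (h *v v)"]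
        by linarith
      also have "\<dots> \<le> (D * norm (g - h) * pdist u v) powr \<alpha>" using le \<alpha> by (intro powr_mono2) auto
      also have "\<dots> = ?c" using D by (simp add: powr_mult pdist_nonneg)
      finally show "?a powr \<alpha> \<le> ?b powr \<alpha> + ?c" by linarith
    qed
    also have "\<dots> = moment j \<alpha> (h *v u) (h *v v) + ?c"
      using pdist_powr_integrable[OF \<alpha>(1), of j "h *v u" "h *v v"] by (simp add: moment_def P.prob_space)
    finally show ?thesis .
  qed
  moreover have "0 < D powr \<alpha>" using D by simp
  ultimately show ?thesis by blast
qed

end

text \<open>
  Replacing the power of the projective distance by a gauge turns a contraction in mean after
  \<open>m\<close> steps into a contraction after a single step, which is stable under perturbations of the law.
\<close>

locale gauge =
  fixes R :: "real^'n::finite \<Rightarrow> real^'n \<Rightarrow> real" and \<alpha> \<kappa> C1 C2 :: real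
  assumes R_measurable: "(\<lambda>p. R (fst p) (snd p)) \<in> borel_measurable (borel \<Otimes>\<^sub>M borel)"
    and \<alpha>: "0 < \<alpha>" "\<alpha> \<le> 1" and k: "1 \<le> \<kappa>" and C1: "0 < C1" and C2: "0 < C2"
    and R_lower: "\<And>u v. u \<noteq> 0 \<Longrightarrow> v \<noteq> 0 \<Longrightarrow> pdist u v powr \<alpha> \<le> R u v"
    and R_upper: "\<And>u v. u \<noteq> 0 \<Longrightarrow> v \<noteq> 0 \<Longrightarrow> R u v \<le> C1 * pdist u v powr \<alpha>"
    and R_perturb: "\<And>g h u v. g \<in> bilip \<kappa> \<Longrightarrow> h \<in> bilip \<kappa> \<Longrightarrow> u \<noteq> 0 \<Longrightarrow> v \<noteq> 0 \<Longrightarrow>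
      R (g *v u) (g *v v) \<le> R (h *v u) (h *v v) + C2 * norm (g - h) powr \<alpha> * pdist u v powr \<alpha>"

text \<open>The gauge is the sum of the first \<open>m\<close> moments with weights
  \<open>1 / r ^ j\<close>, a standard adapted norm. One averaging step shifts the index of the
  moments by one.\<close>

lemma (in walk) gauge_exists:
  assumes m: "m \<ge> 1" and \<alpha>: "0 < \<alpha>" "\<alpha> \<le> 1" and r: "0 < r"
    and contr: "\<And>u v. u \<noteq> 0 \<Longrightarrow> v \<noteq> 0 \<Longrightarrow> moment m \<alpha> u v \<le> r ^ m * pdist u v powr \<alpha>"
  obtains R C1 C2 where "gauge R \<alpha> \<kappa> C1 C2"
    "\<And>u v. u \<noteq> 0 \<Longrightarrow> v \<noteq> 0 \<Longrightarrow> (\<integral>g. R (g *v u) (g *v v) \<partial>M) \<le> r * R u v"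
proof -
  define R where "R u v = (\<Sum>j<m. moment j \<alpha> u v / r ^ j)" for u v
  define D where "D j = ((real CARD('n))\<^sup>2 * (\<kappa> ^ j) ^ 4) powr \<alpha>" for j :: nat
  have "\<forall>j. \<exists>C>0. \<forall>g\<in>bilip \<kappa>. \<forall>h\<in>bilip \<kappa>. \<forall>u v. u \<noteq> 0 \<longrightarrow> v \<noteq> 0 \<longrightarrow>
    moment j \<alpha> (g *v u) (g *v v) \<le> moment j \<alpha> (h *v u) (h *v v) + C * norm (g - h) powr \<alpha> * pdist u v powr \<alpha>"
    using moment_perturb[OF \<alpha>] by blast
  then obtain E where E: "\<And>j. 0 < E j" "\<And>j g h u v. g \<in> bilip \<kappa> \<Longrightarrow> h \<in> bilip \<kappa> \<Longrightarrow> u \<noteq> 0 \<Longrightarrow> v \<noteq> 0 \<Longrightarrow>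
    moment j \<alpha> (g *v u) (g *v v) \<le> moment j \<alpha> (h *v u) (h *v v) + E j * norm (g - h) powr \<alpha> * pdist u v powr \<alpha>"
    by metis
  have "0 \<in> {..<m}" using m by simp
  have "gauge R \<alpha> \<kappa> (\<Sum>j<m. D j / r ^ j) (\<Sum>j<m. E j / r ^ j)"
  proof
    show "(\<lambda>p. R (fst p) (snd p)) \<in> borel_measurable (borel \<Otimes>\<^sub>M borel)"
      unfolding R_def by (intro borel_measurable_sum borel_measurable_divide measurable_moment borel_measurable_const)
    show "0 < (\<Sum>j<m. D j / r ^ j)"
      using m r \<kappa>_ge_1 by (intro sum_pos) (auto simp: D_def lessThan_empty_iff)
    show "0 < (\<Sum>j<m. E j / r ^ j)"
      using m r E(1) by (intro sum_pos) (auto simp: lessThan_empty_iff)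
    fix u v :: "real^'n" assume u: "u \<noteq> 0" and v: "v \<noteq> 0"
    have "moment 0 \<alpha> u v / r ^ 0 \<le> R u v"
      unfolding R_def using m r moment_nonneg by (intro member_le_sum) auto
    then show "pdist u v powr \<alpha> \<le> R u v" by (simp add: moment_0)
    have "R u v \<le> (\<Sum>j<m. D j * pdist u v powr \<alpha> / r ^ j)"
      unfolding R_def D_def using r moment_le[OF \<alpha>(1) u v] by (intro sum_mono divide_right_mono) auto
    then show "R u v \<le> (\<Sum>j<m. D j / r ^ j) * pdist u v powr \<alpha>" by (simp add: sum_distrib_right)
    fix g h :: "real^'n^'n" assume g: "g \<in> bilip \<kappa>" and h: "h \<in> bilip \<kappa>"
    have "R (g *v u) (g *v v) \<le>
        (\<Sum>j<m. (moment j \<alpha> (h *v u) (h *v v) + E j * norm (g - h) powr \<alpha> * pdist u v powr \<alpha>) / r ^ j)"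
      unfolding R_def using r E(2)[OF g h u v] by (intro sum_mono divide_right_mono) auto
    also have "\<dots> = R (h *v u) (h *v v) + (\<Sum>j<m. E j / r ^ j) * norm (g - h) powr \<alpha> * pdist u v powr \<alpha>"
      by (simp add: R_def add_divide_distrib sum.distrib sum_distrib_right mult.assoc)
    finally show "R (g *v u) (g *v v) \<le>
        R (h *v u) (h *v v) + (\<Sum>j<m. E j / r ^ j) * norm (g - h) powr \<alpha> * pdist u v powr \<alpha>" .
  qed (use \<alpha> \<kappa>_ge_1 in auto)
  moreover have "(\<integral>g. R (g *v u) (g *v v) \<partial>M) \<le> r * R u v" if uv: "u \<noteq> 0" "v \<noteq> 0" for u v
  proof -
    have mi: "integrable M (\<lambda>g. moment j \<alpha> (g *v u) (g *v v))" for j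
    proof (rule prob_space.integrable_bounded[where B = "2 powr \<alpha>"])
      show "prob_space M" by unfold_locales
      have "(\<lambda>g. (g *v u, g *v v)) \<in> measurable M (borel \<Otimes>\<^sub>M borel)" by measurable
      from measurable_compose[OF this measurable_moment[of j \<alpha>]]
      show "(\<lambda>g. moment j \<alpha> (g *v u) (g *v v)) \<in> borel_measurable M" by simp
      fix g
      have "moment j \<alpha> (g *v u) (g *v v) \<le> 2 powr \<alpha>"
        unfolding moment_def using \<alpha>
        by (intro P.integral_le_bound pdist_powr_integrable) (auto intro!: powr_mono2 simp: pdist_le_2 pdist_nonneg)
      then show "\<bar>moment j \<alpha> (g *v u) (g *v v)\<bar> \<le> 2 powr \<alpha>" using moment_nonneg by simp
    qed
    have "(\<integral>g. R (g *v u) (g *v v) \<partial>M) = (\<Sum>j<m. moment (Suc j) \<alpha> u v / r ^ j)"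
      unfolding R_def using mi by (simp add: moment_Suc[OF \<alpha>(1)])
    also have "\<dots> = r * (\<Sum>j<m. moment (Suc j) \<alpha> u v / r ^ Suc j)"
      using r by (simp add: sum_distrib_left)
    \<comment> \<open>After the shift the term \<open>0\<close> has left and the term
      \<open>m\<close> has entered; the contraction over \<open>m\<close> steps says that the
      entering term is at most the leaving one.\<close>
    also have "(\<Sum>j<m. moment (Suc j) \<alpha> u v / r ^ Suc j) = R u v - moment 0 \<alpha> u v + moment m \<alpha> u v / r ^ m"
      unfolding R_def using sum.lessThan_Suc_shift[of "\<lambda>j. moment j \<alpha> u v / r ^ j" m]
      by simp
    also have "\<dots> \<le> R u v"
      using contr[OF uv] r by (simp add: moment_0 divide_le_eq mult.commute)
    finally show ?thesis using r by (simp add: mult_left_mono)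
  qed
  ultimately show thesis using that by blast
qed

section \<open>Perturbation of the law\<close>

lemma couplingsD:
  assumes \<pi>: "\<pi> \<in> couplings \<mu> \<nu>"
  shows "prob_space \<pi>" "space \<pi> = space \<mu> \<times> space \<nu>" "sets \<pi> = sets (\<mu> \<Otimes>\<^sub>M \<nu>)"
    "fst \<in> measurable \<pi> \<mu>" "snd \<in> measurable \<pi> \<nu>"
    "distr \<pi> \<mu> fst = \<mu>" "distr \<pi> \<nu> snd = \<nu>"
proof -
  show s: "sets \<pi> = sets (\<mu> \<Otimes>\<^sub>M \<nu>)" and "prob_space \<pi>" "distr \<pi> \<mu> fst = \<mu>" "distr \<pi> \<nu> snd = \<nu>"
    using \<pi> by (auto simp: couplings_def)
  show "space \<pi> = space \<mu> \<times> space \<nu>"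
    using sets_eq_imp_space_eq[OF s] by (simp add: space_pair_measure)
  show "fst \<in> measurable \<pi> \<mu>" "snd \<in> measurable \<pi> \<nu>"
    by (simp_all cong: measurable_cong_sets[OF s refl])
qed

lemma couplings_integral:
  fixes f :: "real^'n::finite^'n \<Rightarrow> real"
  assumes \<pi>: "\<pi> \<in> couplings \<mu> \<nu>"
  shows "f \<in> borel_measurable \<mu> \<Longrightarrow> (\<integral>p. f (fst p) \<partial>\<pi>) = (\<integral>g. f g \<partial>\<mu>)"
    and "f \<in> borel_measurable \<nu> \<Longrightarrow> (\<integral>p. f (snd p) \<partial>\<pi>) = (\<integral>g. f g \<partial>\<nu>)"
  using couplingsD[OF \<pi>] integral_distr[of fst \<pi> \<mu> f] integral_distr[of snd \<pi> \<nu> f] by simp_all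

definition mean_log :: "(real^'n::finite^'n) measure \<Rightarrow> nat \<Rightarrow> real^'n \<Rightarrow> real"
  where "mean_log \<nu> n v = (\<integral>x. ln_stretch (mprod n x) v \<partial>(Pi\<^sub>M (UNIV :: nat set) (\<lambda>_. \<nu>)))"

text \<open>The absolute value is taken inside the integral, since \<open>mean_log_tendsto\<close>
  compares different basis vectors sequence by sequence.\<close>

definition log_gap :: "(real^'n::finite^'n) measure \<Rightarrow> nat \<Rightarrow> real^'n \<Rightarrow> real^'n \<Rightarrow> real"
  where "log_gap \<nu> n u v = (\<integral>x. \<bar>ln_stretch (mprod n x) u - ln_stretch (mprod n x) v\<bar> \<partial>(Pi\<^sub>M (UNIV :: nat set) (\<lambda>_. \<nu>)))"

context walk
begin

lemma prob_space_M: "prob_space M"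
  by unfold_locales

lemma M_nonzero: "g \<in> space M \<Longrightarrow> v \<noteq> 0 \<Longrightarrow> g *v v \<noteq> 0"
  using space_bilip bilip_nonzero by blast

lemma mean_log_bound: "v \<noteq> 0 \<Longrightarrow> \<bar>mean_log M n v\<bar> \<le> real n * ln \<kappa>"
proof -
  assume v: "v \<noteq> 0"
  have "mean_log M n v \<le> real n * ln \<kappa>"
    unfolding mean_log_def using ln_stretch_mprod_bound[OF _ v, of _ n]
    by (intro P.integral_le_bound ln_stretch_mprod_integrable v) (auto simp: abs_le_iff)
  moreover have "- (real n * ln \<kappa>) \<le> mean_log M n v"
    unfolding mean_log_def using ln_stretch_mprod_bound[OF _ v, of _ n]
    by (intro P.integral_ge_bound ln_stretch_mprod_integrable v) (force simp: abs_le_iff)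
  ultimately show ?thesis by linarith
qed

lemma measurable_mean_log: "mean_log M n \<in> borel_measurable borel"
proof -
  have "(\<lambda>q. mprod n (snd q)) \<in> borel_measurable (borel \<Otimes>\<^sub>M S)"
    by (rule measurable_compose[OF measurable_snd measurable_mprod])
  then have "(\<lambda>(v, x). ln_stretch (mprod n x) v) \<in> borel_measurable (borel \<Otimes>\<^sub>M S)"
    unfolding split_beta' by measurable
  then have "(\<lambda>v. \<integral>x. ln_stretch (mprod n x) v \<partial>S) \<in> borel_measurable borel"
    by (rule P.borel_measurable_lebesgue_integral)
  then show ?thesis unfolding mean_log_def .
qed

lemma mean_log_Suc:
  assumes v: "v \<noteq> 0"
  shows "mean_log M (Suc n) v = (\<integral>g. ln_stretch g v + mean_log M n (g *v v) \<partial>M)"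
proof -
  have "mean_log M (Suc n) v = (\<integral>g. (\<integral>y. ln_stretch (mprod (Suc n) (case_nat g y)) v \<partial>S) \<partial>M)"
    unfolding mean_log_def by (rule integral_case_nat[OF ln_stretch_mprod_integrable[OF v]])
  also have "\<dots> = (\<integral>g. ln_stretch g v + mean_log M n (g *v v) \<partial>M)"
  proof (rule Bochner_Integration.integral_cong[OF refl])
    fix g assume g: "g \<in> space M"
    have "(\<integral>y. ln_stretch (mprod (Suc n) (case_nat g y)) v \<partial>S) = (\<integral>y. ln_stretch (mprod n y) (g *v v) + ln_stretch g v \<partial>S)"
      unfolding mprod_case_nat
      by (intro Bochner_Integration.integral_cong refl ln_stretch_mult M_nonzero[OF g v] mprod_nonzero v)
    then show "(\<integral>y. ln_stretch (mprod (Suc n) (case_nat g y)) v \<partial>S) = ln_stretch g v + mean_log M n (g *v v)"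
      using ln_stretch_mprod_integrable[OF M_nonzero[OF g v]] by (simp add: mean_log_def P.prob_space)
  qed
  finally show ?thesis .
qed

lemma log_gap_integrable:
  "u \<noteq> 0 \<Longrightarrow> v \<noteq> 0 \<Longrightarrow> integrable S (\<lambda>x. \<bar>ln_stretch (mprod n x) u - ln_stretch (mprod n x) v\<bar>)"
  by (intro integrable_abs Bochner_Integration.integrable_diff ln_stretch_mprod_integrable)

lemma mean_log_diff_le: "u \<noteq> 0 \<Longrightarrow> v \<noteq> 0 \<Longrightarrow> \<bar>mean_log M n u - mean_log M n v\<bar> \<le> log_gap M n u v"
  using integral_abs_bound[of S "\<lambda>x. ln_stretch (mprod n x) u - ln_stretch (mprod n x) v"] ln_stretch_mprod_integrable
  by (simp add: mean_log_def log_gap_def)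

text \<open>Sequence by sequence, \<open>ln (frame_norm Basis)\<close> lies above the logarithmic
  growth of \<open>v\<close> and exceeds it by at most a constant plus the gaps between
  \<open>v\<close> and the basis vectors. These have bounded means, so both means have the same
  rate.\<close>

lemma mean_log_tendsto:
  assumes gap: "\<And>n u v. u \<noteq> 0 \<Longrightarrow> v \<noteq> 0 \<Longrightarrow> log_gap M n u v \<le> L" and v: "v \<noteq> 0"
    and frame: "(\<lambda>n. (\<integral>x. ln (frame_norm Basis (mprod n x)) \<partial>S) / real n) \<longlonglongrightarrow> \<gamma>"
  shows "(\<lambda>n. mean_log M n v / real n) \<longlonglongrightarrow> \<gamma>"
proof (rule tendsto_divide_const_add[OF frame])
  fix n
  let ?B = "Basis :: (real^'n) set"
  let ?D = "\<lambda>x b. \<bar>ln_stretch (mprod n x) b - ln_stretch (mprod n x) v\<bar>"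
  have b0: "b \<noteq> 0" if "b \<in> ?B" for b using that by (rule nonzero_Basis)
  have pt: "ln_stretch (mprod n x) v \<le> ln (frame_norm ?B (mprod n x))"
    "ln (frame_norm ?B (mprod n x)) \<le> ln (real DIM(real^'n)) + ln_stretch (mprod n x) v + (\<Sum>b\<in>?B. ?D x b)"
    if x: "x \<in> space S" for x
  proof -
    let ?F = "frame_norm ?B (mprod n x)"
    let ?T = "ln_stretch (mprod n x) v + (\<Sum>b\<in>?B. ?D x b)"
    have pos: "norm (mprod n x *v w) / norm w > 0" if "w \<noteq> 0" for w
      using mprod_nonzero[OF x that] that by simp
    have "norm (mprod n x *v v) \<le> ?F * norm v" by (rule frame_norm_bound[OF orthonormal_Basis]) simp
    then have le: "norm (mprod n x *v v) / norm v \<le> ?F" using v by (simp add: divide_le_eq)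
    then show "ln_stretch (mprod n x) v \<le> ln ?F" unfolding ln_stretch_def using pos[OF v] by (intro ln_mono)
    have "?F \<le> (\<Sum>b\<in>?B. exp ?T)"
      unfolding frame_norm_def
    proof (rule sum_mono)
      fix b assume b: "b \<in> ?B"
      have "norm (mprod n x *v b) = exp (ln_stretch (mprod n x) b)"
        using pos[OF b0[OF b]] b by (simp add: ln_stretch_def)
      also have "ln_stretch (mprod n x) b \<le> ln_stretch (mprod n x) v + ?D x b" by linarith
      also have "?D x b \<le> (\<Sum>b\<in>?B. ?D x b)" using b by (intro member_le_sum) auto
      finally show "norm (mprod n x *v b) \<le> exp ?T" by simp
    qed
    then have "?F \<le> real DIM(real^'n) * exp ?T" by simp
    moreover have "0 < ?F" using le pos[OF v] by linarith
    ultimately have "ln ?F \<le> ln (real DIM(real^'n) * exp ?T)" by (intro ln_mono)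
    also have "\<dots> = ln (real DIM(real^'n)) + ?T"
      by (subst ln_mult_pos) (auto simp: DIM_positive)
    finally show "ln ?F \<le> ln (real DIM(real^'n)) + ln_stretch (mprod n x) v + (\<Sum>b\<in>?B. ?D x b)" by simp
  qed
  have Di: "integrable S (\<lambda>x. ?D x b)" if "b \<in> ?B" for b using log_gap_integrable[OF b0[OF that] v] .
  have ri: "integrable S (\<lambda>x. ln (real DIM(real^'n)) + ln_stretch (mprod n x) v + (\<Sum>b\<in>?B. ?D x b))"
    using ln_stretch_mprod_integrable[OF v] Di
    by (intro Bochner_Integration.integrable_add Bochner_Integration.integrable_sum P.integrable_const) auto
  have Fi: "integrable S (\<lambda>x. ln (frame_norm ?B (mprod n x)))"
  proof (rule Bochner_Integration.integrable_bound)
    show "integrable S (\<lambda>x. \<bar>ln (real DIM(real^'n)) + ln_stretch (mprod n x) v + (\<Sum>b\<in>?B. ?D x b)\<bar> + \<bar>ln_stretch (mprod n x) v\<bar>)"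
      by (rule Bochner_Integration.integrable_add[OF integrable_abs[OF ri] integrable_abs[OF ln_stretch_mprod_integrable[OF v]]])
    show "AE x in S. norm (ln (frame_norm ?B (mprod n x))) \<le>
        norm (\<bar>ln (real DIM(real^'n)) + ln_stretch (mprod n x) v + (\<Sum>b\<in>?B. ?D x b)\<bar> + \<bar>ln_stretch (mprod n x) v\<bar>)"
    proof (rule AE_I2)
      fix x assume x: "x \<in> space S"
      show "norm (ln (frame_norm ?B (mprod n x))) \<le>
        norm (\<bar>ln (real DIM(real^'n)) + ln_stretch (mprod n x) v + (\<Sum>b\<in>?B. ?D x b)\<bar> + \<bar>ln_stretch (mprod n x) v\<bar>)"
        using pt[OF x] unfolding real_norm_def by linarith
    qed
  qed measurable
  have lo: "mean_log M n v \<le> (\<integral>x. ln (frame_norm ?B (mprod n x)) \<partial>S)"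
    unfolding mean_log_def using pt by (intro integral_mono ln_stretch_mprod_integrable v Fi) auto
  have "(\<integral>x. ln (frame_norm ?B (mprod n x)) \<partial>S) \<le>
      (\<integral>x. ln (real DIM(real^'n)) + ln_stretch (mprod n x) v + (\<Sum>b\<in>?B. ?D x b) \<partial>S)"
    using pt by (intro integral_mono Fi ri) auto
  also have "\<dots> = ln (real DIM(real^'n)) + mean_log M n v + (\<Sum>b\<in>?B. log_gap M n b v)"
    using ln_stretch_mprod_integrable[OF v] Di by (simp add: mean_log_def log_gap_def P.prob_space)
  also have "(\<Sum>b\<in>?B. log_gap M n b v) \<le> (\<Sum>b\<in>?B. L)"
    by (intro sum_mono gap b0 v)
  finally have up: "(\<integral>x. ln (frame_norm ?B (mprod n x)) \<partial>S) \<le> ln (real DIM(real^'n)) + mean_log M n v + (\<Sum>b\<in>?B. L)"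
    by simp
  show "\<bar>mean_log M n v - (\<integral>x. ln (frame_norm ?B (mprod n x)) \<partial>S)\<bar> \<le> ln (real DIM(real^'n)) + (\<Sum>b\<in>?B. L)"
    using lo up by linarith
qed

end

section \<open>Consequences of a contraction of the gauge in one step\<close>

context gauge
begin

lemma R_nonneg: "u \<noteq> 0 \<Longrightarrow> v \<noteq> 0 \<Longrightarrow> 0 \<le> R u v"
  using R_lower[of u v] by (rule order_trans[rotated]) auto

lemma R_le: "u \<noteq> 0 \<Longrightarrow> v \<noteq> 0 \<Longrightarrow> R u v \<le> C1 * 2 powr \<alpha>"
  using R_upper[of u v] C1 powr_mono2[of \<alpha> "pdist u v" 2] \<alpha>
  by (meson pdist_le_2 pdist_nonneg less_imp_le mult_left_mono order_trans)

lemma R_integrable: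
  assumes "walk \<nu> \<kappa>" "u \<noteq> 0" "v \<noteq> 0"
  shows "integrable \<nu> (\<lambda>g. R (g *v u) (g *v v))"
proof -
  interpret W: walk \<nu> \<kappa> by fact
  show ?thesis
  proof (rule prob_space.integrable_bounded[OF W.prob_space_M, where B = "C1 * 2 powr \<alpha>"])
    have "(\<lambda>g. (g *v u, g *v v)) \<in> measurable \<nu> (borel \<Otimes>\<^sub>M borel)" by measurable
    from measurable_compose[OF this R_measurable]
    show "(\<lambda>g. R (g *v u) (g *v v)) \<in> borel_measurable \<nu>" by simp
    fix g assume "g \<in> space \<nu>"
    then show "\<bar>R (g *v u) (g *v v)\<bar> \<le> C1 * 2 powr \<alpha>"
      using W.M_nonzero assms R_nonneg R_le by (simp add: abs_le_iff)
  qed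
qed

lemma pdist_le_R: "u \<noteq> 0 \<Longrightarrow> v \<noteq> 0 \<Longrightarrow> pdist u v \<le> 2 * R u v"
proof -
  assume uv: "u \<noteq> 0" "v \<noteq> 0"
  have "pdist u v \<le> 2 * pdist u v powr \<alpha>"
  proof (cases "pdist u v = 0")
    case False
    then have pos: "pdist u v > 0" using pdist_nonneg[of u v] by linarith
    have "pdist u v powr (1 - \<alpha>) \<le> 2 powr (1 - \<alpha>)" using \<alpha> pos pdist_le_2 by (intro powr_mono2) auto
    also have "2 powr (1 - \<alpha>) \<le> (2::real) powr 1" using \<alpha> by (intro powr_mono) auto
    finally have "pdist u v powr (1 - \<alpha>) \<le> 2" by simp
    then have "pdist u v powr (1 - \<alpha>) * pdist u v powr \<alpha> \<le> 2 * pdist u v powr \<alpha>" by (rule mult_right_mono) simp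
    then show ?thesis using pos by (simp flip: powr_add)
  qed simp
  also have "\<dots> \<le> 2 * R u v" using R_lower[OF uv] by simp
  finally show "pdist u v \<le> 2 * R u v" .
qed

text \<open>The first factor contributes at most a multiple of the present distance, and the gauge
  of the new pair of directions has contracted in mean. The contributions form a geometric series,
  which is why the bound does not depend on \<open>n\<close>.\<close>

lemma log_gap_bound:
  assumes W: "walk \<nu> \<kappa>" and r: "0 \<le> r" "r < 1"
    and contr: "\<And>u v. u \<noteq> 0 \<Longrightarrow> v \<noteq> 0 \<Longrightarrow> (\<integral>g. R (g *v u) (g *v v) \<partial>\<nu>) \<le> r * R u v"
    and uv: "u \<noteq> 0" "v \<noteq> 0"
  shows "log_gap \<nu> n u v \<le> 2 * \<kappa>\<^sup>2 / (1 - r) * R u v"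
  using uv
proof (induction n arbitrary: u v)
  interpret W: walk \<nu> \<kappa> by fact
  \<comment> \<open>The fixed point of \<open>B \<mapsto> 2 * \<kappa>\<^sup>2 + B * r\<close>, so
    that the induction reproduces the same constant.\<close>
  define B where "B = 2 * \<kappa>\<^sup>2 / (1 - r)"
  have B: "0 \<le> B" "2 * \<kappa>\<^sup>2 + B * r = B" using r by (auto simp: B_def field_simps)
  {
    case 0
    have "log_gap \<nu> 0 u v = 0" using 0 by (simp add: log_gap_def ln_stretch_def)
    then show ?case using mult_nonneg_nonneg[OF B(1) R_nonneg[OF 0]] unfolding B_def by linarith
  next
    case (Suc n)
    note uv = Suc.prems
    let ?D = "\<lambda>g y. \<bar>ln_stretch (mprod (Suc n) (case_nat g y)) u - ln_stretch (mprod (Suc n) (case_nat g y)) v\<bar>"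
    have "log_gap \<nu> (Suc n) u v = (\<integral>g. (\<integral>y. ?D g y \<partial>W.S) \<partial>\<nu>)"
      unfolding log_gap_def by (rule W.integral_case_nat[OF W.log_gap_integrable[OF uv]])
    also have "\<dots> \<le> (\<integral>g. 2 * \<kappa>\<^sup>2 * R u v + B * R (g *v u) (g *v v) \<partial>\<nu>)"
    proof (rule integral_mono')
      show "integrable \<nu> (\<lambda>g. 2 * \<kappa>\<^sup>2 * R u v + B * R (g *v u) (g *v v))"
        using R_integrable[OF W uv] by simp
      fix g assume g: "g \<in> space \<nu>"
      note gn = W.M_nonzero[OF g uv(1)] W.M_nonzero[OF g uv(2)]
      show "0 \<le> 2 * \<kappa>\<^sup>2 * R u v + B * R (g *v u) (g *v v)"
        using B by (intro add_nonneg_nonneg mult_nonneg_nonneg R_nonneg uv gn) auto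
      have "(\<integral>y. ?D g y \<partial>W.S) \<le>
          (\<integral>y. \<bar>ln_stretch g u - ln_stretch g v\<bar> + \<bar>ln_stretch (mprod n y) (g *v u) - ln_stretch (mprod n y) (g *v v)\<bar> \<partial>W.S)"
      proof (rule integral_mono')
        fix y assume y: "y \<in> space W.S"
        have "ln_stretch (mprod n y ** g) u = ln_stretch (mprod n y) (g *v u) + ln_stretch g u" "ln_stretch (mprod n y ** g) v = ln_stretch (mprod n y) (g *v v) + ln_stretch g v"
          by (intro ln_stretch_mult gn W.mprod_nonzero y uv)+
        then show "?D g y \<le> \<bar>ln_stretch g u - ln_stretch g v\<bar> + \<bar>ln_stretch (mprod n y) (g *v u) - ln_stretch (mprod n y) (g *v v)\<bar>"
          unfolding mprod_case_nat by linarith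
      qed (use W.log_gap_integrable[OF gn] in auto)
      also have "\<dots> = \<bar>ln_stretch g u - ln_stretch g v\<bar> + log_gap \<nu> n (g *v u) (g *v v)"
        using W.log_gap_integrable[OF gn] by (simp add: log_gap_def W.P.prob_space)
      also have "\<bar>ln_stretch g u - ln_stretch g v\<bar> \<le> \<kappa>\<^sup>2 * pdist u v"
        using g W.space_bilip by (intro ln_stretch_lipschitz k uv) auto
      also have "\<kappa>\<^sup>2 * pdist u v \<le> \<kappa>\<^sup>2 * (2 * R u v)" by (intro mult_left_mono pdist_le_R uv) auto
      also have "log_gap \<nu> n (g *v u) (g *v v) \<le> B * R (g *v u) (g *v v)"
        unfolding B_def by (rule Suc.IH[OF gn])
      finally show "(\<integral>y. ?D g y \<partial>W.S) \<le> 2 * \<kappa>\<^sup>2 * R u v + B * R (g *v u) (g *v v)" by simp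
    qed
    also have "\<dots> = 2 * \<kappa>\<^sup>2 * R u v + B * (\<integral>g. R (g *v u) (g *v v) \<partial>\<nu>)"
      using R_integrable[OF W uv] by (simp add: prob_space.prob_space[OF W.prob_space_M])
    also have "\<dots> \<le> 2 * \<kappa>\<^sup>2 * R u v + B * (r * R u v)"
      using contr[OF uv] B by (intro add_left_mono mult_left_mono) auto
    also have "\<dots> = (2 * \<kappa>\<^sup>2 + B * r) * R u v" by (simp add: algebra_simps)
    finally show ?case unfolding B(2) unfolding B_def .
  }
qed

text \<open>Estimates shared by the two perturbation results. The scale \<open>e\<close> of the
  affine majorant is left free; it is matched to the cost \<open>w\<close> in the final
  theorem.\<close>

lemma dist_powr_integral:
  fixes \<nu> \<mu> :: "(real^'n^'n) measure"
  assumes \<nu>: "walk \<nu> \<kappa>" "walk \<mu> \<kappa>" and \<pi>: "\<pi> \<in> couplings \<nu> \<mu>"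
    and w: "(\<integral>p. norm (fst p - snd p) \<partial>\<pi>) \<le> w" and e: "0 < e"
  shows "integrable \<pi> (\<lambda>p. norm (fst p - snd p))"
    "integrable \<pi> (\<lambda>p. e powr \<alpha> + e powr (\<alpha> - 1) * norm (fst p - snd p))"
    "(\<integral>p. e powr \<alpha> + e powr (\<alpha> - 1) * norm (fst p - snd p) \<partial>\<pi>) \<le> e powr \<alpha> + e powr (\<alpha> - 1) * w"
    "p \<in> space \<pi> \<Longrightarrow> norm (fst p - snd p) powr \<alpha> \<le> e powr \<alpha> + e powr (\<alpha> - 1) * norm (fst p - snd p)"
    "p \<in> space \<pi> \<Longrightarrow> norm (fst p - snd p) \<le> 2 * (real CARD('n) * \<kappa>)"
proof -
  interpret N: walk \<nu> \<kappa> by fact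
  interpret M: walk \<mu> \<kappa> by fact
  note D = couplingsD[OF \<pi>]
  interpret pi: prob_space \<pi> by (rule D)
  have [measurable]: "fst \<in> borel_measurable \<pi>" "snd \<in> borel_measurable \<pi>"
    using measurable_compose[OF D(4) N.measurable_M_borel] measurable_compose[OF D(5) M.measurable_M_borel] by simp_all
  have b: "norm (fst p - snd p) \<le> 2 * (real CARD('n) * \<kappa>)" if "p \<in> space \<pi>" for p
  proof -
    have "norm (fst p) \<le> real CARD('n) * \<kappa>" "norm (snd p) \<le> real CARD('n) * \<kappa>"
      using that N.space_bilip M.space_bilip unfolding D(2) by (auto intro!: bilip_norm_le)
    then show ?thesis using norm_triangle_ineq4[of "fst p" "snd p"] by linarith
  qed
  then show "p \<in> space \<pi> \<Longrightarrow> norm (fst p - snd p) \<le> 2 * (real CARD('n) * \<kappa>)" .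
  show i: "integrable \<pi> (\<lambda>p. norm (fst p - snd p))"
    using b by (intro pi.integrable_bounded[where B = "2 * (real CARD('n) * \<kappa>)"]) auto
  then show "integrable \<pi> (\<lambda>p. e powr \<alpha> + e powr (\<alpha> - 1) * norm (fst p - snd p))" by simp
  show "(\<integral>p. e powr \<alpha> + e powr (\<alpha> - 1) * norm (fst p - snd p) \<partial>\<pi>) \<le> e powr \<alpha> + e powr (\<alpha> - 1) * w"
    using i w by (simp add: pi.prob_space mult_left_mono)
  show "norm (fst p - snd p) powr \<alpha> \<le> e powr \<alpha> + e powr (\<alpha> - 1) * norm (fst p - snd p)"
    by (intro powr_le_linear \<alpha> e) simp
qed

text \<open>The error in \<open>R_perturb\<close> is a multiple of
  \<open>pdist u v powr \<alpha>\<close>, hence of \<open>R u v\<close>, so moving the law only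
  worsens the rate.\<close>

lemma contraction_perturb:
  assumes \<nu>: "walk \<nu> \<kappa>" "walk \<mu> \<kappa>" and \<pi>: "\<pi> \<in> couplings \<nu> \<mu>"
    and w: "(\<integral>p. norm (fst p - snd p) \<partial>\<pi>) \<le> w" and e: "0 < e"
    and contr: "(\<integral>g. R (g *v u) (g *v v) \<partial>\<mu>) \<le> r * R u v"
    and uv: "u \<noteq> 0" "v \<noteq> 0"
  shows "(\<integral>g. R (g *v u) (g *v v) \<partial>\<nu>) \<le> (r + C2 * (e powr \<alpha> + e powr (\<alpha> - 1) * w)) * R u v"
proof -
  interpret N: walk \<nu> \<kappa> by fact
  interpret M: walk \<mu> \<kappa> by fact
  note D = couplingsD[OF \<pi>]
  note I = dist_powr_integral[OF \<nu> \<pi> w e]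
  have iN: "integrable \<pi> (\<lambda>p. R (fst p *v u) (fst p *v v))"
    using R_integrable[OF \<nu>(1) uv] by (intro integrable_distr[OF D(4)]) (simp add: D)
  have iM: "integrable \<pi> (\<lambda>p. R (snd p *v u) (snd p *v v))"
    using R_integrable[OF \<nu>(2) uv] by (intro integrable_distr[OF D(5)]) (simp add: D)
  let ?q = "\<lambda>p. e powr \<alpha> + e powr (\<alpha> - 1) * norm (fst p - snd p)"
  have "(\<integral>g. R (g *v u) (g *v v) \<partial>\<nu>) = (\<integral>p. R (fst p *v u) (fst p *v v) \<partial>\<pi>)"
    using couplings_integral(1)[OF \<pi> borel_measurable_integrable[OF R_integrable[OF \<nu>(1) uv]]] by simp
  also have "\<dots> \<le> (\<integral>p. R (snd p *v u) (snd p *v v) + C2 * pdist u v powr \<alpha> * ?q p \<partial>\<pi>)"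
  proof (rule integral_mono)
    show "integrable \<pi> (\<lambda>p. R (snd p *v u) (snd p *v v) + C2 * pdist u v powr \<alpha> * ?q p)"
      by (intro Bochner_Integration.integrable_add iM integrable_mult_right I(2))
    fix p assume p: "p \<in> space \<pi>"
    then have "fst p \<in> bilip \<kappa>" "snd p \<in> bilip \<kappa>" using N.space_bilip M.space_bilip unfolding D(2) by auto
    then have "R (fst p *v u) (fst p *v v) \<le>
        R (snd p *v u) (snd p *v v) + C2 * norm (fst p - snd p) powr \<alpha> * pdist u v powr \<alpha>"
      by (intro R_perturb uv)
    also have "C2 * norm (fst p - snd p) powr \<alpha> * pdist u v powr \<alpha> = C2 * pdist u v powr \<alpha> * norm (fst p - snd p) powr \<alpha>"
      by simp
    also have "\<dots> \<le> C2 * pdist u v powr \<alpha> * ?q p"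
      using C2 by (intro mult_left_mono I(4) p) auto
    finally show "R (fst p *v u) (fst p *v v) \<le> R (snd p *v u) (snd p *v v) + C2 * pdist u v powr \<alpha> * ?q p" by simp
  qed (rule iN)
  also have "\<dots> = (\<integral>p. R (snd p *v u) (snd p *v v) \<partial>\<pi>) + C2 * pdist u v powr \<alpha> * (\<integral>p. ?q p \<partial>\<pi>)"
    using iM I(2) by simp
  also have "(\<integral>p. R (snd p *v u) (snd p *v v) \<partial>\<pi>) = (\<integral>g. R (g *v u) (g *v v) \<partial>\<mu>)"
    using couplings_integral(2)[OF \<pi> borel_measurable_integrable[OF R_integrable[OF \<nu>(2) uv]]] by simp
  also have "\<dots> \<le> r * R u v" by (rule contr)
  also have "C2 * pdist u v powr \<alpha> * (\<integral>p. ?q p \<partial>\<pi>) \<le> C2 * pdist u v powr \<alpha> * (e powr \<alpha> + e powr (\<alpha> - 1) * w)"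
    using C2 by (intro mult_left_mono I(3)) auto
  also have "C2 * pdist u v powr \<alpha> * (e powr \<alpha> + e powr (\<alpha> - 1) * w) \<le> C2 * R u v * (e powr \<alpha> + e powr (\<alpha> - 1) * w)"
  proof (intro mult_right_mono mult_left_mono R_lower uv)
    have "0 \<le> (\<integral>p. norm (fst p - snd p) \<partial>\<pi>)" by (intro Bochner_Integration.integral_nonneg) auto
    then have "0 \<le> w" using w by (rule order_trans)
    then show "0 \<le> e powr \<alpha> + e powr (\<alpha> - 1) * w" by simp
  qed (use C2 in auto)
  finally show ?thesis by (simp add: algebra_simps)
qed

text \<open>Both means are split at the first factor, and the first factors \<open>g\<close> and
  \<open>h\<close> are coupled. The difference has three parts: the stretch of \<open>v\<close> by
  \<open>g\<close> and \<open>h\<close>, the change of the starting vector from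
  \<open>g *v v\<close> to \<open>h *v v\<close> under the law \<open>\<nu>\<close>, and the
  difference of the means from the common vector \<open>h *v v\<close>, left to the induction. The
  first two cost a fixed amount in each step.\<close>

lemma mean_log_perturb:
  assumes \<nu>: "walk \<nu> \<kappa>" "walk \<mu> \<kappa>" and \<pi>: "\<pi> \<in> couplings \<nu> \<mu>"
    and w: "(\<integral>p. norm (fst p - snd p) \<partial>\<pi>) \<le> w" and e: "0 < e"
    and gap: "\<And>n u v. u \<noteq> 0 \<Longrightarrow> v \<noteq> 0 \<Longrightarrow> log_gap \<nu> n u v \<le> B * R u v" and B: "0 \<le> B"
    and v: "v \<noteq> 0"
  shows "\<bar>mean_log \<nu> n v - mean_log \<mu> n v\<bar> \<le>
    real n * ((2 * real CARD('n) * \<kappa>\<^sup>2 + B * C1 * (2 * \<kappa>)) * (e powr \<alpha> + e powr (\<alpha> - 1) * w))"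
  using v
proof (induction n arbitrary: v)
  case 0
  then show ?case by (simp add: mean_log_def ln_stretch_def)
next
  case (Suc n)
  note v = Suc.prems
  interpret N: walk \<nu> \<kappa> by fact
  interpret M: walk \<mu> \<kappa> by fact
  note D = couplingsD[OF \<pi>]
  note I = dist_powr_integral[OF \<nu> \<pi> w e]
  interpret pi: prob_space \<pi> by (rule D)
  \<comment> \<open>The first summand pays for the stretch of the vector, the second for the change
    of the starting direction.\<close>
  define A where "A = 2 * real CARD('n) * \<kappa>\<^sup>2 + B * C1 * (2 * \<kappa>)"
  have A: "0 \<le> A" using B C1 k by (simp add: A_def)
  let ?q = "\<lambda>p. e powr \<alpha> + e powr (\<alpha> - 1) * norm (fst p - snd p)"
  define Q where "Q = e powr \<alpha> + e powr (\<alpha> - 1) * w"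
  have step_integrable: "integrable \<mu> (\<lambda>g. ln_stretch g v + mean_log \<mu> n (g *v v))" if "walk \<mu> \<kappa>" for \<mu>
  proof -
    interpret W: walk \<mu> \<kappa> by fact
    show ?thesis
    proof (rule prob_space.integrable_bounded[OF W.prob_space_M, where B = "ln \<kappa> + real n * ln \<kappa>"])
      have "(\<lambda>g. mean_log \<mu> n (g *v v)) \<in> borel_measurable \<mu>"
        by (rule measurable_compose[OF _ W.measurable_mean_log]) measurable
      then show "(\<lambda>g. ln_stretch g v + mean_log \<mu> n (g *v v)) \<in> borel_measurable \<mu>" by measurable
      fix g assume g: "g \<in> space \<mu>"
      then have "\<bar>ln_stretch g v\<bar> \<le> ln \<kappa>" using W.space_bilip by (intro ln_stretch_bound k v) auto
      with W.mean_log_bound[OF W.M_nonzero[OF g v], of n]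
      show "\<bar>ln_stretch g v + mean_log \<mu> n (g *v v)\<bar> \<le> ln \<kappa> + real n * ln \<kappa>" by linarith
    qed
  qed
  have iN: "integrable \<pi> (\<lambda>p. ln_stretch (fst p) v + mean_log \<nu> n (fst p *v v))"
    using step_integrable[OF \<nu>(1)] by (intro integrable_distr[OF D(4)]) (simp add: D)
  have iM: "integrable \<pi> (\<lambda>p. ln_stretch (snd p) v + mean_log \<mu> n (snd p *v v))"
    using step_integrable[OF \<nu>(2)] by (intro integrable_distr[OF D(5)]) (simp add: D)
  have eN: "mean_log \<nu> (Suc n) v = (\<integral>p. ln_stretch (fst p) v + mean_log \<nu> n (fst p *v v) \<partial>\<pi>)"
    unfolding N.mean_log_Suc[OF v] using couplings_integral(1)[OF \<pi> borel_measurable_integrable[OF step_integrable[OF \<nu>(1)]]] by simp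
  have eM: "mean_log \<mu> (Suc n) v = (\<integral>p. ln_stretch (snd p) v + mean_log \<mu> n (snd p *v v) \<partial>\<pi>)"
    unfolding M.mean_log_Suc[OF v] using couplings_integral(2)[OF \<pi> borel_measurable_integrable[OF step_integrable[OF \<nu>(2)]]] by simp
  have "\<bar>mean_log \<nu> (Suc n) v - mean_log \<mu> (Suc n) v\<bar> =
      \<bar>\<integral>p. (ln_stretch (fst p) v + mean_log \<nu> n (fst p *v v)) - (ln_stretch (snd p) v + mean_log \<mu> n (snd p *v v)) \<partial>\<pi>\<bar>"
    unfolding eN eM using iN iM by simp
  also have "\<dots> \<le> (\<integral>p. \<bar>(ln_stretch (fst p) v + mean_log \<nu> n (fst p *v v)) - (ln_stretch (snd p) v + mean_log \<mu> n (snd p *v v))\<bar> \<partial>\<pi>)"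
    by (rule integral_abs_bound)
  also have "\<dots> \<le> (\<integral>p. A * ?q p + real n * (A * Q) \<partial>\<pi>)"
  proof (rule integral_mono)
    show "integrable \<pi> (\<lambda>p. \<bar>(ln_stretch (fst p) v + mean_log \<nu> n (fst p *v v)) - (ln_stretch (snd p) v + mean_log \<mu> n (snd p *v v))\<bar>)"
      using iN iM by (intro integrable_abs Bochner_Integration.integrable_diff)
    show "integrable \<pi> (\<lambda>p. A * ?q p + real n * (A * Q))"
      by (intro Bochner_Integration.integrable_add integrable_mult_right I(2) pi.integrable_const)
    fix p assume p: "p \<in> space \<pi>"
    obtain g h where gh: "p = (g, h)" by (cases p)
    then have g: "g \<in> space \<nu>" "g \<in> bilip \<kappa>" and h: "h \<in> space \<mu>" "h \<in> bilip \<kappa>"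
      using p N.space_bilip M.space_bilip unfolding D(2) by auto
    have hN: "h *v v \<noteq> 0" and gN: "g *v v \<noteq> 0" using N.M_nonzero[OF g(1) v] M.M_nonzero[OF h(1) v] by auto
    define t where "t = norm (g - h)"
    have t0: "0 \<le> t" by (simp add: t_def)
    have t2: "t \<le> 2 * (real CARD('n) * \<kappa>)" using I(5)[OF p] by (simp add: gh t_def)
    have tq: "t powr \<alpha> \<le> ?q p" using I(4)[OF p] by (simp add: gh t_def)
    have d1: "1 \<le> 2 * (real CARD('n) * \<kappa>)"
    proof -
      have "1 * 1 \<le> real CARD('n) * \<kappa>" using k by (intro mult_mono) auto
      then show ?thesis by simp
    qed
    \<comment> \<open>The stretch is Lipschitz in the matrix, whereas the direction costs a power
      \<open>\<alpha>\<close>. Since \<open>t\<close> is bounded, the linear cost can be expressed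
      by \<open>t powr \<alpha>\<close> too.\<close>
    have tt: "t \<le> 2 * (real CARD('n) * \<kappa>) * t powr \<alpha>"
    proof (cases "t = 0")
      case False
      then have t: "t > 0" using t0 by linarith
      have "t = t powr (1 - \<alpha>) * t powr \<alpha>" using t by (simp flip: powr_add)
      also have "t powr (1 - \<alpha>) \<le> (2 * (real CARD('n) * \<kappa>)) powr (1 - \<alpha>)"
        using \<alpha> t t2 by (intro powr_mono2) auto
      also have "\<dots> \<le> (2 * (real CARD('n) * \<kappa>)) powr 1" using \<alpha> d1 by (intro powr_mono) auto
      also have "\<dots> = 2 * (real CARD('n) * \<kappa>)" using d1 by simp
      finally show ?thesis by (simp add: mult_right_mono)
    qed simp
    have "\<bar>ln_stretch g v - ln_stretch h v\<bar> \<le> \<kappa> * t" unfolding t_def by (intro ln_stretch_lipschitz_matrix g h k v)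
    also have "\<kappa> * t \<le> \<kappa> * (2 * (real CARD('n) * \<kappa>) * t powr \<alpha>)" using tt k by (intro mult_left_mono) auto
    finally have 1: "\<bar>ln_stretch g v - ln_stretch h v\<bar> \<le> 2 * real CARD('n) * \<kappa>\<^sup>2 * t powr \<alpha>"
      by (simp add: power2_eq_square mult_ac)
    \<comment> \<open>The contraction enters here: the gap bound is uniform in \<open>n\<close>, so
      a changed starting direction is not amplified by the remaining steps.\<close>
    have "\<bar>mean_log \<nu> n (g *v v) - mean_log \<nu> n (h *v v)\<bar> \<le> log_gap \<nu> n (g *v v) (h *v v)"
      by (rule N.mean_log_diff_le[OF gN hN])
    also have "\<dots> \<le> B * R (g *v v) (h *v v)" by (rule gap[OF gN hN])
    also have "\<dots> \<le> B * (C1 * pdist (g *v v) (h *v v) powr \<alpha>)" by (intro mult_left_mono R_upper gN hN B)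
    also have "\<dots> \<le> B * (C1 * (2 * \<kappa> * t) powr \<alpha>)"
      unfolding t_def using B C1 \<alpha> by (intro mult_left_mono powr_mono2 pdist_image_le g h k v) (auto simp: pdist_nonneg)
    also have "(2 * \<kappa> * t) powr \<alpha> = (2 * \<kappa>) powr \<alpha> * t powr \<alpha>" using k t0 by (simp add: powr_mult)
    also have "B * (C1 * ((2 * \<kappa>) powr \<alpha> * t powr \<alpha>)) \<le> B * (C1 * (2 * \<kappa> * t powr \<alpha>))"
    proof -
      have "(2 * \<kappa>) powr \<alpha> \<le> (2 * \<kappa>) powr 1" using \<alpha> k by (intro powr_mono) auto
      then have "(2 * \<kappa>) powr \<alpha> \<le> 2 * \<kappa>" using k by simp
      then show ?thesis using B C1 by (intro mult_left_mono mult_right_mono) auto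
    qed
    finally have 2: "\<bar>mean_log \<nu> n (g *v v) - mean_log \<nu> n (h *v v)\<bar> \<le> B * C1 * (2 * \<kappa>) * t powr \<alpha>"
      by (simp add: mult_ac)
    have 3: "\<bar>mean_log \<nu> n (h *v v) - mean_log \<mu> n (h *v v)\<bar> \<le> real n * (A * Q)"
      unfolding A_def Q_def by (rule Suc.IH[OF hN])
    have "2 * real CARD('n) * \<kappa>\<^sup>2 * t powr \<alpha> + B * C1 * (2 * \<kappa>) * t powr \<alpha> = A * t powr \<alpha>"
      by (simp add: A_def algebra_simps)
    moreover have "A * t powr \<alpha> \<le> A * ?q p" using A tq by (rule mult_left_mono[rotated])
    ultimately show "\<bar>(ln_stretch (fst p) v + mean_log \<nu> n (fst p *v v)) - (ln_stretch (snd p) v + mean_log \<mu> n (snd p *v v))\<bar> \<le>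
        A * ?q p + real n * (A * Q)"
      using 1 2 3 unfolding gh fst_conv snd_conv by linarith
  qed
  also have "\<dots> = A * (\<integral>p. ?q p \<partial>\<pi>) + real n * (A * Q)"
    using I(2) by (simp add: pi.prob_space)
  also have "\<dots> \<le> A * Q + real n * (A * Q)"
    unfolding Q_def using A by (intro add_right_mono mult_left_mono I(3))
  also have "\<dots> = real (Suc n) * (A * Q)" by (simp add: algebra_simps)
  finally show ?case unfolding A_def Q_def .
qed

end

section \<open>Restriction to the support\<close>

text \<open>\<open>norm (g *v v)\<close> is positive on the compact product of \<open>K\<close> and
  the unit sphere, because determinant \<open>1\<close> excludes kernels; its minimum gives the
  lower constant.\<close>

lemma compact_SL_bilip:
  fixes K :: "(real^'n::finite^'n) set"
  assumes K: "compact K" "K \<subseteq> SL"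
  obtains \<kappa> where "1 \<le> \<kappa>" "K \<subseteq> bilip \<kappa>"
proof (cases "K = {}")
  case True
  then show thesis using that[of 1] by simp
next
  case False
  obtain b where b: "\<And>g. g \<in> K \<Longrightarrow> norm g \<le> b"
    using compact_imp_bounded[OF K(1)] by (auto simp: bounded_iff)
  let ?S = "K \<times> sphere (0 :: real^'n) 1"
  have cpt: "compact ?S" using K by (intro compact_Times) auto
  have ne: "?S \<noteq> {}" using False by simp
  have cont: "continuous_on ?S (\<lambda>p. norm (fst p *v snd p))" by (intro continuous_intros)
  from continuous_attains_inf[OF cpt ne cont] obtain p
    where p: "p \<in> ?S" "\<forall>q\<in>?S. norm (fst p *v snd p) \<le> norm (fst q *v snd q)" by (rule bexE)
  define c where "c = norm (fst p *v snd p)"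
  have inj: "g *v v \<noteq> 0" if "g \<in> K" "v \<noteq> 0" for g and v :: "real^'n"
  proof -
    have "det g \<noteq> 0" using that K by (auto simp: SL_def)
    then have "invertible g" by (simp add: invertible_det_nz)
    then obtain h where "h ** g = mat 1" by (auto simp: invertible_def)
    then have "h *v (g *v v) = v" by (simp add: matrix_vector_mul_assoc)
    then show ?thesis using that by auto
  qed
  have "fst p \<in> K" "snd p \<noteq> 0" using p(1) by auto
  then have c: "c > 0" using inj by (simp add: c_def)
  have lower: "c * norm v \<le> norm (g *v v)" if g: "g \<in> K" for g v
  proof (cases "v = 0")
    case False
    then have "(g, v /\<^sub>R norm v) \<in> ?S" using g by simp
    from bspec[OF p(2) this] have "c \<le> norm (g *v (v /\<^sub>R norm v))" by (simp add: c_def)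
    then show ?thesis using False by (simp add: matrix_vector_mult_scaleR field_simps)
  qed simp
  define \<kappa> where "\<kappa> = max 1 (max b (1 / c))"
  show thesis
  proof (rule that[of \<kappa>])
    show "K \<subseteq> bilip \<kappa>"
    proof
      fix g assume g: "g \<in> K"
      show "g \<in> bilip \<kappa>"
        unfolding bilip_def
      proof safe
        fix v :: "real^'n"
        have "norm (g *v v) \<le> norm g * norm v" by (rule norm_matrix_vector_le)
        also have "\<dots> \<le> \<kappa> * norm v" using b[OF g] by (intro mult_right_mono) (auto simp: \<kappa>_def)
        finally show "norm (g *v v) \<le> \<kappa> * norm v" .
        have "norm v \<le> 1 / c * norm (g *v v)" using lower[OF g, of v] c by (simp add: field_simps)
        also have "\<dots> \<le> \<kappa> * norm (g *v v)" by (intro mult_right_mono) (auto simp: \<kappa>_def)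
        finally show "norm v \<le> \<kappa> * norm (g *v v)" .
      qed
    qed
  qed (simp add: \<kappa>_def)
qed

text \<open>The law as a measure on its support, so that all points of its space, and not just
  almost all, are uniformly bilipschitz.\<close>

definition supp_measure :: "(real^'n::finite^'n) measure \<Rightarrow> (real^'n^'n) measure"
  where "supp_measure \<nu> = restrict_space \<nu> (supp \<nu>)"

text \<open>The bridge between the law on \<open>SL\<close> and the law on the support. The default
  value off the support, a null set, is any point of the support; the support is nonempty because it
  has full measure.\<close>

definition supp_retract :: "(real^'n::finite^'n) measure \<Rightarrow> real^'n^'n \<Rightarrow> real^'n^'n"
  where "supp_retract \<nu> g = (if g \<in> supp \<nu> then g else (SOME h. h \<in> supp \<nu>))"

lemma prob_measure_SLD:
  assumes "prob_measure_SL \<nu>"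
  shows "prob_space \<nu>" "sets \<nu> = sets (restrict_space borel SL)" "space \<nu> = SL"
proof -
  show "prob_space \<nu>" and s: "sets \<nu> = sets (restrict_space borel SL)"
    using assms by (auto simp: prob_measure_SL_def)
  show "space \<nu> = SL" using sets_eq_imp_space_eq[OF s] by (simp add: space_restrict_space)
qed

lemma open_SL_sets: "prob_measure_SL \<nu> \<Longrightarrow> open U \<Longrightarrow> U \<inter> SL \<in> sets \<nu>"
  by (auto simp: prob_measure_SLD sets_restrict_space)

text \<open>With a countable base, the complement of the support in \<open>SL\<close> is the union
  of countably many basic open sets of measure zero.\<close>

lemma AE_supp:
  fixes \<nu> :: "(real^'n::finite^'n) measure"
  assumes \<nu>: "prob_measure_SL \<nu>"
  shows "supp \<nu> \<in> sets \<nu>" "AE g in \<nu>. g \<in> supp \<nu>"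
proof -
  obtain B :: "(real^'n^'n) set set" where B: "countable B" "topological_basis B"
    using ex_countable_basis by blast
  define Z where "Z = {b \<in> B. emeasure \<nu> (b \<inter> SL) = 0}"
  have null: "b \<inter> SL \<in> null_sets \<nu>" if "b \<in> Z" for b
    using that open_SL_sets[OF \<nu> topological_basis_open[OF B(2)]] by (auto simp: Z_def)
  have cZ: "countable Z" using B(1) by (simp add: Z_def)
  have N: "(\<Union>b\<in>Z. b \<inter> SL) \<in> null_sets \<nu>"
    using null by (intro null_sets_UN' cZ)
  have eq: "supp \<nu> = SL - (\<Union>b\<in>Z. b \<inter> SL)"
  proof (intro equalityI subsetI)
    fix g assume g: "g \<in> supp \<nu>"
    have "g \<notin> b" if "b \<in> Z" for b
    proof
      assume "g \<in> b"
      moreover have "open b" using that topological_basis_open[OF B(2)] by (simp add: Z_def)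
      ultimately have "emeasure \<nu> (b \<inter> SL) > 0" using g by (simp add: supp_def)
      then show False using that by (simp add: Z_def)
    qed
    then show "g \<in> SL - (\<Union>b\<in>Z. b \<inter> SL)" using g by (auto simp: supp_def)
  next
    fix g assume g: "g \<in> SL - (\<Union>b\<in>Z. b \<inter> SL)"
    have "emeasure \<nu> (U \<inter> SL) > 0" if U: "open U" "g \<in> U" for U
    proof (rule ccontr)
      assume "\<not> emeasure \<nu> (U \<inter> SL) > 0"
      then have 0: "emeasure \<nu> (U \<inter> SL) = 0" by (simp add: zero_less_iff_neq_zero)
      obtain b where b: "b \<in> B" "g \<in> b" "b \<subseteq> U" using topological_basisE[OF B(2) U] .
      have "emeasure \<nu> (b \<inter> SL) \<le> emeasure \<nu> (U \<inter> SL)"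
        using b by (intro emeasure_mono open_SL_sets[OF \<nu>] U) auto
      then have "b \<in> Z" using b 0 by (simp add: Z_def)
      then show False using g b by auto
    qed
    then show "g \<in> supp \<nu>" using g by (simp add: supp_def)
  qed
  have "SL \<in> sets \<nu>" using sets.top[of \<nu>] by (simp add: prob_measure_SLD[OF \<nu>])
  then show "supp \<nu> \<in> sets \<nu>" unfolding eq using N by (intro sets.Diff) auto
  from AE_not_in[OF N] AE_space[of \<nu>] show "AE g in \<nu>. g \<in> supp \<nu>"
    by eventually_elim (simp add: eq prob_measure_SLD[OF \<nu>])
qed

lemma supp_measure_walk:
  assumes \<nu>: "prob_measure_SL \<nu>" and K: "supp \<nu> \<subseteq> K" "K \<subseteq> bilip \<kappa>" "1 \<le> \<kappa>"
  shows "walk (supp_measure \<nu>) \<kappa>"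
proof -
  interpret N: prob_space \<nu> by (rule prob_measure_SLD[OF \<nu>])
  have sub: "supp \<nu> \<subseteq> SL" by (auto simp: supp_def)
  have sp: "space (supp_measure \<nu>) = supp \<nu>"
    using sub by (auto simp: supp_measure_def space_restrict_space prob_measure_SLD[OF \<nu>])
  have "emeasure \<nu> (supp \<nu>) = 1"
    using AE_supp[OF \<nu>] by (intro N.emeasure_eq_1_AE)
  then have "prob_space (supp_measure \<nu>)"
    unfolding supp_measure_def by (intro prob_space_restrict_space AE_supp(1)[OF \<nu>])
  then interpret prob_space "supp_measure \<nu>" .
  show ?thesis
  proof
    have "sets (supp_measure \<nu>) = (\<lambda>A. supp \<nu> \<inter> A) ` ((\<lambda>A. SL \<inter> A) ` sets borel)"
      by (simp add: supp_measure_def sets_restrict_space prob_measure_SLD[OF \<nu>])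
    also have "\<dots> = (\<lambda>A. supp \<nu> \<inter> A) ` sets borel"
      using sub by (simp add: image_image Int_assoc[symmetric] Int_absorb2)
    finally show "sets (supp_measure \<nu>) = sets (restrict_space borel (space (supp_measure \<nu>)))"
      by (simp add: sp sets_restrict_space)
    show "space (supp_measure \<nu>) \<subseteq> bilip \<kappa>" using sp K by blast
  qed (rule K(3))
qed

lemma supp_retract:
  assumes \<nu>: "prob_measure_SL \<nu>"
  shows "supp_retract \<nu> \<in> measurable \<nu> (supp_measure \<nu>)"
    "AE g in \<nu>. supp_retract \<nu> g = g"
    "distr \<nu> (supp_measure \<nu>) (supp_retract \<nu>) = supp_measure \<nu>"
    "space (supp_measure \<nu>) = supp \<nu>"
proof -
  interpret N: prob_space \<nu> by (rule prob_measure_SLD[OF \<nu>])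
  show sp: "space (supp_measure \<nu>) = supp \<nu>"
    by (auto simp: supp_measure_def space_restrict_space prob_measure_SLD[OF \<nu>] supp_def)
  show ae: "AE g in \<nu>. supp_retract \<nu> g = g"
    using AE_supp(2)[OF \<nu>] by eventually_elim (simp add: supp_retract_def)
  have "\<exists>g. g \<in> supp \<nu>"
  proof (rule ccontr)
    assume "\<not> ?thesis"
    then have "AE g in \<nu>. False" using AE_supp(2)[OF \<nu>] by simp
    then show False by simp
  qed
  then have "(SOME h. h \<in> supp \<nu>) \<in> supp \<nu>" by (rule someI_ex)
  then have r: "supp_retract \<nu> g \<in> supp \<nu>" for g by (simp add: supp_retract_def)
  have "(SOME h. h \<in> supp \<nu>) \<in> space \<nu>"
    using subsetD[OF sets.sets_into_space[OF AE_supp(1)[OF \<nu>]] \<open>(SOME h. h \<in> supp \<nu>) \<in> supp \<nu>\<close>] .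
  then have "(\<lambda>g. if g \<in> supp \<nu> then g else (SOME h. h \<in> supp \<nu>)) \<in> measurable \<nu> \<nu>"
    by (intro measurable_If_set measurable_ident_sets[OF refl] measurable_const sets.Int sets.top AE_supp(1)[OF \<nu>])
  then have "supp_retract \<nu> \<in> measurable \<nu> \<nu>" by (simp add: supp_retract_def[abs_def])
  then show m: "supp_retract \<nu> \<in> measurable \<nu> (supp_measure \<nu>)"
    unfolding supp_measure_def using r by (intro measurable_restrict_space2) auto
  show "distr \<nu> (supp_measure \<nu>) (supp_retract \<nu>) = supp_measure \<nu>"
  proof (rule measure_eqI)
    fix A assume "A \<in> sets (distr \<nu> (supp_measure \<nu>) (supp_retract \<nu>))"
    then have A: "A \<in> sets (supp_measure \<nu>)" by simp
    then have AT: "A \<subseteq> supp \<nu>" "A \<in> sets \<nu>"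
      using sets.sets_into_space[OF A] AE_supp(1)[OF \<nu>]
      by (auto simp: sp supp_measure_def sets_restrict_space)
    have "emeasure (distr \<nu> (supp_measure \<nu>) (supp_retract \<nu>)) A = emeasure \<nu> (supp_retract \<nu> -` A \<inter> space \<nu>)"
      by (rule emeasure_distr[OF m A])
    also have "\<dots> = emeasure \<nu> A"
    proof (rule emeasure_eq_AE)
      show "AE g in \<nu>. g \<in> supp_retract \<nu> -` A \<inter> space \<nu> \<longleftrightarrow> g \<in> A"
        using ae AE_space by eventually_elim auto
    qed (use AT measurable_sets[OF m A] in auto)
    also have "\<dots> = emeasure (supp_measure \<nu>) A"
      unfolding supp_measure_def using AT AE_supp(1)[OF \<nu>]
      by (intro emeasure_restrict_space[symmetric]) (auto intro: sets.Int)
    finally show "emeasure (distr \<nu> (supp_measure \<nu>) (supp_retract \<nu>)) A = emeasure (supp_measure \<nu>) A" .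
  qed simp
qed

section \<open>From the two-sided shift to the one-sided walk on the support\<close>

lemma shift_funpow: "(shift ^^ n) x m = x (m + int n)"
  by (induction n arbitrary: m) (simp_all add: shift_def algebra_simps)

lemma cocycle_eq_mprod: "cocycle n x = mprod n (\<lambda>k. x (int k))"
  by (induction n) (simp_all add: generator_def shift_funpow)

text \<open>The cocycle at positive times reads only coordinates with nonnegative index. Restricting
  to these and retracting each one to the support maps the two-sided product measure to the
  one-sided one, and almost surely it changes no factor.\<close>

lemma AE_cocycle:
  assumes \<nu>: "prob_measure_SL \<nu>" and W: "walk (supp_measure \<nu>) \<kappa>"
    and P: "AE y in Pi\<^sub>M (UNIV :: nat set) (\<lambda>_. supp_measure \<nu>). P (\<lambda>n. mprod n y)"
  shows "AE x in Pi\<^sub>M (UNIV :: int set) (\<lambda>_. \<nu>). P (\<lambda>n. cocycle n x)"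
proof -
  interpret W: walk "supp_measure \<nu>" \<kappa> by fact
  interpret N: prob_space \<nu> by (rule prob_measure_SLD[OF \<nu>])
  interpret Z: product_prob_space "\<lambda>_. \<nu>" "UNIV :: int set" by unfold_locales
  let ?Z = "Pi\<^sub>M (UNIV :: int set) (\<lambda>_. \<nu>)"
  note r = supp_retract[OF \<nu>]
  define T where "T x = (\<lambda>k. supp_retract \<nu> (x (int k)))" for x :: "int \<Rightarrow> real^'a^'a"
  have coord: "(\<lambda>x. supp_retract \<nu> (x (int k))) \<in> measurable ?Z (supp_measure \<nu>)" for k
  proof -
    have "(\<lambda>x. x (int k)) \<in> measurable ?Z \<nu>" by (rule measurable_component_singleton) simp
    from measurable_compose[OF this r(1)] show ?thesis .
  qed
  have T: "T \<in> measurable ?Z W.S"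
    unfolding T_def[abs_def] using measurable_space[OF coord]
    by (intro measurable_PiM_single' coord) auto
  have dist: "distr ?Z W.S T = W.S"
  proof (rule W.PiM_eq)
    fix J :: "nat set" and F assume J: "finite J" "J \<subseteq> UNIV" and F: "\<And>j. j \<in> J \<Longrightarrow> F j \<in> sets (supp_measure \<nu>)"
    let ?X = "\<lambda>i. supp_retract \<nu> -` F (nat i) \<inter> space \<nu>"
    have X: "?X i \<in> sets \<nu>" if "i \<in> int ` J" for i
      using that F by (intro measurable_sets[OF r(1)]) auto
    have "emeasure (distr ?Z W.S T) (prod_emb UNIV (\<lambda>_. supp_measure \<nu>) J (Pi\<^sub>E J F)) =
        emeasure ?Z (T -` prod_emb UNIV (\<lambda>_. supp_measure \<nu>) J (Pi\<^sub>E J F) \<inter> space ?Z)"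
      using J F by (intro emeasure_distr T sets_PiM_I) auto
    also have "T -` prod_emb UNIV (\<lambda>_. supp_measure \<nu>) J (Pi\<^sub>E J F) \<inter> space ?Z =
        {x \<in> space ?Z. \<forall>i\<in>int ` J. x i \<in> ?X i}"
      using measurable_space[OF r(1)] by (auto simp: T_def prod_emb_def space_PiM PiE_iff)
    also have "emeasure ?Z \<dots> = (\<Prod>i\<in>int ` J. emeasure \<nu> (?X i))"
      using J X by (intro Z.emeasure_PiM_Collect) auto
    also have "\<dots> = (\<Prod>j\<in>J. emeasure \<nu> (supp_retract \<nu> -` F j \<inter> space \<nu>))"
      by (subst prod.reindex) auto
    also have "\<dots> = (\<Prod>j\<in>J. emeasure (supp_measure \<nu>) (F j))"
      using F by (intro prod.cong refl) (metis r(1,3) emeasure_distr)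
    finally show "emeasure (distr ?Z W.S T) (prod_emb UNIV (\<lambda>_. supp_measure \<nu>) J (Pi\<^sub>E J F)) =
        (\<Prod>j\<in>J. emeasure (supp_measure \<nu>) (F j))" .
  qed simp
  have "AE y in distr ?Z W.S T. P (\<lambda>n. mprod n y)" unfolding dist by (rule P)
  from AE_distrD[OF T this] have "AE x in ?Z. P (\<lambda>n. mprod n (T x))" .
  moreover have "AE x in ?Z. \<forall>k::nat. supp_retract \<nu> (x (int k)) = x (int k)"
    unfolding AE_all_countable by (intro allI Z.AE_component r(2)) simp
  ultimately show ?thesis
    by eventually_elim (simp add: T_def cocycle_eq_mprod)
qed

lemma lyapunov_exponent_on_eqI:
  assumes \<nu>: "prob_measure_SL \<nu>" and W: "walk (supp_measure \<nu>) \<kappa>"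
    and lim: "AE y in Pi\<^sub>M (UNIV :: nat set) (\<lambda>_. supp_measure \<nu>).
      (\<lambda>n. ln (singular_value V k (mprod n y)) / real n) \<longlonglongrightarrow> L"
  shows "lyapunov_exponent_on V k \<nu> = L"
  unfolding lyapunov_exponent_on_def
proof (rule the_equality)
  interpret N: prob_space \<nu> by (rule prob_measure_SLD[OF \<nu>])
  interpret Z: product_prob_space "\<lambda>_. \<nu>" "UNIV :: int set" by unfold_locales
  let ?Z = "Pi\<^sub>M (UNIV :: int set) (\<lambda>_. \<nu>)"
  show L: "AE x in ?Z. (\<lambda>n. ln (singular_value V k (cocycle n x)) / real n) \<longlonglongrightarrow> L"
    using AE_cocycle[OF \<nu> W, where P = "\<lambda>A. (\<lambda>n. ln (singular_value V k (A n)) / real n) \<longlonglongrightarrow> L"] lim by simp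
  fix L' assume "AE x in ?Z. (\<lambda>n. ln (singular_value V k (cocycle n x)) / real n) \<longlonglongrightarrow> L'"
  with L have "AE x in ?Z. L' = L"
    by eventually_elim (rule LIMSEQ_unique)
  then show "L' = L" by simp
qed

text \<open>The given coupling is pushed forward by the pair of retractions, which moves almost no
  point. The factor of the dimension is the price of passing from the operator norm to the Frobenius
  norm.\<close>

lemma supp_coupling:
  fixes \<mu> \<nu> :: "(real^'n::finite^'n) measure"
  assumes \<mu>: "prob_measure_SL \<mu>" "walk (supp_measure \<mu>) \<kappa>" and \<nu>: "prob_measure_SL \<nu>" "walk (supp_measure \<nu>) \<kappa>"
    and \<pi>: "\<pi> \<in> couplings \<mu> \<nu>"
    and cost: "(\<integral>\<^sup>+ p. ennreal (onorm (\<lambda>v. (fst p - snd p) *v v)) \<partial>\<pi>) < ennreal w"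
  shows "\<exists>\<pi>'\<in>couplings (supp_measure \<mu>) (supp_measure \<nu>). (\<integral>p. norm (fst p - snd p) \<partial>\<pi>') \<le> real CARD('n) * w"
proof -
  interpret M: walk "supp_measure \<mu>" \<kappa> by fact
  interpret N: walk "supp_measure \<nu>" \<kappa> by fact
  note D = couplingsD[OF \<pi>]
  interpret pi: prob_space \<pi> by (rule D)
  note rM = supp_retract[OF \<mu>(1)] and rN = supp_retract[OF \<nu>(1)]
  let ?P = "supp_measure \<mu> \<Otimes>\<^sub>M supp_measure \<nu>"
  define f where "f p = (supp_retract \<mu> (fst p), supp_retract \<nu> (snd p))" for p
  have f1: "(\<lambda>p. supp_retract \<mu> (fst p)) \<in> measurable \<pi> (supp_measure \<mu>)"
    by (rule measurable_compose[OF D(4) rM(1)])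
  have f2: "(\<lambda>p. supp_retract \<nu> (snd p)) \<in> measurable \<pi> (supp_measure \<nu>)"
    by (rule measurable_compose[OF D(5) rN(1)])
  have f: "f \<in> measurable \<pi> ?P" unfolding f_def[abs_def] by (rule measurable_Pair[OF f1 f2])
  define \<pi>' where "\<pi>' = distr \<pi> ?P f"
  interpret pi': prob_space \<pi>' unfolding \<pi>'_def by (rule pi.prob_space_distr[OF f])
  have "distr \<pi>' (supp_measure \<mu>) fst = distr \<pi> (supp_measure \<mu>) (\<lambda>p. supp_retract \<mu> (fst p))"
    unfolding \<pi>'_def by (subst distr_distr[OF measurable_fst f]) (simp add: f_def o_def)
  also have "\<dots> = distr (distr \<pi> \<mu> fst) (supp_measure \<mu>) (supp_retract \<mu>)"
    by (subst distr_distr[OF rM(1) D(4)]) (simp add: o_def)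
  also have "\<dots> = supp_measure \<mu>" by (simp add: D(6) rM(3))
  finally have m1: "distr \<pi>' (supp_measure \<mu>) fst = supp_measure \<mu>" .
  have "distr \<pi>' (supp_measure \<nu>) snd = distr \<pi> (supp_measure \<nu>) (\<lambda>p. supp_retract \<nu> (snd p))"
    unfolding \<pi>'_def by (subst distr_distr[OF measurable_snd f]) (simp add: f_def o_def)
  also have "\<dots> = distr (distr \<pi> \<nu> snd) (supp_measure \<nu>) (supp_retract \<nu>)"
    by (subst distr_distr[OF rN(1) D(5)]) (simp add: o_def)
  also have "\<dots> = supp_measure \<nu>" by (simp add: D(7) rN(3))
  finally have m2: "distr \<pi>' (supp_measure \<nu>) snd = supp_measure \<nu>" .
  have \<pi>'c: "\<pi>' \<in> couplings (supp_measure \<mu>) (supp_measure \<nu>)"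
    using m1 m2 pi'.prob_space_axioms by (simp add: couplings_def \<pi>'_def)
  note D' = couplingsD[OF \<pi>'c]
  let ?d = "real CARD('n)"
  have d: "?d > 0" by simp
  \<comment> \<open>The Frobenius norm divided by the dimension lies below the operator norm and is
    evidently measurable, so the change of variables is done with it.\<close>
  let ?n = "\<lambda>p. norm (fst p - snd p :: real^'n^'n) / ?d"
  have [measurable]: "fst \<in> borel_measurable \<pi>'" "snd \<in> borel_measurable \<pi>'"
    using measurable_compose[OF D'(4) M.measurable_M_borel] measurable_compose[OF D'(5) N.measurable_M_borel] by simp_all
  have bnd: "norm (fst p - snd p) \<le> 2 * (?d * \<kappa>)" if "p \<in> space \<pi>'" for p
  proof -
    have "fst p \<in> bilip \<kappa>" "snd p \<in> bilip \<kappa>"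
      using that M.space_bilip N.space_bilip unfolding D'(2) by auto
    then show ?thesis
      using norm_triangle_ineq4[of "fst p" "snd p"] bilip_norm_le[of "fst p" \<kappa>] bilip_norm_le[of "snd p" \<kappa>] by linarith
  qed
  have ni: "integrable \<pi>' (\<lambda>p. norm (fst p - snd p))"
    using bnd by (intro pi'.integrable_bounded[where B = "2 * (?d * \<kappa>)"]) auto
  have "ennreal (\<integral>p. ?n p \<partial>\<pi>') = (\<integral>\<^sup>+p. ennreal (?n p) \<partial>\<pi>')"
    using ni by (intro nn_integral_eq_integral[symmetric]) auto
  also have "\<dots> = (\<integral>\<^sup>+p. ennreal (?n (f p)) \<partial>\<pi>)"
  proof -
    have "(\<lambda>p. ennreal (?n p)) \<in> borel_measurable \<pi>'" by measurable
    then show ?thesis unfolding \<pi>'_def by (intro nn_integral_distr[OF f])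
  qed
  also have "\<dots> \<le> (\<integral>\<^sup>+p. ennreal (onorm (\<lambda>v. (fst p - snd p) *v v)) \<partial>\<pi>)"
  proof (rule nn_integral_mono_AE)
    have "AE p in \<pi>. supp_retract \<mu> (fst p) = fst p"
    proof (rule AE_distrD[OF D(4)])
      show "AE g in distr \<pi> \<mu> fst. supp_retract \<mu> g = g" unfolding D(6) by (rule rM(2))
    qed
    moreover have "AE p in \<pi>. supp_retract \<nu> (snd p) = snd p"
    proof (rule AE_distrD[OF D(5)])
      show "AE g in distr \<pi> \<nu> snd. supp_retract \<nu> g = g" unfolding D(7) by (rule rN(2))
    qed
    ultimately show "AE p in \<pi>. ennreal (?n (f p)) \<le> ennreal (onorm (\<lambda>v. (fst p - snd p) *v v))"
    proof eventually_elim
      case (elim p)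
      have "norm (fst p - snd p) \<le> ?d * onorm (\<lambda>v. (fst p - snd p) *v v)"
        by (intro norm_matrix_le_bound onorm) simp
      then show ?case using elim d by (intro ennreal_leI) (simp add: f_def divide_le_eq mult.commute)
    qed
  qed
  also have "\<dots> < ennreal w" by (rule cost)
  finally have lt: "ennreal (\<integral>p. ?n p \<partial>\<pi>') < ennreal w" .
  have "0 \<le> (\<integral>p. ?n p \<partial>\<pi>')" by (intro Bochner_Integration.integral_nonneg) auto
  then have "(\<integral>p. ?n p \<partial>\<pi>') < w" using lt by (simp add: ennreal_less_iff)
  then have "(\<integral>p. norm (fst p - snd p) \<partial>\<pi>') \<le> ?d * w" using d by (simp add: divide_less_eq mult.commute)
  then show ?thesis using \<pi>'c by blast
qed

text \<open>The strict bound on the distance provides a nearly optimal coupling; the infimum is not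
  claimed to be attained. For \<open>enn2real\<close> to be faithful the infimum has to be
  finite.\<close>

lemma wasserstein_coupling:
  fixes \<mu> \<nu> :: "(real^'n::finite^'n) measure"
  assumes \<mu>: "prob_measure_SL \<mu>" "walk (supp_measure \<mu>) \<kappa>" and \<nu>: "prob_measure_SL \<nu>" "walk (supp_measure \<nu>) \<kappa>"
    and w: "wasserstein \<mu> \<nu> < w"
  shows "\<exists>\<pi>'\<in>couplings (supp_measure \<mu>) (supp_measure \<nu>). (\<integral>p. norm (fst p - snd p) \<partial>\<pi>') \<le> real CARD('n) * w"
proof -
  interpret M: prob_space \<mu> by (rule prob_measure_SLD[OF \<mu>(1)])
  interpret N: prob_space \<nu> by (rule prob_measure_SLD[OF \<nu>(1)])
  interpret MN: pair_prob_space \<mu> \<nu> ..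
  interpret WM: walk "supp_measure \<mu>" \<kappa> by fact
  interpret WN: walk "supp_measure \<nu>" \<kappa> by fact
  let ?c = "\<lambda>\<pi>. \<integral>\<^sup>+ p. ennreal (onorm (\<lambda>v. (fst p - snd p :: real^'n^'n) *v v)) \<partial>\<pi>"
  have snd: "distr (\<mu> \<Otimes>\<^sub>M \<nu>) \<nu> snd = \<nu>"
  proof (rule measure_eqI)
    fix A assume "A \<in> sets (distr (\<mu> \<Otimes>\<^sub>M \<nu>) \<nu> snd)"
    then have A: "A \<in> sets \<nu>" by simp
    have "emeasure (distr (\<mu> \<Otimes>\<^sub>M \<nu>) \<nu> snd) A = emeasure (\<mu> \<Otimes>\<^sub>M \<nu>) (snd -` A \<inter> space (\<mu> \<Otimes>\<^sub>M \<nu>))"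
      by (rule emeasure_distr[OF measurable_snd A])
    also have "snd -` A \<inter> space (\<mu> \<Otimes>\<^sub>M \<nu>) = space \<mu> \<times> A"
      using sets.sets_into_space[OF A] by (auto simp: space_pair_measure)
    also have "emeasure (\<mu> \<Otimes>\<^sub>M \<nu>) (space \<mu> \<times> A) = emeasure \<nu> A"
      using A by (simp add: N.emeasure_pair_measure_Times M.emeasure_space_1)
    finally show "emeasure (distr (\<mu> \<Otimes>\<^sub>M \<nu>) \<nu> snd) A = emeasure \<nu> A" .
  qed simp
  \<comment> \<open>The product coupling has finite cost, as both laws live on bounded sets, so the
    infimum is below \<open>top\<close>.\<close>
  have pc: "\<mu> \<Otimes>\<^sub>M \<nu> \<in> couplings \<mu> \<nu>"
    using MN.prob_space_axioms snd N.distr_pair_fst by (simp add: couplings_def)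
  have "?c (\<mu> \<Otimes>\<^sub>M \<nu>) \<le> (\<integral>\<^sup>+ p. ennreal (2 * (real CARD('n) * \<kappa>)) \<partial>(\<mu> \<Otimes>\<^sub>M \<nu>))"
  proof (rule nn_integral_mono_AE)
    note D = couplingsD[OF pc]
    have "AE p in \<mu> \<Otimes>\<^sub>M \<nu>. fst p \<in> supp \<mu>"
    proof (rule AE_distrD[OF D(4)])
      show "AE g in distr (\<mu> \<Otimes>\<^sub>M \<nu>) \<mu> fst. g \<in> supp \<mu>" unfolding D(6) by (rule AE_supp(2)[OF \<mu>(1)])
    qed
    moreover have "AE p in \<mu> \<Otimes>\<^sub>M \<nu>. snd p \<in> supp \<nu>"
    proof (rule AE_distrD[OF D(5)])
      show "AE g in distr (\<mu> \<Otimes>\<^sub>M \<nu>) \<nu> snd. g \<in> supp \<nu>" unfolding D(7) by (rule AE_supp(2)[OF \<nu>(1)])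
    qed
    ultimately show "AE p in \<mu> \<Otimes>\<^sub>M \<nu>. ennreal (onorm (\<lambda>v. (fst p - snd p) *v v)) \<le> ennreal (2 * (real CARD('n) * \<kappa>))"
    proof eventually_elim
      case (elim p)
      have b: "fst p \<in> bilip \<kappa>" "snd p \<in> bilip \<kappa>"
        using elim WM.space_bilip WN.space_bilip supp_retract(4)[OF \<mu>(1)] supp_retract(4)[OF \<nu>(1)] by auto
      have "onorm (\<lambda>v. (fst p - snd p) *v v) \<le> norm (fst p - snd p)"
        by (intro onorm_le norm_matrix_vector_le)
      also have "\<dots> \<le> 2 * (real CARD('n) * \<kappa>)"
        using norm_triangle_ineq4[of "fst p" "snd p"] bilip_norm_le[OF b(1)] bilip_norm_le[OF b(2)] by linarith
      finally show ?case by (rule ennreal_leI)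
    qed
  qed
  also have "\<dots> < top" by (simp add: MN.emeasure_space_1)
  finally have "(INF \<pi>\<in>couplings \<mu> \<nu>. ?c \<pi>) < top"
    using pc by (auto simp: INF_less_iff)
  then have "(INF \<pi>\<in>couplings \<mu> \<nu>. ?c \<pi>) = ennreal (wasserstein \<mu> \<nu>)"
    unfolding wasserstein_def by simp
  also have "\<dots> < ennreal w"
    using w by (intro ennreal_lessI) (auto simp: wasserstein_def intro: le_less_trans[OF enn2real_nonneg])
  finally obtain \<pi> where "\<pi> \<in> couplings \<mu> \<nu>" "?c \<pi> < ennreal w" by (auto simp: INF_less_iff)
  then show ?thesis by (rule supp_coupling[OF \<mu> \<nu>])
qed

lemma slow_frame_exponent_le:
  assumes W: "walk \<nu> \<kappa>" and B: "orthonormal B" "B \<noteq> {}"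
    and lim: "AE x in Pi\<^sub>M (UNIV :: nat set) (\<lambda>_. \<nu>). (\<lambda>n. ln (frame_norm B (mprod n x)) / real n) \<longlonglongrightarrow> \<gamma>"
    and slow: "\<And>b. b \<in> B \<Longrightarrow> AE x in Pi\<^sub>M (UNIV :: nat set) (\<lambda>_. \<nu>). slow s x b"
  shows "\<gamma> \<le> s"
proof -
  interpret W: walk \<nu> \<kappa> by fact
  have fin: "finite B" by (rule orthonormal_finite[OF B(1)])
  have "AE x in W.S. \<forall>b\<in>B. slow s x b" using slow fin by (simp add: AE_finite_all)
  with lim AE_space have "AE x in W.S. \<gamma> \<le> s"
  proof eventually_elim
    case (elim x)
    then have "\<forall>b\<in>B. \<exists>C. \<forall>n. norm (mprod n x *v b) \<le> C * exp (s * real n)" by (simp add: slow_def)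
    then obtain C where C: "\<And>b n. b \<in> B \<Longrightarrow> norm (mprod n x *v b) \<le> C b * exp (s * real n)" by metis
    define D where "D = (\<Sum>b\<in>B. C b)"
    have F: "frame_norm B (mprod n x) \<le> D * exp (s * real n)" for n
      unfolding frame_norm_def D_def sum_distrib_right using C by (intro sum_mono)
    have pos: "0 < frame_norm B (mprod n x)" for n
    proof -
      have "0 < 1 / \<kappa> ^ n" using W.\<kappa>_ge_1 by simp
      with frame_norm_lower[OF B W.mprod_bilip[OF elim(2)] W.\<kappa>_power_ge_1, of n] show ?thesis by linarith
    qed
    have D: "0 < D" using pos[of 0] F[of 0] by simp
    have le: "ln (frame_norm B (mprod n x)) / real n \<le> ln D / real n + s" if "n \<ge> 1" for n
    proof -
      have "ln (frame_norm B (mprod n x)) \<le> ln (D * exp (s * real n))" using F pos by (intro ln_mono)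
      also have "\<dots> = ln D + s * real n" using D by (simp add: ln_mult_pos)
      finally show ?thesis using that by (simp add: field_simps)
    qed
    have "(\<lambda>n. ln D / real n + s) \<longlonglongrightarrow> 0 + s" by (intro tendsto_add lim_const_over_n tendsto_const)
    then have "\<gamma> \<le> 0 + s"
      using elim(1) le by (intro LIMSEQ_le[of _ \<gamma> _ "0 + s"]) auto
    then show ?case by simp
  qed
  then show ?thesis by simp
qed

section \<open>Hoelder continuity of the first exponent\<close>

lemma top_exponent:
  fixes \<nu> :: "(real^'n::finite^'n) measure"
  assumes \<nu>: "prob_measure_SL \<nu>" and W: "walk (supp_measure \<nu>) \<kappa>"
  shows "AE x in Pi\<^sub>M (UNIV :: nat set) (\<lambda>_. supp_measure \<nu>).
      (\<lambda>n. ln (frame_norm Basis (mprod n x)) / real n) \<longlonglongrightarrow> lyapunov_exponent 1 \<nu>"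
    "(\<lambda>n. (\<integral>x. ln (frame_norm Basis (mprod n x)) \<partial>(Pi\<^sub>M (UNIV :: nat set) (\<lambda>_. supp_measure \<nu>))) / real n)
      \<longlonglongrightarrow> lyapunov_exponent 1 \<nu>"
proof -
  interpret W: walk "supp_measure \<nu>" \<kappa> by fact
  have ne: "(Basis :: (real^'n) set) \<noteq> {}" by simp
  obtain \<gamma> where g: "AE x in W.S. (\<lambda>n. ln (frame_norm Basis (mprod n x)) / real n) \<longlonglongrightarrow> \<gamma>"
    "(\<lambda>n. (\<integral>x. ln (frame_norm Basis (mprod n x)) \<partial>W.S) / real n) \<longlonglongrightarrow> \<gamma>"
    using W.frame_exponent[OF orthonormal_Basis ne] by auto
  have "lyapunov_exponent_on (span Basis) 1 \<nu> = \<gamma>"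
    by (rule lyapunov_exponent_on_eqI[OF \<nu> W W.singular_value_exponent[OF orthonormal_Basis ne g(1)]])
  then have "lyapunov_exponent 1 \<nu> = \<gamma>" by simp
  with g show "AE x in W.S. (\<lambda>n. ln (frame_norm Basis (mprod n x)) / real n) \<longlonglongrightarrow> lyapunov_exponent 1 \<nu>"
    "(\<lambda>n. (\<integral>x. ln (frame_norm Basis (mprod n x)) \<partial>W.S) / real n) \<longlonglongrightarrow> lyapunov_exponent 1 \<nu>"
    by simp_all
qed

lemma second_exponent:
  fixes \<nu> :: "(real^'n::finite^'n) measure"
  assumes \<nu>: "prob_measure_SL \<nu>" and W: "walk (supp_measure \<nu>) \<kappa>" and d: "CARD('n) \<ge> 2"
  shows "(\<lambda>n. (\<integral>x. ln (wedge_norm (mprod n x)) \<partial>(Pi\<^sub>M (UNIV :: nat set) (\<lambda>_. supp_measure \<nu>))) / real n)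
    \<longlonglongrightarrow> lyapunov_exponent 1 \<nu> + lyapunov_exponent 2 \<nu>"
proof -
  interpret W: walk "supp_measure \<nu>" \<kappa> by fact
  have ne: "(Basis :: (real^'n) set) \<noteq> {}" by simp
  obtain \<gamma>' where g: "AE x in W.S. (\<lambda>n. ln (wedge_norm (mprod n x)) / real n) \<longlonglongrightarrow> \<gamma>'"
    "(\<lambda>n. (\<integral>x. ln (wedge_norm (mprod n x)) \<partial>W.S) / real n) \<longlonglongrightarrow> \<gamma>'"
    using W.wedge_exponent[OF d] by auto
  have "AE x in W.S. (\<lambda>n. ln (singular_value UNIV 1 (mprod n x)) / real n) \<longlonglongrightarrow> lyapunov_exponent 1 \<nu>"
    using W.singular_value_exponent[OF orthonormal_Basis ne top_exponent(1)[OF \<nu> W]] by simp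
  from lyapunov_exponent_on_eqI[OF \<nu> W W.singular_value_2_exponent[OF d this g(1)]]
  have "lyapunov_exponent 2 \<nu> = \<gamma>' - lyapunov_exponent 1 \<nu>" .
  with g(2) show ?thesis by simp
qed

text \<open>On \<open>V\<close> the exponent is at most \<open>s\<close>, because a basis of
  \<open>V\<close> consists of slow vectors. But \<open>V\<close> is either the whole space or an
  invariant proper subspace, and in both cases its exponent is the top one.\<close>

lemma quasi_irreducible_no_slow:
  fixes \<mu> :: "(real^'n::finite^'n) measure"
  assumes \<mu>: "prob_measure_SL \<mu>" and W: "walk (supp_measure \<mu>) \<kappa>" and qi: "quasi_irreducible \<mu>"
    and s: "s < lyapunov_exponent 1 \<mu>"
    and V: "subspace V" "V \<noteq> {0}"
    and inv: "\<And>w. w \<in> V \<Longrightarrow> AE g in supp_measure \<mu>. g *v w \<in> V"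
    and slow: "\<And>w. w \<in> V \<Longrightarrow> AE x in Pi\<^sub>M (UNIV :: nat set) (\<lambda>_. supp_measure \<mu>). slow s x w"
  shows False
proof -
  interpret W: walk "supp_measure \<mu>" \<kappa> by fact
  note r = supp_retract[OF \<mu>]
  \<comment> \<open>Quasi-irreducibility speaks of every matrix of the support. The matrices that
    move a fixed \<open>w\<close> out of the closed set \<open>V\<close> form an open set; being
    null, it misses the support.\<close>
  have inv_supp: "(\<lambda>v. g *v v) ` V \<subseteq> V" if g: "g \<in> supp \<mu>" for g
  proof safe
    fix w assume w: "w \<in> V"
    show "g *v w \<in> V"
    proof (rule ccontr)
      assume gw: "g *v w \<notin> V"
      define U where "U = (\<lambda>h. h *v w) -` (- V)"
      have "continuous_on UNIV (\<lambda>h :: real^'n^'n. h *v w)" by (intro continuous_intros)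
      moreover have "open (- V)" using closed_subspace[OF V(1)] by (simp add: open_Compl)
      ultimately have U: "open U" unfolding U_def using open_vimage by blast
      have "AE g in distr \<mu> (supp_measure \<mu>) (supp_retract \<mu>). g *v w \<in> V"
        unfolding r(3) by (rule inv[OF w])
      from AE_distrD[OF r(1) this] r(2) have "AE g in \<mu>. g \<notin> U \<inter> SL"
        by eventually_elim (simp add: U_def)
      then have "emeasure \<mu> (U \<inter> SL) = 0"
        using open_SL_sets[OF \<mu> U] by (simp add: AE_iff_null_sets null_setsD1)
      moreover have "g \<in> U" using gw by (simp add: U_def)
      ultimately show False using g U by (auto simp: supp_def)
    qed
  qed
  obtain B where B: "B \<subseteq> V" "pairwise orthogonal B" "\<And>x. x \<in> B \<Longrightarrow> norm x = 1" "span B = V"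
    using orthonormal_basis_subspace[OF V(1)] by metis
  have oB: "orthonormal B" using B by (simp add: orthonormal_def)
  have nB: "B \<noteq> {}" using B(4) V(2) by auto
  obtain \<gamma> where g: "AE x in W.S. (\<lambda>n. ln (frame_norm B (mprod n x)) / real n) \<longlonglongrightarrow> \<gamma>"
    using W.frame_exponent[OF oB nB] inv_supp unfolding r(4) B(4) by blast
  have "\<gamma> \<le> s"
    by (rule slow_frame_exponent_le[OF W oB nB g]) (use B(1) slow in blast)
  moreover have "lyapunov_exponent_on V 1 \<mu> = \<gamma>"
    using lyapunov_exponent_on_eqI[OF \<mu> W W.singular_value_exponent[OF oB nB g]] by (simp add: B(4))
  \<comment> \<open>If \<open>V\<close> is proper, the first alternative of quasi-irreducibility
    fails and the second one identifies \<open>V\<close> with the subspace that realizes the top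
    exponent.\<close>
  moreover have "lyapunov_exponent_on V 1 \<mu> = lyapunov_exponent 1 \<mu>"
  proof (cases "V = UNIV")
    case False
    then have "proper_invariant_subspace \<mu> V"
      using V inv_supp by (simp add: proper_invariant_subspace_def)
    then show ?thesis using qi unfolding quasi_irreducible_def by blast
  qed simp
  ultimately show False using s by simp
qed

theorem theorem1p3:
  fixes K :: "(real^'n::finite^'n) set" and \<mu> :: "(real^'n^'n) measure"
  assumes "CARD('n) \<ge> 2"
    and "compact K" and "K \<subseteq> SL"
    and "prob_measure_SL \<mu>" and "supp \<mu> \<subseteq> K"
    and "quasi_irreducible \<mu>"
    and "lyapunov_exponent 1 \<mu> > lyapunov_exponent 2 \<mu>"
  shows "\<exists>\<delta>>0. \<exists>C::real. \<exists>\<theta>>0. \<forall>\<nu>\<^sub>1 \<nu>\<^sub>2.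
    prob_measure_SL \<nu>\<^sub>1 \<longrightarrow> supp \<nu>\<^sub>1 \<subseteq> K \<longrightarrow> wasserstein \<nu>\<^sub>1 \<mu> < \<delta> \<longrightarrow>
    prob_measure_SL \<nu>\<^sub>2 \<longrightarrow> supp \<nu>\<^sub>2 \<subseteq> K \<longrightarrow> wasserstein \<nu>\<^sub>2 \<mu> < \<delta> \<longrightarrow>
    \<bar>lyapunov_exponent 1 \<nu>\<^sub>1 - lyapunov_exponent 1 \<nu>\<^sub>2\<bar> \<le> C * wasserstein \<nu>\<^sub>1 \<nu>\<^sub>2 powr \<theta>"
proof -
  note \<mu> = assms(4)
  obtain \<kappa> where \<kappa>: "1 \<le> \<kappa>" "K \<subseteq> bilip \<kappa>"
    using compact_SL_bilip[OF assms(2,3)] .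
  have walk: "walk (supp_measure \<nu>) \<kappa>" if "prob_measure_SL \<nu>" "supp \<nu> \<subseteq> K" for \<nu>
    by (rule supp_measure_walk[OF that \<kappa>(2,1)])
  have W: "walk (supp_measure \<mu>) \<kappa>" by (rule walk[OF \<mu> assms(5)])
  interpret W: walk "supp_measure \<mu>" \<kappa> by (rule W)
  let ?d = "real CARD('n)"
  have d: "?d > 0" by simp

  have growth: "\<exists>C. \<forall>n v. v \<noteq> 0 \<longrightarrow> real n * (lyapunov_exponent 1 \<mu> - \<epsilon>) - C \<le> (\<integral>x. ln_stretch (mprod n x) v \<partial>W.S)"
    if "\<epsilon> > 0" for \<epsilon>
    by (rule W.uniform_growth[OF _ that], rule quasi_irreducible_no_slow[OF \<mu> W assms(6)])
  have gap: "lyapunov_exponent 1 \<mu> + lyapunov_exponent 2 \<mu> < 2 * lyapunov_exponent 1 \<mu>"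
    using assms(7) by simp
  obtain m \<alpha> r where m: "m \<ge> 1" and \<alpha>: "0 < \<alpha>" "\<alpha> \<le> 1" and r: "0 < r" "r < 1"
    and contr: "\<And>u v. u \<noteq> 0 \<Longrightarrow> v \<noteq> 0 \<Longrightarrow> W.moment m \<alpha> u v \<le> r ^ m * pdist u v powr \<alpha>"
    using W.contraction[OF assms(1) growth second_exponent[OF \<mu> W assms(1)] gap] by blast
  obtain R C1 C2 where "gauge R \<alpha> \<kappa> C1 C2"
    and RW: "\<And>u v. u \<noteq> 0 \<Longrightarrow> v \<noteq> 0 \<Longrightarrow> (\<integral>g. R (g *v u) (g *v v) \<partial>supp_measure \<mu>) \<le> r * R u v"
    using W.gauge_exists[OF m \<alpha> r(1) contr] by blast
  interpret gauge R \<alpha> \<kappa> C1 C2 by fact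

  \<comment> \<open>Chosen so that the perturbation of the rate for a coupling of cost at most
    \<open>e\<close>, namely \<open>2 * C2 * e powr \<alpha>\<close>, equals
    \<open>(1 - r) / 2\<close>. The rate then moves from \<open>r\<close> to the midpoint
    \<open>r'\<close> of \<open>r\<close> and \<open>1\<close>.\<close>
  define e where "e = ((1 - r) / (4 * C2)) powr (1 / \<alpha>)"
  have e: "0 < e" using r C2 by (simp add: e_def)
  have e\<alpha>: "e powr \<alpha> = (1 - r) / (4 * C2)"
    using r C2 \<alpha> by (simp add: e_def powr_powr)
  define r' where "r' = (1 + r) / 2"
  have r': "0 \<le> r'" "r' < 1" using r by (auto simp: r'_def)
  define B where "B = 2 * \<kappa>\<^sup>2 / (1 - r')"
  have B: "0 \<le> B" using r' by (simp add: B_def)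
  define A where "A = 2 * ?d * \<kappa>\<^sup>2 + B * C1 * (2 * \<kappa>)"
  have A: "0 \<le> A" using B C1 k by (simp add: A_def)
  have powr_self: "t powr \<alpha> + t powr (\<alpha> - 1) * t = 2 * t powr \<alpha>" if "0 < t" for t
    using that by (simp add: powr_diff)

  \<comment> \<open>The radius is \<open>e / ?d\<close> because \<open>wasserstein_coupling\<close>
    returns a Frobenius cost, larger by the factor \<open>?d\<close>.\<close>
  have near: "log_gap (supp_measure \<nu>) n u v \<le> B * R u v"
    if \<nu>: "prob_measure_SL \<nu>" "supp \<nu> \<subseteq> K" and close: "wasserstein \<nu> \<mu> < e / ?d" and uv: "u \<noteq> 0" "v \<noteq> 0" for \<nu> n u v
  proof -
    obtain \<pi> where \<pi>: "\<pi> \<in> couplings (supp_measure \<nu>) (supp_measure \<mu>)" "(\<integral>p. norm (fst p - snd p) \<partial>\<pi>) \<le> ?d * (e / ?d)"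
      using wasserstein_coupling[OF \<nu>(1) walk[OF \<nu>] \<mu> W close] by blast
    have \<pi>e: "(\<integral>p. norm (fst p - snd p) \<partial>\<pi>) \<le> e" using \<pi>(2) d by simp
    have "C2 * (e powr \<alpha> + e powr (\<alpha> - 1) * e) = (1 - r) / 2"
      unfolding powr_self[OF e] unfolding e\<alpha> using C2 by (simp add: field_simps)
    then have r'_eq: "r + C2 * (e powr \<alpha> + e powr (\<alpha> - 1) * e) = r'" by (simp add: r'_def field_simps)
    have "(\<integral>g. R (g *v u) (g *v v) \<partial>supp_measure \<nu>) \<le> r' * R u v" if "u \<noteq> 0" "v \<noteq> 0" for u v
      using contraction_perturb[OF walk[OF \<nu>] W \<pi>(1) \<pi>e e RW[OF that] that] unfolding r'_eq .
    then show ?thesis unfolding B_def by (rule log_gap_bound[OF walk[OF \<nu>] r' _ uv])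
  qed
  \<comment> \<open>The gauge is bounded, so the gap bound is uniform in the directions as well as
    in \<open>n\<close>.\<close>
  have L1: "(\<lambda>n. mean_log (supp_measure \<nu>) n v / real n) \<longlonglongrightarrow> lyapunov_exponent 1 \<nu>"
    if \<nu>: "prob_measure_SL \<nu>" "supp \<nu> \<subseteq> K" and close: "wasserstein \<nu> \<mu> < e / ?d" and v: "v \<noteq> 0" for \<nu> v
  proof (rule walk.mean_log_tendsto[OF walk[OF \<nu>] _ v top_exponent(2)[OF \<nu>(1) walk[OF \<nu>]]])
    fix n and u v :: "real^'n" assume uv: "u \<noteq> 0" "v \<noteq> 0"
    have "log_gap (supp_measure \<nu>) n u v \<le> B * R u v" by (rule near[OF \<nu> close uv])
    also have "\<dots> \<le> B * (C1 * 2 powr \<alpha>)" by (intro mult_left_mono R_le uv B)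
    finally show "log_gap (supp_measure \<nu>) n u v \<le> B * (C1 * 2 powr \<alpha>)" .
  qed

  have main: "\<bar>lyapunov_exponent 1 \<nu>\<^sub>1 - lyapunov_exponent 1 \<nu>\<^sub>2\<bar> \<le> (2 * A * ?d powr \<alpha>) * wasserstein \<nu>\<^sub>1 \<nu>\<^sub>2 powr \<alpha>"
    if \<nu>1: "prob_measure_SL \<nu>\<^sub>1" "supp \<nu>\<^sub>1 \<subseteq> K" and close1: "wasserstein \<nu>\<^sub>1 \<mu> < e / ?d"
      and \<nu>2: "prob_measure_SL \<nu>\<^sub>2" "supp \<nu>\<^sub>2 \<subseteq> K" and close2: "wasserstein \<nu>\<^sub>2 \<mu> < e / ?d" for \<nu>\<^sub>1 \<nu>\<^sub>2
  proof -
    let ?w = "wasserstein \<nu>\<^sub>1 \<nu>\<^sub>2"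
    obtain v :: "real^'n" where v: "v \<noteq> 0" using zero_neq_one by blast
    have w0: "0 \<le> ?w" by (simp add: wasserstein_def)
    \<comment> \<open>The estimate is proved for every \<open>w\<close> above the distance and then
      passed to the limit: only nearly optimal couplings are available, and a positive
      \<open>w\<close> is needed as a scale even if the distance is \<open>0\<close>.\<close>
    have le: "\<bar>lyapunov_exponent 1 \<nu>\<^sub>1 - lyapunov_exponent 1 \<nu>\<^sub>2\<bar> \<le> (2 * A * ?d powr \<alpha>) * w powr \<alpha>"
      if w: "?w < w" for w
    proof -
      have wp: "0 < ?d * w" using w w0 d by simp
      obtain \<pi> where \<pi>: "\<pi> \<in> couplings (supp_measure \<nu>\<^sub>1) (supp_measure \<nu>\<^sub>2)" "(\<integral>p. norm (fst p - snd p) \<partial>\<pi>) \<le> ?d * w"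
        using wasserstein_coupling[OF \<nu>1(1) walk[OF \<nu>1] \<nu>2(1) walk[OF \<nu>2] w] by blast
      have bound: "\<bar>mean_log (supp_measure \<nu>\<^sub>1) n v / real n - mean_log (supp_measure \<nu>\<^sub>2) n v / real n\<bar> \<le>
          (2 * A * ?d powr \<alpha>) * w powr \<alpha>" if n: "n \<ge> 1" for n
      proof -
        \<comment> \<open>The scale of the affine majorant is set equal to the cost
          \<open>?d * w\<close>, which makes its two terms equal and gives the power
          \<open>\<alpha>\<close> of the cost.\<close>
        have "\<bar>mean_log (supp_measure \<nu>\<^sub>1) n v - mean_log (supp_measure \<nu>\<^sub>2) n v\<bar> \<le>
            real n * (A * ((?d * w) powr \<alpha> + (?d * w) powr (\<alpha> - 1) * (?d * w)))"
          unfolding A_def by (rule mean_log_perturb[OF walk[OF \<nu>1] walk[OF \<nu>2] \<pi> wp near[OF \<nu>1 close1] B v])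
        also have "\<dots> = (2 * A * ?d powr \<alpha>) * w powr \<alpha> * real n"
          unfolding powr_self[OF wp] using w w0 by (simp add: powr_mult)
        finally show ?thesis
          using n by (simp flip: diff_divide_distrib add: divide_le_eq)
      qed
      have "(\<lambda>n. \<bar>mean_log (supp_measure \<nu>\<^sub>1) n v / real n - mean_log (supp_measure \<nu>\<^sub>2) n v / real n\<bar>)
          \<longlonglongrightarrow> \<bar>lyapunov_exponent 1 \<nu>\<^sub>1 - lyapunov_exponent 1 \<nu>\<^sub>2\<bar>"
        by (intro tendsto_rabs tendsto_diff L1 \<nu>1 \<nu>2 close1 close2 v)
      then show ?thesis by (rule LIMSEQ_le_const2) (use bound in auto)
    qed
    have "(\<lambda>n. ?w + 1 / Suc n) \<longlonglongrightarrow> ?w + 0"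
      using LIMSEQ_inverse_real_of_nat by (intro tendsto_add tendsto_const) (simp add: inverse_eq_divide)
    then have "(\<lambda>n. (?w + 1 / Suc n) powr \<alpha>) \<longlonglongrightarrow> ?w powr \<alpha>"
      using \<alpha> w0 by (intro tendsto_powr'[OF _ tendsto_const]) (auto intro!: always_eventually)
    then have "(\<lambda>n. (2 * A * ?d powr \<alpha>) * (?w + 1 / Suc n) powr \<alpha>) \<longlonglongrightarrow> (2 * A * ?d powr \<alpha>) * ?w powr \<alpha>"
      by (intro tendsto_mult tendsto_const)
    then show ?thesis
    proof (rule LIMSEQ_le_const)
      show "\<exists>N. \<forall>n\<ge>N. \<bar>lyapunov_exponent 1 \<nu>\<^sub>1 - lyapunov_exponent 1 \<nu>\<^sub>2\<bar> \<le> (2 * A * ?d powr \<alpha>) * (?w + 1 / Suc n) powr \<alpha>"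
        by (intro exI[of _ 0] allI impI le) simp
    qed
  qed
  have "0 < e / ?d" using e d by simp
  then show ?thesis using main \<alpha>(1) by blast
qed

end
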